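(* Let $\Omega \subset \mathbb{R}^d$ ($d \ge 1$) be a convex polytope (with nonempty interior) which is centrally symmetric and all of whose faces of all dimensions are also centrally symmetric. Then there exists a set $\Lambda \subset \mathbb{R}^d$ such that the system of exponential functions $E(\Lambda) = \{e_\lambda\}_{\lambda \in \Lambda}$, $e_\lambda(x) = e^{2\pi i \langle \lambda, x\rangle}$, is a Riesz basis in $L^2(\Omega)$.
   Context: A convex polytope is the convex hull of finitely many points. A convex polytope $\Omega$ is centrally symmetric if $-\Omega$ is a translate of $\Omega$. A system $\{f_n\}$ in a separable Hilbert space $H$ is a Riesz basis if it is the image of an orthonormal basis of $H$ under a bounded, invertible linear operator on $H$. *)

theory Defs
  imports "HOL-Analysis.Analysis"
begin

definition centrally_symmetric :: "'a::real_vector set \<Rightarrow> bool" where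
  "centrally_symmetric S \<longleftrightarrow> (\<exists>t. uminus ` S = (\<lambda>x. t + x) ` S)"

text \<open>The space L2(M) of complex-valued square integrable functions; elements
  are functions, identified when equal almost everywhere.\<close>
definition L2 :: "'a measure \<Rightarrow> ('a \<Rightarrow> complex) set" where
  "L2 M = {f. f \<in> borel_measurable M \<and> integrable M (\<lambda>x. (cmod (f x))\<^sup>2)}"

definition ae_eq :: "'a measure \<Rightarrow> ('a \<Rightarrow> complex) \<Rightarrow> ('a \<Rightarrow> complex) \<Rightarrow> bool" where
  "ae_eq M f g \<longleftrightarrow> (AE x in M. f x = g x)"

definition L2_inner :: "'a measure \<Rightarrow> ('a \<Rightarrow> complex) \<Rightarrow> ('a \<Rightarrow> complex) \<Rightarrow> complex" where
  "L2_inner M f g = (LINT x|M. f x * cnj (g x))"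

definition L2_norm :: "'a measure \<Rightarrow> ('a \<Rightarrow> complex) \<Rightarrow> real" where
  "L2_norm M f = sqrt (LINT x|M. (cmod (f x))\<^sup>2)"

definition L2_orthonormal_basis :: "'a measure \<Rightarrow> 'i set \<Rightarrow> ('i \<Rightarrow> 'a \<Rightarrow> complex) \<Rightarrow> bool" where
  "L2_orthonormal_basis M I u \<longleftrightarrow>
     (\<forall>i\<in>I. u i \<in> L2 M) \<and>
     (\<forall>i\<in>I. \<forall>j\<in>I. L2_inner M (u i) (u j) = (if i = j then 1 else 0)) \<and>
     (\<forall>f\<in>L2 M. (\<forall>i\<in>I. L2_inner M f (u i) = 0) \<longrightarrow> ae_eq M f (\<lambda>x. 0))"

definition L2_bounded_linear :: "'a measure \<Rightarrow> (('a \<Rightarrow> complex) \<Rightarrow> ('a \<Rightarrow> complex)) \<Rightarrow> bool" where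
  "L2_bounded_linear M T \<longleftrightarrow>
     (\<forall>f\<in>L2 M. T f \<in> L2 M) \<and>
     (\<forall>f\<in>L2 M. \<forall>g\<in>L2 M. ae_eq M f g \<longrightarrow> ae_eq M (T f) (T g)) \<and>
     (\<forall>f\<in>L2 M. \<forall>g\<in>L2 M. \<forall>a b::complex.
         ae_eq M (T (\<lambda>x. a * f x + b * g x)) (\<lambda>x. a * T f x + b * T g x)) \<and>
     (\<exists>C. \<forall>f\<in>L2 M. L2_norm M (T f) \<le> C * L2_norm M f)"

definition L2_bounded_invertible :: "'a measure \<Rightarrow> (('a \<Rightarrow> complex) \<Rightarrow> ('a \<Rightarrow> complex)) \<Rightarrow> bool" where
  "L2_bounded_invertible M T \<longleftrightarrow> L2_bounded_linear M T \<and>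
     (\<exists>S. L2_bounded_linear M S \<and>
          (\<forall>f\<in>L2 M. ae_eq M (S (T f)) f) \<and> (\<forall>f\<in>L2 M. ae_eq M (T (S f)) f))"

definition L2_riesz_basis :: "'a measure \<Rightarrow> 'i set \<Rightarrow> ('i \<Rightarrow> 'a \<Rightarrow> complex) \<Rightarrow> bool" where
  "L2_riesz_basis M I e \<longleftrightarrow>
     (\<exists>u T. L2_orthonormal_basis M I u \<and> L2_bounded_invertible M T \<and>
            (\<forall>i\<in>I. ae_eq M (T (u i)) (e i)))"

definition exponential :: "'a::euclidean_space \<Rightarrow> 'a \<Rightarrow> complex" where
  "exponential l x = exp (complex_of_real (2 * pi * (l \<bullet> x)) * \<i>)"

end

(* A polytope all of whose faces are symmetric is a zonotope: if [a, a+u] is an edge, then the fibres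
   of the polytope over the vertices of its projection along u all contain a translate of [0,u],
   because a symmetric two-dimensional face carries this property across an edge of the projection.
   Hence [0,u] is a Minkowski summand, and splitting it off lowers the number of vertices.

   Let Omega = Omega1 + [0,u] with Omega1 a zonotope, and let Q be the product of [0,u] and the
   projection of Omega along u.  Periodization along u maps L2(Omega) to L2(Q), and its kernel is the
   set of the differences g(x-u) - g(x) with g in L2(Omega1).  So a Riesz basis of exponentials for
   Omega1, whose frequencies l keep exp(2 pi i <l,u>) away from 1, together with one for Q, whose
   frequencies satisfy <l,u> in Z, is a Riesz basis for Omega.  The first condition is arranged by a
   small perturbation of the frequencies along u, the second one is carried through the induction.
   The induction starts from orthogonal boxes (Fourier series) and from null sets (no frequency). *)

theory Submission
  imports Defs
begin

subsection \<open>The space L2\<close>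

text \<open>The two frequency sets of the recursive step satisfy opposite conditions along u, and
  this makes the combined system triangular: taking the difference of h at x + u and x erases the
  periodic half and multiplies each remaining coefficient by a factor bounded below. One half is
  therefore estimated first and the other from the remainder. For completeness the same mechanism is
  read backwards: a function with vanishing periodization has a primitive along u, and convexity
  confines this primitive to the smaller zonotope.

  Projections make generators parallel or zero, and the smaller zonotope may lose its interior.

  The definition of a Riesz basis by an invertible operator is hard to pass through a recursion. The
  analysis works instead with three separate properties, a Bessel bound, a lower bound for finite
  combinations, and completeness, and builds the operator from them only once.\<close>

lemma L2_measurable: "f \<in> L2 M \<Longrightarrow> f \<in> borel_measurable M"
  and L2_integrable_sq: "f \<in> L2 M \<Longrightarrow> integrable M (\<lambda>x. (cmod (f x))\<^sup>2)"
  by (auto simp: L2_def)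

lemma L2_I:
  assumes "f \<in> borel_measurable M" "integrable M g" "\<And>x. x \<in> space M \<Longrightarrow> (cmod (f x))\<^sup>2 \<le> g x"
  shows "f \<in> L2 M"
proof -
  have "integrable M (\<lambda>x. (cmod (f x))\<^sup>2)"
  proof (rule Bochner_Integration.integrable_bound[OF assms(2)])
    show "AE x in M. norm ((cmod (f x))\<^sup>2) \<le> norm (g x)"
      using assms(3) by (intro AE_I2) fastforce
  qed (use assms(1) in measurable)
  then show ?thesis using assms(1) by (simp add: L2_def)
qed

lemma L2_zero [simp]: "(\<lambda>x. 0) \<in> L2 M"
  by (simp add: L2_def)

lemma norm_add_sq_le: "(cmod (a + b))\<^sup>2 \<le> 2 * (cmod a)\<^sup>2 + 2 * (cmod b)\<^sup>2"
proof -
  have "(cmod (a + b))\<^sup>2 \<le> (cmod a + cmod b)\<^sup>2"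
    by (intro power_mono norm_triangle_ineq) auto
  also have "\<dots> \<le> 2 * (cmod a)\<^sup>2 + 2 * (cmod b)\<^sup>2"
    using sum_squares_bound[of "cmod a" "cmod b"] by (simp add: power2_sum)
  finally show ?thesis .
qed

lemma L2_add [intro]:
  assumes "f \<in> L2 M" "g \<in> L2 M" shows "(\<lambda>x. f x + g x) \<in> L2 M"
proof (rule L2_I)
  show "integrable M (\<lambda>x. 2 * (cmod (f x))\<^sup>2 + 2 * (cmod (g x))\<^sup>2)"
    using assms by (auto simp: L2_def)
qed (use assms norm_add_sq_le in \<open>auto simp: L2_def\<close>)

lemma L2_cmult [intro]: "f \<in> L2 M \<Longrightarrow> (\<lambda>x. c * f x) \<in> L2 M"
  by (auto simp: L2_def norm_mult power_mult_distrib)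

lemma L2_diff [intro]: "f \<in> L2 M \<Longrightarrow> g \<in> L2 M \<Longrightarrow> (\<lambda>x. f x - g x) \<in> L2 M"
  using L2_add[OF _ L2_cmult[of g M "-1"], of f] by simp

lemma L2_sum [intro]: "(\<And>i. i \<in> F \<Longrightarrow> f i \<in> L2 M) \<Longrightarrow> (\<lambda>x. \<Sum>i\<in>F. f i x) \<in> L2 M"
  by (induction F rule: infinite_finite_induct) auto

lemma borel_measurable_cnj [measurable]:
  "f \<in> borel_measurable M \<Longrightarrow> (\<lambda>x. cnj (f x)) \<in> borel_measurable M"
  by (rule borel_measurable_continuous_on[of cnj]) (auto intro: continuous_intros)

lemma L2_prod_integrable [intro]:
  assumes "f \<in> L2 M" "g \<in> L2 M" shows "integrable M (\<lambda>x. f x * cnj (g x))"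
proof (rule Bochner_Integration.integrable_bound)
  show "integrable M (\<lambda>x. (cmod (f x))\<^sup>2 + (cmod (g x))\<^sup>2)"
    using assms by (auto simp: L2_def)
  have "(cmod a) * (cmod b) \<le> (cmod a)\<^sup>2 + (cmod b)\<^sup>2" for a b
    using sum_squares_bound[of "cmod a" "cmod b"] mult_nonneg_nonneg[OF norm_ge_zero norm_ge_zero, of a b]
    by linarith
  then show "AE x in M. norm (f x * cnj (g x)) \<le> norm ((cmod (f x))\<^sup>2 + (cmod (g x))\<^sup>2)"
    by (intro AE_I2) (simp add: norm_mult)
qed (use assms in \<open>auto simp: L2_def\<close>)

lemma L2_inner_add_left:
  "f \<in> L2 M \<Longrightarrow> g \<in> L2 M \<Longrightarrow> h \<in> L2 M \<Longrightarrow>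
    L2_inner M (\<lambda>x. f x + g x) h = L2_inner M f h + L2_inner M g h"
  by (simp add: L2_inner_def distrib_right Bochner_Integration.integral_add[OF L2_prod_integrable L2_prod_integrable])

lemma L2_inner_add_right:
  "f \<in> L2 M \<Longrightarrow> g \<in> L2 M \<Longrightarrow> h \<in> L2 M \<Longrightarrow>
    L2_inner M h (\<lambda>x. f x + g x) = L2_inner M h f + L2_inner M h g"
  by (simp add: L2_inner_def distrib_left Bochner_Integration.integral_add[OF L2_prod_integrable L2_prod_integrable])

lemma L2_inner_cmult_left: "L2_inner M (\<lambda>x. c * f x) h = c * L2_inner M f h"
  by (simp add: L2_inner_def mult.assoc)

lemma L2_inner_cmult_right: "L2_inner M h (\<lambda>x. c * f x) = cnj c * L2_inner M h f"
  by (simp add: L2_inner_def mult.left_commute)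

lemma L2_inner_zero_left [simp]: "L2_inner M (\<lambda>x. 0) h = 0"
  and L2_inner_zero_right [simp]: "L2_inner M h (\<lambda>x. 0) = 0"
  by (simp_all add: L2_inner_def)

lemma L2_inner_diff_left:
  "f \<in> L2 M \<Longrightarrow> g \<in> L2 M \<Longrightarrow> h \<in> L2 M \<Longrightarrow>
    L2_inner M (\<lambda>x. f x - g x) h = L2_inner M f h - L2_inner M g h"
  using L2_inner_add_left[OF _ L2_cmult[of g M "-1"], of f h] L2_inner_cmult_left[of M "-1" g h] by simp

lemma L2_inner_diff_right:
  "f \<in> L2 M \<Longrightarrow> g \<in> L2 M \<Longrightarrow> h \<in> L2 M \<Longrightarrow>
    L2_inner M h (\<lambda>x. f x - g x) = L2_inner M h f - L2_inner M h g"
  using L2_inner_add_right[OF _ L2_cmult[of g M "-1"], of f h] L2_inner_cmult_right[of M h "-1" g] by simp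

lemma L2_inner_sum_left:
  assumes "\<And>i. i \<in> F \<Longrightarrow> f i \<in> L2 M" "h \<in> L2 M"
  shows "L2_inner M (\<lambda>x. \<Sum>i\<in>F. f i x) h = (\<Sum>i\<in>F. L2_inner M (f i) h)"
  using assms(1)
proof (induction F rule: infinite_finite_induct)
  case (insert i F)
  then have "L2_inner M (\<lambda>x. f i x + (\<Sum>i\<in>F. f i x)) h = L2_inner M (f i) h + L2_inner M (\<lambda>x. \<Sum>i\<in>F. f i x) h"
    using assms(2) by (intro L2_inner_add_left) auto
  with insert show ?case by simp
qed auto

lemma L2_inner_commute: "L2_inner M f g = cnj (L2_inner M g f)"
  unfolding L2_inner_def by (subst Bochner_Integration.integral_cnj[symmetric]) (simp add: mult.commute)

lemma L2_inner_sum_right: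
  assumes "\<And>i. i \<in> F \<Longrightarrow> f i \<in> L2 M" "h \<in> L2 M"
  shows "L2_inner M h (\<lambda>x. \<Sum>i\<in>F. f i x) = (\<Sum>i\<in>F. L2_inner M h (f i))"
  by (subst L2_inner_commute, subst L2_inner_sum_left[OF assms])
     (auto simp: L2_inner_commute[of M h])

lemma L2_norm_nonneg [simp]: "0 \<le> L2_norm M f"
  by (simp add: L2_norm_def)

lemma L2_norm_sq: "(L2_norm M f)\<^sup>2 = (LINT x|M. (cmod (f x))\<^sup>2)"
  by (simp add: L2_norm_def)

lemma L2_inner_self: "L2_inner M f f = complex_of_real ((L2_norm M f)\<^sup>2)"
proof -
  have "(\<lambda>x. f x * cnj (f x)) = (\<lambda>x. complex_of_real ((cmod (f x))\<^sup>2))"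
    by (simp only: complex_norm_square)
  then show ?thesis by (simp only: L2_inner_def L2_norm_sq integral_complex_of_real)
qed

lemma L2_norm_zero [simp]: "L2_norm M (\<lambda>x. 0) = 0"
  by (simp add: L2_norm_def)

lemma L2_norm_cmult: "L2_norm M (\<lambda>x. c * f x) = cmod c * L2_norm M f"
  by (simp add: L2_norm_def norm_mult power_mult_distrib real_sqrt_mult)

lemma L2_norm_minus_commute: "L2_norm M (\<lambda>x. f x - g x) = L2_norm M (\<lambda>x. g x - f x)"
  by (simp add: L2_norm_def norm_minus_commute)

lemma ae_eq_refl [simp]: "ae_eq M f f" by (simp add: ae_eq_def)

lemma L2_norm_eq_0_iff:
  assumes "f \<in> L2 M" shows "L2_norm M f = 0 \<longleftrightarrow> ae_eq M f (\<lambda>x. 0)"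
  using integral_nonneg_eq_0_iff_AE[OF L2_integrable_sq[OF assms]]
  by (simp add: L2_norm_def ae_eq_def)

lemma ae_eq_iff_L2_norm_diff:
  assumes "f \<in> L2 M" "g \<in> L2 M" shows "ae_eq M f g \<longleftrightarrow> L2_norm M (\<lambda>x. f x - g x) = 0"
  using L2_norm_eq_0_iff[OF L2_diff[OF assms]] by (simp add: ae_eq_def)

lemma L2_inner_cong:
  assumes "ae_eq M f f'" "ae_eq M g g'" "f \<in> L2 M" "f' \<in> L2 M" "g \<in> L2 M" "g' \<in> L2 M"
  shows "L2_inner M f g = L2_inner M f' g'"
  unfolding L2_inner_def
  by (rule integral_cong_AE) (use assms in \<open>auto simp: L2_def ae_eq_def elim: eventually_elim2\<close>)

lemma L2_norm_add_sq:
  assumes "f \<in> L2 M" "g \<in> L2 M"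
  shows "(L2_norm M (\<lambda>x. f x + g x))\<^sup>2 = (L2_norm M f)\<^sup>2 + 2 * Re (L2_inner M f g) + (L2_norm M g)\<^sup>2"
proof -
  have "L2_inner M (\<lambda>x. f x + g x) (\<lambda>x. f x + g x) =
    L2_inner M f f + (L2_inner M f g + cnj (L2_inner M f g)) + L2_inner M g g"
    using assms by (simp add: L2_inner_add_left L2_inner_add_right L2_add L2_inner_commute[of M g f])
  then have "complex_of_real ((L2_norm M (\<lambda>x. f x + g x))\<^sup>2) =
    complex_of_real ((L2_norm M f)\<^sup>2 + 2 * Re (L2_inner M f g) + (L2_norm M g)\<^sup>2)"
    unfolding L2_inner_self by (simp add: complex_add_cnj)
  then show ?thesis by (simp only: of_real_eq_iff)
qed

lemma L2_norm_diff_sq: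
  assumes "f \<in> L2 M" "g \<in> L2 M"
  shows "(L2_norm M (\<lambda>x. f x - g x))\<^sup>2 = (L2_norm M f)\<^sup>2 - 2 * Re (L2_inner M f g) + (L2_norm M g)\<^sup>2"
  using L2_norm_add_sq[OF assms(1) L2_cmult[OF assms(2), of "-1"]] L2_norm_cmult[of M "-1" g]
    L2_inner_cmult_right[of M f "-1" g] by simp

lemma L2_Cauchy_Schwarz:
  assumes f: "f \<in> L2 M" and g: "g \<in> L2 M"
  shows "cmod (L2_inner M f g) \<le> L2_norm M f * L2_norm M g"
proof (cases "L2_norm M g = 0")
  case True
  then have "ae_eq M g (\<lambda>x. 0)" using L2_norm_eq_0_iff[OF g] by simp
  then have "L2_inner M f g = L2_inner M f (\<lambda>x. 0)" using f g by (intro L2_inner_cong) auto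
  then show ?thesis by simp
next
  case False
  define n where "n = (L2_norm M g)\<^sup>2"
  have n: "n > 0" using False by (simp add: n_def)
  define z where "z = L2_inner M f g"
  define c where "c = z / complex_of_real n"
  have "0 \<le> (L2_norm M (\<lambda>x. f x - c * g x))\<^sup>2" by simp
  also have "\<dots> = (L2_norm M f)\<^sup>2 - 2 * Re (cnj c * z) + (cmod c)\<^sup>2 * n"
    using f g by (simp add: L2_norm_diff_sq L2_cmult L2_inner_cmult_right L2_norm_cmult power_mult_distrib n_def z_def)
  also have "cnj c * z = complex_of_real ((cmod z)\<^sup>2 / n)"
    unfolding c_def of_real_divide complex_norm_square by (simp add: mult.commute)
  also have "(cmod c)\<^sup>2 * n = (cmod z)\<^sup>2 / n"
    using n by (simp add: c_def norm_divide power_divide power2_eq_square)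
  finally have "(cmod z)\<^sup>2 / n \<le> (L2_norm M f)\<^sup>2" by simp
  then have "(cmod z)\<^sup>2 \<le> (L2_norm M f * L2_norm M g)\<^sup>2"
    using n by (simp add: n_def power_mult_distrib divide_le_eq)
  then show ?thesis unfolding z_def by (rule power2_le_imp_le) simp
qed

lemma L2_norm_triangle:
  assumes f: "f \<in> L2 M" and g: "g \<in> L2 M"
  shows "L2_norm M (\<lambda>x. f x + g x) \<le> L2_norm M f + L2_norm M g"
proof (rule power2_le_imp_le)
  have "Re (L2_inner M f g) \<le> L2_norm M f * L2_norm M g"
    using L2_Cauchy_Schwarz[OF f g] complex_Re_le_cmod order_trans by blast
  then show "(L2_norm M (\<lambda>x. f x + g x))\<^sup>2 \<le> (L2_norm M f + L2_norm M g)\<^sup>2"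
    by (simp add: L2_norm_add_sq[OF f g] power2_sum)
qed simp

lemma L2_norm_triangle_diff:
  assumes f: "f \<in> L2 M" and g: "g \<in> L2 M"
  shows "L2_norm M (\<lambda>x. f x - g x) \<le> L2_norm M f + L2_norm M g"
  using L2_norm_triangle[OF f L2_cmult[OF g, of "-1"]] L2_norm_cmult[of M "-1" g] by simp

lemma L2_norm_triangle_sub:
  assumes f: "f \<in> L2 M" and g: "g \<in> L2 M"
  shows "L2_norm M f \<le> L2_norm M g + L2_norm M (\<lambda>x. f x - g x)"
  using L2_norm_triangle[OF g L2_diff[OF f g]] by simp

lemma L2_norm_triangle3:
  assumes "f \<in> L2 M" "g \<in> L2 M" "h \<in> L2 M"
  shows "L2_norm M (\<lambda>x. f x - h x) \<le> L2_norm M (\<lambda>x. f x - g x) + L2_norm M (\<lambda>x. g x - h x)"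
  using L2_norm_triangle[OF L2_diff[OF assms(1,2)] L2_diff[OF assms(2,3)]] by simp

lemma nn_integral_L2_norm:
  assumes "f \<in> L2 M"
  shows "(\<integral>\<^sup>+x. ennreal ((cmod (f x))\<^sup>2) \<partial>M) = ennreal ((L2_norm M f)\<^sup>2)"
  unfolding L2_norm_sq using assms by (intro nn_integral_eq_integral) (auto simp: L2_def)

lemma L2_norm_le_nn_integral:
  assumes "f \<in> borel_measurable M" "(\<integral>\<^sup>+x. ennreal ((cmod (f x))\<^sup>2) \<partial>M) \<le> ennreal (c\<^sup>2)" "0 \<le> c"
  shows "f \<in> L2 M" "L2_norm M f \<le> c"
proof -
  note [measurable] = assms(1)
  have "integrable M (\<lambda>x. (cmod (f x))\<^sup>2)"
  proof (rule integrableI_nonneg)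
    show "(\<integral>\<^sup>+x. ennreal ((cmod (f x))\<^sup>2) \<partial>M) < \<infinity>"
      using assms(2) by (rule le_less_trans) simp
  qed auto
  then show f: "f \<in> L2 M" using assms(1) by (simp add: L2_def)
  show "L2_norm M f \<le> c"
  proof (rule power2_le_imp_le)
    show "(L2_norm M f)\<^sup>2 \<le> c\<^sup>2"
      using assms(2) unfolding nn_integral_L2_norm[OF f] by (simp add: ennreal_le_iff)
  qed (rule assms(3))
qed

section \<open>Completeness of L2 (Riesz-Fischer)\<close>

lemma summable_geometric_bound:
  fixes h :: "nat \<Rightarrow> real"
  assumes "\<And>k. 0 \<le> h k" "summable (\<lambda>k. 2 ^ k * (h k)\<^sup>2)"
  shows "summable h"
proof -
  have "(\<lambda>k. 2 ^ k * (h k)\<^sup>2) \<longlonglongrightarrow> 0" using assms(2) by (rule summable_LIMSEQ_zero)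
  then have "eventually (\<lambda>k. 2 ^ k * (h k)\<^sup>2 < 1) sequentially"
    by (rule order_tendstoD(2)) simp
  then have "eventually (\<lambda>k. norm (h k) \<le> (1 / sqrt 2) ^ k) sequentially"
  proof eventually_elim
    case (elim k)
    have "((1 / sqrt 2) ^ k)\<^sup>2 = ((1 / sqrt 2)\<^sup>2) ^ k" by (simp add: power_mult[symmetric] mult.commute)
    also have "\<dots> = 1 / 2 ^ k" by (simp add: power_divide)
    finally have "(h k)\<^sup>2 \<le> ((1 / sqrt 2) ^ k)\<^sup>2" using elim by (simp add: field_simps)
    then have "h k \<le> (1 / sqrt 2) ^ k" by (rule power2_le_imp_le) simp
    with assms(1) show ?case by simp
  qed
  moreover have "summable (\<lambda>k. (1 / sqrt 2 :: real) ^ k)" by (rule summable_geometric) simp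
  ultimately show ?thesis by (rule summable_comparison_test_ev)
qed

text \<open>Along a fast subsequence the squared increments, even with weights 2^k, have a finite
  total integral. At almost every point they are then dominated by a geometric series, so the
  subsequence converges pointwise. Fatou's lemma turns the Cauchy bounds into norm convergence of
  the entire sequence.\<close>

theorem L2_complete:
  fixes F :: "nat \<Rightarrow> 'a \<Rightarrow> complex"
  assumes F: "\<And>n. F n \<in> L2 M"
    and Cauchy: "\<And>\<epsilon>. \<epsilon> > 0 \<Longrightarrow> \<exists>N. \<forall>m\<ge>N. \<forall>n\<ge>N. L2_norm M (\<lambda>x. F m x - F n x) < \<epsilon>"
  shows "\<exists>f\<in>L2 M. (\<lambda>n. L2_norm M (\<lambda>x. F n x - f x)) \<longlonglongrightarrow> 0"
proof -
  have "\<exists>N. \<forall>m\<ge>N. \<forall>n\<ge>N. L2_norm M (\<lambda>x. F m x - F n x) < (1/2) ^ k" for k :: nat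
    by (rule Cauchy) simp
  then obtain N where N: "\<And>k m n. m \<ge> N k \<Longrightarrow> n \<ge> N k \<Longrightarrow> L2_norm M (\<lambda>x. F m x - F n x) < (1/2) ^ k"
    by metis
  \<comment> \<open>Summing all thresholds up to k puts \<open>r k\<close> beyond each of them, so
    every later index of the subsequence still respects an earlier threshold.\<close>
  define r where "r k = k + (\<Sum>j\<le>k. N j)" for k
  have r_ge: "r k \<ge> N j" if "j \<le> k" for j k
  proof -
    have "N j \<le> (\<Sum>j\<le>k. N j)" using that by (intro member_le_sum) auto
    then show ?thesis by (simp add: r_def)
  qed
  define h where "h k x = cmod (F (r (Suc k)) x - F (r k) x)" for k x
  have [measurable]: "F n \<in> borel_measurable M" for n using F by (rule L2_measurable)
  have [measurable]: "h k \<in> borel_measurable M" for k unfolding h_def by measurable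
  \<comment> \<open>The increment has squared norm at most 4^(-k), so the weight 2^k leaves the
    summable bound 2^(-k).\<close>
  have int_h: "(\<integral>\<^sup>+x. ennreal (2 ^ k * (h k x)\<^sup>2) \<partial>M) \<le> ennreal ((1/2) ^ k)" for k
  proof -
    have lt: "L2_norm M (\<lambda>x. F (r (Suc k)) x - F (r k) x) \<le> (1/2) ^ k"
      using N[of k "r (Suc k)" "r k"] r_ge[of k "Suc k"] r_ge[of k k] by simp
    have "(\<integral>\<^sup>+x. ennreal (2 ^ k * (h k x)\<^sup>2) \<partial>M) = ennreal (2 ^ k) * (\<integral>\<^sup>+x. ennreal ((h k x)\<^sup>2) \<partial>M)"
      by (simp add: ennreal_mult nn_integral_cmult)
    also have "(\<integral>\<^sup>+x. ennreal ((h k x)\<^sup>2) \<partial>M) = ennreal ((L2_norm M (\<lambda>x. F (r (Suc k)) x - F (r k) x))\<^sup>2)"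
      unfolding h_def by (rule nn_integral_L2_norm) (use F in auto)
    also have "ennreal (2 ^ k) * \<dots> = ennreal (2 ^ k * (L2_norm M (\<lambda>x. F (r (Suc k)) x - F (r k) x))\<^sup>2)"
      by (simp add: ennreal_mult)
    also have "2 ^ k * (L2_norm M (\<lambda>x. F (r (Suc k)) x - F (r k) x))\<^sup>2 \<le> 2 ^ k * ((1/2) ^ k)\<^sup>2"
      using lt by (intro mult_left_mono power_mono) auto
    also have "2 ^ k * ((1/2) ^ k)\<^sup>2 = (1/2 :: real) ^ k"
      by (simp add: power_divide power2_eq_square)
    finally show ?thesis by (simp add: ennreal_leI)
  qed
  have "(\<integral>\<^sup>+x. (\<Sum>k. ennreal (2 ^ k * (h k x)\<^sup>2)) \<partial>M) = (\<Sum>k. \<integral>\<^sup>+x. ennreal (2 ^ k * (h k x)\<^sup>2) \<partial>M)"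
    by (rule nn_integral_suminf) measurable
  also have "\<dots> \<le> (\<Sum>k. ennreal ((1/2) ^ k))"
    using int_h by (intro suminf_le) auto
  also have "\<dots> = ennreal (\<Sum>k. (1/2) ^ k)"
    by (rule suminf_ennreal2) (auto intro: summable_geometric)
  also have "\<dots> < \<infinity>" by simp
  finally have "(\<integral>\<^sup>+x. (\<Sum>k. ennreal (2 ^ k * (h k x)\<^sup>2)) \<partial>M) \<noteq> \<infinity>" by simp
  then have "AE x in M. (\<Sum>k. ennreal (2 ^ k * (h k x)\<^sup>2)) \<noteq> \<infinity>"
    by (intro nn_integral_noteq_infinite) measurable
  then have conv: "AE x in M. convergent (\<lambda>k. F (r k) x)"
  proof eventually_elim
    case (elim x)
    have "summable (\<lambda>k. 2 ^ k * (h k x)\<^sup>2)"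
    proof (rule summable_suminf_not_top)
      show "(\<Sum>k. ennreal (2 ^ k * (h k x)\<^sup>2)) \<noteq> top"
        using elim unfolding infinity_ennreal_def .
    qed simp
    then have "summable (\<lambda>k. h k x)" by (rule summable_geometric_bound[rotated]) (simp add: h_def)
    then have "summable (\<lambda>k. F (r (Suc k)) x - F (r k) x)"
      unfolding h_def by (rule summable_norm_cancel)
    then have "convergent (\<lambda>n. F (r n) x - F (r 0) x)"
      unfolding summable_iff_convergent sum_lessThan_telescope[of "\<lambda>k. F (r k) x"] .
    from convergent_add[OF this convergent_const[of "F (r 0) x"]] show ?case by simp
  qed
  define f where "f x = lim (\<lambda>k. F (r k) x)" for x
  have [measurable]: "f \<in> borel_measurable M"
    unfolding f_def by (rule borel_measurable_lim_metric) measurable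
  \<comment> \<open>Fatou's lemma with n fixed, the limit being approached along the subsequence
    only.\<close>
  have est: "(\<lambda>x. F n x - f x) \<in> L2 M \<and> L2_norm M (\<lambda>x. F n x - f x) \<le> (1/2) ^ k" if "n \<ge> N k" for n k
  proof -
    have "(\<integral>\<^sup>+x. ennreal ((cmod (F n x - f x))\<^sup>2) \<partial>M)
      = (\<integral>\<^sup>+x. liminf (\<lambda>j. ennreal ((cmod (F n x - F (r j) x))\<^sup>2)) \<partial>M)"
    proof (rule nn_integral_cong_AE)
      show "AE x in M. ennreal ((cmod (F n x - f x))\<^sup>2) = liminf (\<lambda>j. ennreal ((cmod (F n x - F (r j) x))\<^sup>2))"
        using conv
      proof eventually_elim
        case (elim x)
        then have "(\<lambda>j. F (r j) x) \<longlonglongrightarrow> f x" unfolding f_def by (simp add: convergent_LIMSEQ_iff)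
        then have "(\<lambda>j. ennreal ((cmod (F n x - F (r j) x))\<^sup>2)) \<longlonglongrightarrow> ennreal ((cmod (F n x - f x))\<^sup>2)"
          by (intro tendsto_ennrealI tendsto_intros)
        from lim_imp_Liminf[OF trivial_limit_sequentially this] show ?case by simp
      qed
    qed
    also have "\<dots> \<le> liminf (\<lambda>j. \<integral>\<^sup>+x. ennreal ((cmod (F n x - F (r j) x))\<^sup>2) \<partial>M)"
      by (rule nn_integral_liminf) measurable
    also have "\<dots> \<le> ennreal (((1/2) ^ k)\<^sup>2)"
    proof (rule Liminf_le)
      show "\<forall>\<^sub>F j in sequentially. (\<integral>\<^sup>+x. ennreal ((cmod (F n x - F (r j) x))\<^sup>2) \<partial>M) \<le> ennreal (((1/2) ^ k)\<^sup>2)"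
        using eventually_ge_at_top[of k]
      proof eventually_elim
        case (elim j)
        then have "L2_norm M (\<lambda>x. F n x - F (r j) x) \<le> (1/2) ^ k"
          using N[of k n "r j"] r_ge that by (simp add: less_imp_le)
        then have "(L2_norm M (\<lambda>x. F n x - F (r j) x))\<^sup>2 \<le> ((1/2) ^ k)\<^sup>2" by (intro power_mono) auto
        then show ?case by (subst nn_integral_L2_norm) (use F in \<open>auto intro: ennreal_leI\<close>)
      qed
    qed simp
    finally show ?thesis using L2_norm_le_nn_integral[of "\<lambda>x. F n x - f x" M "(1/2) ^ k"] by auto
  qed
  have "(\<lambda>x. F (N 0) x - (F (N 0) x - f x)) \<in> L2 M"
    by (rule L2_diff[OF F]) (use est[where k = 0 and n = "N 0"] in simp)
  then have "f \<in> L2 M" by simp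
  moreover have "(\<lambda>n. L2_norm M (\<lambda>x. F n x - f x)) \<longlonglongrightarrow> 0"
  proof (rule LIMSEQ_I)
    fix \<epsilon> :: real assume "0 < \<epsilon>"
    then obtain k where k: "(1/2) ^ k < \<epsilon>" using real_arch_pow_inv[of \<epsilon> "1/2"] by auto
    show "\<exists>no. \<forall>n\<ge>no. norm (L2_norm M (\<lambda>x. F n x - f x) - 0) < \<epsilon>"
      using est[of k] k by (intro exI[of _ "N k"]) (auto intro: le_less_trans)
  qed
  ultimately show ?thesis by blast
qed

subsection \<open>Riesz bases\<close>

definition lincomb :: "'i set \<Rightarrow> ('i \<Rightarrow> complex) \<Rightarrow> ('i \<Rightarrow> 'a \<Rightarrow> complex) \<Rightarrow> 'a \<Rightarrow> complex" where
  "lincomb F c e = (\<lambda>x. \<Sum>i\<in>F. c i * e i x)"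

definition bessel :: "'a measure \<Rightarrow> 'i set \<Rightarrow> ('i \<Rightarrow> 'a \<Rightarrow> complex) \<Rightarrow> bool" where
  "bessel M I e \<longleftrightarrow> (\<exists>B. \<forall>F c. finite F \<longrightarrow> F \<subseteq> I \<longrightarrow>
     L2_norm M (lincomb F c e) \<le> B * sqrt (\<Sum>i\<in>F. (cmod (c i))\<^sup>2))"

text \<open>Only the lower half of the usual two-sided inequality, the upper half being
  \<open>bessel\<close>. They are kept apart because the lower bound belongs to one particular
  domain, while the upper one is propagated to all bounded domains.\<close>

definition riesz_sequence :: "'a measure \<Rightarrow> 'i set \<Rightarrow> ('i \<Rightarrow> 'a \<Rightarrow> complex) \<Rightarrow> bool" where
  "riesz_sequence M I e \<longleftrightarrow> (\<exists>A. \<forall>F c. finite F \<longrightarrow> F \<subseteq> I \<longrightarrow>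
     sqrt (\<Sum>i\<in>F. (cmod (c i))\<^sup>2) \<le> A * L2_norm M (lincomb F c e))"

definition complete_in :: "'a measure \<Rightarrow> 'i set \<Rightarrow> ('i \<Rightarrow> 'a \<Rightarrow> complex) \<Rightarrow> bool" where
  "complete_in M I e \<longleftrightarrow> (\<forall>f\<in>L2 M. (\<forall>i\<in>I. L2_inner M f (e i) = 0) \<longrightarrow> ae_eq M f (\<lambda>x. 0))"

definition dense_span :: "'a measure \<Rightarrow> 'i set \<Rightarrow> ('i \<Rightarrow> 'a \<Rightarrow> complex) \<Rightarrow> bool" where
  "dense_span M I e \<longleftrightarrow> (\<forall>f\<in>L2 M. \<forall>\<epsilon>>0. \<exists>F c. finite F \<and> F \<subseteq> I \<and> L2_norm M (\<lambda>x. f x - lincomb F c e x) < \<epsilon>)"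

lemma dense_spanD:
  "dense_span M I e \<Longrightarrow> f \<in> L2 M \<Longrightarrow> \<epsilon> > 0 \<Longrightarrow>
    \<exists>F c. finite F \<and> F \<subseteq> I \<and> L2_norm M (\<lambda>x. f x - lincomb F c e x) < \<epsilon>"
  by (simp add: dense_span_def)

lemma besselE:
  assumes "bessel M I e"
  obtains B where "B > 0" "\<And>F c. finite F \<Longrightarrow> F \<subseteq> I \<Longrightarrow>
     L2_norm M (lincomb F c e) \<le> B * sqrt (\<Sum>i\<in>F. (cmod (c i))\<^sup>2)"
proof -
  from assms obtain B where B: "\<And>F c. finite F \<Longrightarrow> F \<subseteq> I \<Longrightarrow>
     L2_norm M (lincomb F c e) \<le> B * sqrt (\<Sum>i\<in>F. (cmod (c i))\<^sup>2)"
    unfolding bessel_def by auto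
  show ?thesis
  proof (rule that[of "\<bar>B\<bar> + 1"])
    fix F and c :: "'b \<Rightarrow> complex" assume F: "finite F" "F \<subseteq> I"
    have "B * sqrt (\<Sum>i\<in>F. (cmod (c i))\<^sup>2) \<le> (\<bar>B\<bar> + 1) * sqrt (\<Sum>i\<in>F. (cmod (c i))\<^sup>2)"
      by (intro mult_right_mono) (auto intro: sum_nonneg)
    then show "L2_norm M (lincomb F c e) \<le> (\<bar>B\<bar> + 1) * sqrt (\<Sum>i\<in>F. (cmod (c i))\<^sup>2)"
      using B[OF F, of c] by linarith
  qed auto
qed

lemma riesz_sequenceE:
  assumes "riesz_sequence M I e"
  obtains A where "A > 0" "\<And>F c. finite F \<Longrightarrow> F \<subseteq> I \<Longrightarrow>
     sqrt (\<Sum>i\<in>F. (cmod (c i))\<^sup>2) \<le> A * L2_norm M (lincomb F c e)"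
proof -
  from assms obtain A where A: "\<And>F c. finite F \<Longrightarrow> F \<subseteq> I \<Longrightarrow>
     sqrt (\<Sum>i\<in>F. (cmod (c i))\<^sup>2) \<le> A * L2_norm M (lincomb F c e)"
    unfolding riesz_sequence_def by auto
  show ?thesis
  proof (rule that[of "\<bar>A\<bar> + 1"])
    fix F and c :: "'b \<Rightarrow> complex" assume F: "finite F" "F \<subseteq> I"
    have "A * L2_norm M (lincomb F c e) \<le> (\<bar>A\<bar> + 1) * L2_norm M (lincomb F c e)"
      by (intro mult_right_mono) auto
    then show "sqrt (\<Sum>i\<in>F. (cmod (c i))\<^sup>2) \<le> (\<bar>A\<bar> + 1) * L2_norm M (lincomb F c e)"
      using A[OF F, of c] by linarith
  qed auto
qed

lemma lincomb_L2 [intro]: "(\<And>i. i \<in> F \<Longrightarrow> e i \<in> L2 M) \<Longrightarrow> lincomb F c e \<in> L2 M"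
  unfolding lincomb_def by (intro L2_sum L2_cmult)

lemma lincomb_empty [simp]: "lincomb {} c e = (\<lambda>x. 0)"
  by (simp add: lincomb_def)

lemma lincomb_add: "lincomb F (\<lambda>i. c i + d i) e x = lincomb F c e x + lincomb F d e x"
  by (simp add: lincomb_def sum.distrib distrib_right)

lemma lincomb_cmult: "lincomb F (\<lambda>i. a * c i) e x = a * lincomb F c e x"
  by (simp add: lincomb_def sum_distrib_left mult.assoc)

lemma lincomb_mono:
  assumes "finite G" "F \<subseteq> G" "\<And>i. i \<in> F \<Longrightarrow> c i = d i" "\<And>i x. i \<in> G - F \<Longrightarrow> d i * e i x = 0"
  shows "lincomb F c e = lincomb G d e"
  unfolding lincomb_def using assms by (intro ext sum.mono_neutral_cong_left) auto

lemma lincomb_extend: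
  assumes "finite G" "F \<subseteq> G"
  shows "lincomb F c e = lincomb G (\<lambda>i. if i \<in> F then c i else 0) e"
  by (rule lincomb_mono) (use assms in auto)

lemma lincomb_Un:
  assumes "finite F" "finite G" "F \<inter> G = {}"
  shows "lincomb (F \<union> G) c e x = lincomb F c e x + lincomb G c e x"
  unfolding lincomb_def using assms by (simp add: sum.union_disjoint)

lemma L2_inner_lincomb_left:
  assumes "\<And>i. i \<in> F \<Longrightarrow> e i \<in> L2 M" "h \<in> L2 M"
  shows "L2_inner M (lincomb F c e) h = (\<Sum>i\<in>F. c i * L2_inner M (e i) h)"
  unfolding lincomb_def using assms
  by (subst L2_inner_sum_left) (auto simp: L2_inner_cmult_left)

lemma L2_inner_lincomb_right:
  assumes "\<And>i. i \<in> F \<Longrightarrow> e i \<in> L2 M" "h \<in> L2 M"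
  shows "L2_inner M h (lincomb F c e) = (\<Sum>i\<in>F. cnj (c i) * L2_inner M h (e i))"
  unfolding lincomb_def using assms
  by (subst L2_inner_sum_right) (auto simp: L2_inner_cmult_right)

section \<open>Orthonormal systems, Gram-Schmidt and Fourier expansion\<close>

lemma L2_norm_lincomb_orthonormal:
  assumes "finite F" "\<And>i. i \<in> F \<Longrightarrow> u i \<in> L2 M"
    "\<And>i j. i \<in> F \<Longrightarrow> j \<in> F \<Longrightarrow> L2_inner M (u i) (u j) = (if i = j then 1 else 0)"
  shows "(L2_norm M (lincomb F c u))\<^sup>2 = (\<Sum>i\<in>F. (cmod (c i))\<^sup>2)"
proof -
  have "complex_of_real ((L2_norm M (lincomb F c u))\<^sup>2) = L2_inner M (lincomb F c u) (lincomb F c u)"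
    by (simp only: L2_inner_self)
  also have "\<dots> = (\<Sum>i\<in>F. c i * (\<Sum>j\<in>F. cnj (c j) * L2_inner M (u i) (u j)))"
    using assms by (subst L2_inner_lincomb_left) (auto simp: L2_inner_lincomb_right lincomb_L2)
  also have "\<dots> = (\<Sum>i\<in>F. c i * (\<Sum>j\<in>F. if i = j then cnj (c j) else 0))"
    using assms(3) by (intro sum.cong refl arg_cong2[of _ _ _ _ "(*)"]) auto
  also have "\<dots> = (\<Sum>i\<in>F. complex_of_real ((cmod (c i))\<^sup>2))"
    using assms(1) by (intro sum.cong refl) (simp only: complex_norm_square, simp)
  also have "\<dots> = complex_of_real (\<Sum>i\<in>F. (cmod (c i))\<^sup>2)" by (rule of_real_sum[symmetric])
  finally show ?thesis by (simp only: of_real_eq_iff)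
qed

lemma orthonormal_bessel_ineq:
  assumes F: "finite F" and u: "\<And>i. i \<in> F \<Longrightarrow> u i \<in> L2 M"
    and on: "\<And>i j. i \<in> F \<Longrightarrow> j \<in> F \<Longrightarrow> L2_inner M (u i) (u j) = (if i = j then 1 else 0)"
    and f: "f \<in> L2 M"
  shows "(\<Sum>i\<in>F. (cmod (L2_inner M f (u i)))\<^sup>2) \<le> (L2_norm M f)\<^sup>2"
proof -
  define c where "c i = L2_inner M f (u i)" for i
  have "L2_inner M f (lincomb F c u) = (\<Sum>i\<in>F. complex_of_real ((cmod (c i))\<^sup>2))"
    by (subst L2_inner_lincomb_right[OF u f], simp, intro sum.cong refl)
       (simp only: complex_norm_square, simp add: c_def mult.commute)
  then have "L2_inner M f (lincomb F c u) = complex_of_real (\<Sum>i\<in>F. (cmod (c i))\<^sup>2)" by simp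
  then have "(L2_norm M (\<lambda>x. f x - lincomb F c u x))\<^sup>2 = (L2_norm M f)\<^sup>2 - (\<Sum>i\<in>F. (cmod (c i))\<^sup>2)"
    using L2_norm_diff_sq[OF f lincomb_L2[of F u M c, OF u]] L2_norm_lincomb_orthonormal[OF F u on, of c] by simp
  then show ?thesis unfolding c_def[symmetric] by (smt (verit) zero_le_power2)
qed

lemma ex_gram_schmidt:
  fixes e :: "nat \<Rightarrow> 'a \<Rightarrow> complex"
  assumes e: "\<And>n. e n \<in> L2 M"
  shows "\<exists>u. (\<forall>n. u n \<in> L2 M) \<and> (\<forall>m n. m \<noteq> n \<longrightarrow> L2_inner M (u m) (u n) = 0) \<and>
    (\<forall>n. \<exists>c. u n = lincomb {..n} c e) \<and> (\<forall>n. \<exists>c. ae_eq M (e n) (lincomb {..n} c u)) \<and>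
    (\<forall>n. L2_norm M (u n) = 1 \<or> L2_norm M (u n) = 0 \<and> (\<exists>c. c n = 1 \<and> L2_norm M (lincomb {..n} c e) = 0)) \<and>
    (\<forall>n. e n = (\<lambda>x. 0) \<longrightarrow> u n = (\<lambda>x. 0))"
proof -
  \<comment> \<open>Each \<open>u n\<close> depends on all its predecessors, hence the well-founded
    recursion.\<close>
  define step where "step us n = (let w = (\<lambda>x. e n x - (\<Sum>k<n. L2_inner M (e n) (us k) * us k x))
      in (\<lambda>x. complex_of_real (inverse (L2_norm M w)) * w x))" for us :: "nat \<Rightarrow> 'a \<Rightarrow> complex" and n
  define u where "u = wfrec less_than step"
  have u_rec: "u n = step u n" for n
    unfolding u_def
    by (subst wfrec_fixpoint[OF wf_less_than]) (auto simp: adm_wf_def step_def Let_def)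
  define w where "w n = (\<lambda>x. e n x - (\<Sum>k<n. L2_inner M (e n) (u k) * u k x))" for n
  have u: "u n = (\<lambda>x. complex_of_real (inverse (L2_norm M (w n))) * w n x)" for n
    by (subst u_rec) (simp add: step_def w_def Let_def)
  have uL2: "u n \<in> L2 M" and wL2: "w n \<in> L2 M" for n
  proof (induction n rule: less_induct)
    case (less n)
    { case 2 show ?case unfolding w_def using less e by (intro L2_diff L2_sum L2_cmult) auto }
    then show "u n \<in> L2 M" unfolding u by (intro L2_cmult)
  qed
  have norm_u: "L2_norm M (u n) = 1 \<or> L2_norm M (u n) = 0 \<and> L2_norm M (w n) = 0" for n
    by (cases "L2_norm M (w n) = 0") (simp_all add: u L2_norm_cmult norm_inverse)
  have orth: "\<forall>m<n. L2_inner M (u n) (u m) = 0" for n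
  proof (induction n rule: less_induct)
    case (less n)
    show ?case
    proof (intro allI impI)
      fix m assume m: "m < n"
      have "L2_inner M (w n) (u m) = L2_inner M (e n) (u m) - (\<Sum>k<n. L2_inner M (e n) (u k) * L2_inner M (u k) (u m))"
        unfolding w_def
        by (simp add: L2_inner_diff_left L2_sum L2_cmult uL2 e L2_inner_sum_left L2_inner_cmult_left)
      also have "(\<Sum>k<n. L2_inner M (e n) (u k) * L2_inner M (u k) (u m)) = (\<Sum>k<n. if k = m then L2_inner M (e n) (u m) * L2_inner M (u m) (u m) else 0)"
      proof (intro sum.cong refl)
        fix k assume "k \<in> {..<n}"
        then have "k \<noteq> m \<Longrightarrow> L2_inner M (u k) (u m) = 0"
          using less m L2_inner_commute[of M "u k" "u m"] by (cases k m rule: linorder_cases) auto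
        then show "L2_inner M (e n) (u k) * L2_inner M (u k) (u m) =
          (if k = m then L2_inner M (e n) (u m) * L2_inner M (u m) (u m) else 0)" by auto
      qed
      also have "\<dots> = L2_inner M (e n) (u m) * L2_inner M (u m) (u m)" using m by simp
      also have "\<dots> = L2_inner M (e n) (u m)"
      proof (cases "L2_norm M (u m) = 0")
        case True
        then have "cmod (L2_inner M (e n) (u m)) \<le> 0" using L2_Cauchy_Schwarz[OF e uL2, of n m] by simp
        then show ?thesis by simp
      next
        case False then show ?thesis using norm_u[of m] by (simp add: L2_inner_self)
      qed
      finally show "L2_inner M (u n) (u m) = 0" unfolding u[of n] by (simp add: L2_inner_cmult_left)
    qed
  qed
  \<comment> \<open>The remainder is \<open>e n\<close> minus a combination of earlier functions, so
    its leading coefficient stays 1; \<open>b\<close> collects the other coefficients after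
    exchanging the two sums.\<close>
  have "\<exists>c. c n = 1 \<and> w n = lincomb {..n} c e" for n
  proof (induction n rule: less_induct)
    case (less n)
    then have "\<forall>k\<in>{..<n}. \<exists>c. c k = 1 \<and> w k = lincomb {..k} c e" by auto
    then obtain c where c: "\<And>k. k < n \<Longrightarrow> w k = lincomb {..k} (c k) e" by (metis lessThan_iff)
    define d where "d k = L2_inner M (e n) (u k) * complex_of_real (inverse (L2_norm M (w k)))" for k
    define b where "b j = (if j = n then 1 else - (\<Sum>k<n. d k * (if j \<le> k then c k j else 0)))" for j
    have "w n x = lincomb {..n} b e x" for x
    proof -
      have "(\<Sum>k<n. L2_inner M (e n) (u k) * u k x) = (\<Sum>k<n. d k * (\<Sum>j\<le>k. c k j * e j x))"
        unfolding u d_def by (intro sum.cong refl) (use c in \<open>simp add: lincomb_def\<close>)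
      also have "\<dots> = (\<Sum>k<n. d k * (\<Sum>j<n. (if j \<le> k then c k j else 0) * e j x))"
        by (intro sum.cong refl arg_cong2[of _ _ _ _ "(*)"] sum.mono_neutral_cong_left) auto
      also have "\<dots> = (\<Sum>j<n. (\<Sum>k<n. d k * (if j \<le> k then c k j else 0)) * e j x)"
        unfolding sum_distrib_left sum_distrib_right by (subst sum.swap) (simp add: mult.assoc)
      finally have *: "(\<Sum>k<n. L2_inner M (e n) (u k) * u k x) = (\<Sum>j<n. (\<Sum>k<n. d k * (if j \<le> k then c k j else 0)) * e j x)" .
      have "{..n} = insert n {..<n}" by auto
      then have "lincomb {..n} b e x = b n * e n x + (\<Sum>j<n. b j * e j x)" by (simp add: lincomb_def)
      also have "(\<Sum>j<n. b j * e j x) = - (\<Sum>j<n. (\<Sum>k<n. d k * (if j \<le> k then c k j else 0)) * e j x)"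
        unfolding sum_negf[symmetric] by (intro sum.cong refl) (simp add: b_def)
      finally have "lincomb {..n} b e x = b n * e n x + - (\<Sum>j<n. (\<Sum>k<n. d k * (if j \<le> k then c k j else 0)) * e j x)" .
      then show ?thesis unfolding w_def * by (simp only: b_def[of n]) simp
    qed
    then have "w n = lincomb {..n} b e" by (rule ext)
    moreover have "b n = 1" by (simp add: b_def)
    ultimately show ?case by blast
  qed
  then obtain c where c: "\<And>n. c n n = 1" "\<And>n. w n = lincomb {..n} (c n) e" by metis
  have span: "\<exists>c. u n = lincomb {..n} c e" for n
    by (intro exI[of _ "\<lambda>j. complex_of_real (inverse (L2_norm M (w n))) * c n j"])
       (simp add: fun_eq_iff lincomb_cmult u c(2))
  have span': "\<exists>c. ae_eq M (e n) (lincomb {..n} c u)" for n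
  proof -
    define c where "c k = (if k = n then complex_of_real (L2_norm M (w n)) else L2_inner M (e n) (u k))" for k
    have wn: "ae_eq M (w n) (\<lambda>x. c n * u n x)"
    proof (cases "L2_norm M (w n) = 0")
      case True then show ?thesis using L2_norm_eq_0_iff[OF wL2, of n] by (simp add: c_def)
    next
      case False then show ?thesis by (simp add: c_def u mult.assoc[symmetric])
    qed
    have "{..n} = insert n {..<n}" by auto
    then have "lincomb {..n} c u x = c n * u n x + (\<Sum>k<n. L2_inner M (e n) (u k) * u k x)" for x
      by (simp add: lincomb_def c_def)
    moreover have "e n x = w n x + (\<Sum>k<n. L2_inner M (e n) (u k) * u k x)" for x by (simp add: w_def)
    ultimately have "ae_eq M (e n) (lincomb {..n} c u)"
      using wn by (simp add: ae_eq_def)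
    then show ?thesis by blast
  qed
  have orth': "L2_inner M (u m) (u n) = 0" if "m \<noteq> n" for m n
    using orth[of m] orth[of n] that L2_inner_commute[of M "u m" "u n"] by (cases m n rule: linorder_cases) auto
  have "L2_norm M (u n) = 1 \<or> L2_norm M (u n) = 0 \<and> (\<exists>c. c n = 1 \<and> L2_norm M (lincomb {..n} c e) = 0)" for n
    using norm_u[of n] c by metis
  moreover have "u n = (\<lambda>x. 0)" if "e n = (\<lambda>x. 0)" for n
  proof -
    have "w n = (\<lambda>x. 0)" by (simp add: w_def that)
    then show ?thesis by (simp add: u[of n])
  qed
  ultimately show ?thesis using uL2 orth' span span' by (intro exI[of _ u]) blast
qed

text \<open>Bessel's inequality makes the Fourier partial sums Cauchy; their limit has the same
  coefficients as \<open>f\<close>, and completeness identifies the two.\<close>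

lemma orthonormal_basis_dense:
  assumes "countable I" and onb: "L2_orthonormal_basis M I u"
  shows "dense_span M I u"
  unfolding dense_span_def
proof (intro ballI allI impI)
  fix f and \<epsilon> :: real assume f: "f \<in> L2 M" and \<epsilon>: "0 < \<epsilon>"
  have u: "\<And>i. i \<in> I \<Longrightarrow> u i \<in> L2 M"
    and on: "\<And>i j. i \<in> I \<Longrightarrow> j \<in> I \<Longrightarrow> L2_inner M (u i) (u j) = (if i = j then 1 else 0)"
    and compl: "\<And>f. f \<in> L2 M \<Longrightarrow> (\<And>i. i \<in> I \<Longrightarrow> L2_inner M f (u i) = 0) \<Longrightarrow> ae_eq M f (\<lambda>x. 0)"
    using onb unfolding L2_orthonormal_basis_def by auto
  define a where "a i = L2_inner M f (u i)" for i
  \<comment> \<open>Initial sections of an enumeration. Finite and infinite \<open>I\<close> are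
    treated alike, the sections being eventually constant in the finite case.\<close>
  define K where "K n = {i\<in>I. to_nat_on I i < n}" for n
  have K: "finite (K n)" "K n \<subseteq> I" for n
  proof -
    have "inj_on (to_nat_on I) (K n)"
      using inj_on_to_nat_on[OF assms(1)] by (rule inj_on_subset) (auto simp: K_def)
    moreover have "to_nat_on I ` K n \<subseteq> {..<n}" by (auto simp: K_def)
    ultimately show "finite (K n)" by (meson finite_imageD finite_lessThan finite_subset)
    show "K n \<subseteq> I" by (auto simp: K_def)
  qed
  define S where "S n = lincomb (K n) a u" for n
  have SL2: "S n \<in> L2 M" for n unfolding S_def using K u by (intro lincomb_L2) auto
  define \<sigma> where "\<sigma> n = (\<Sum>i\<in>K n. (cmod (a i))\<^sup>2)" for n
  have diff: "(L2_norm M (\<lambda>x. S n x - S m x))\<^sup>2 = \<sigma> n - \<sigma> m" if "m \<le> n" for m n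
  proof -
    have sub: "K m \<subseteq> K n" using that by (auto simp: K_def)
    have "S n x = lincomb (K n - K m) a u x + S m x" for x
      unfolding S_def lincomb_def using sum.subset_diff[OF sub K(1)] by blast
    then have "(\<lambda>x. S n x - S m x) = lincomb (K n - K m) a u" by auto
    moreover have "(L2_norm M (lincomb (K n - K m) a u))\<^sup>2 = (\<Sum>i\<in>K n - K m. (cmod (a i))\<^sup>2)"
    proof (rule L2_norm_lincomb_orthonormal)
      show "finite (K n - K m)" using K(1) by simp
      show "u i \<in> L2 M" if "i \<in> K n - K m" for i using that K(2) u by blast
      show "L2_inner M (u i) (u j) = (if i = j then 1 else 0)" if "i \<in> K n - K m" "j \<in> K n - K m" for i j
        using that K(2) on by blast
    qed
    ultimately show ?thesis unfolding \<sigma>_def using sum_diff[OF K(1) sub] by metis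
  qed
  have "incseq \<sigma>"
    unfolding \<sigma>_def using K by (intro incseq_SucI sum_mono2) (auto simp: K_def)
  moreover have "\<sigma> n \<le> (L2_norm M f)\<^sup>2" for n
    unfolding \<sigma>_def a_def
  proof (rule orthonormal_bessel_ineq[OF K(1) _ _ f])
    show "u i \<in> L2 M" if "i \<in> K n" for i using that K(2) u by blast
    show "L2_inner M (u i) (u j) = (if i = j then 1 else 0)" if "i \<in> K n" "j \<in> K n" for i j
      using that K(2) on by blast
  qed
  ultimately have "Cauchy \<sigma>" using incseq_convergent LIMSEQ_imp_Cauchy by metis
  have "\<exists>g\<in>L2 M. (\<lambda>n. L2_norm M (\<lambda>x. S n x - g x)) \<longlonglongrightarrow> 0"
  proof (rule L2_complete)
    fix \<delta> :: real assume "\<delta> > 0"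
    then obtain N where N: "\<And>m n. m \<ge> N \<Longrightarrow> n \<ge> N \<Longrightarrow> norm (\<sigma> m - \<sigma> n) < \<delta>\<^sup>2"
      using CauchyD[OF \<open>Cauchy \<sigma>\<close>, of "\<delta>\<^sup>2"] by auto
    have *: "L2_norm M (\<lambda>x. S n x - S m x) < \<delta>" if "N \<le> m" "m \<le> n" for m n
    proof (rule power2_less_imp_less)
      show "(L2_norm M (\<lambda>x. S n x - S m x))\<^sup>2 < \<delta>\<^sup>2"
        using diff[OF that(2)] N[of n m] that by auto
    qed (use \<open>\<delta> > 0\<close> in simp)
    show "\<exists>N. \<forall>m\<ge>N. \<forall>n\<ge>N. L2_norm M (\<lambda>x. S m x - S n x) < \<delta>"
      using * L2_norm_minus_commute[of M "S _" "S _"] by (metis nle_le)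
  qed (rule SL2)
  then obtain g where g: "g \<in> L2 M" "(\<lambda>n. L2_norm M (\<lambda>x. S n x - g x)) \<longlonglongrightarrow> 0" by blast
  have "L2_inner M (\<lambda>x. f x - g x) (u i) = 0" if i: "i \<in> I" for i
  proof -
    \<comment> \<open>Once i has entered the partial sum, \<open>S n\<close> and \<open>f\<close>
      have the same i-th coefficient, so that of \<open>f - g\<close> is bounded by the norm of
      \<open>S n - g\<close>.\<close>
    have "eventually (\<lambda>n. cmod (L2_inner M (\<lambda>x. f x - g x) (u i)) \<le> L2_norm M (\<lambda>x. S n x - g x)) sequentially"
      using eventually_gt_at_top[of "to_nat_on I i"]
    proof eventually_elim
      case (elim n)
      have "L2_inner M (S n) (u i) = (\<Sum>j\<in>K n. a j * L2_inner M (u j) (u i))"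
        unfolding S_def using K u i by (intro L2_inner_lincomb_left) auto
      also have "\<dots> = (\<Sum>j\<in>K n. if j = i then a j else 0)"
      proof (intro sum.cong refl)
        fix j assume "j \<in> K n"
        then have "j \<in> I" using K(2) by blast
        then show "a j * L2_inner M (u j) (u i) = (if j = i then a j else 0)" using on[OF _ i] by simp
      qed
      also have "\<dots> = a i" using elim i K by (simp add: K_def)
      finally have "L2_inner M (\<lambda>x. f x - g x) (u i) = L2_inner M (\<lambda>x. S n x - g x) (u i)"
        using f g SL2 u i by (simp add: L2_inner_diff_left a_def)
      also have "cmod \<dots> \<le> L2_norm M (\<lambda>x. S n x - g x) * L2_norm M (u i)"
        using SL2 g u i by (intro L2_Cauchy_Schwarz L2_diff) auto
      also have "L2_norm M (u i) = 1"
      proof -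
        have "complex_of_real ((L2_norm M (u i))\<^sup>2) = 1" using on[OF i i] by (simp only: L2_inner_self) simp
        then have "(L2_norm M (u i))\<^sup>2 = 1" by (simp only: of_real_eq_1_iff)
        then show ?thesis by (metis L2_norm_nonneg power2_eq_1_iff neg_0_le_iff_le not_one_le_zero)
      qed
      finally show ?case by simp
    qed
    then have "cmod (L2_inner M (\<lambda>x. f x - g x) (u i)) \<le> 0"
      by (intro tendsto_lowerbound[OF g(2)]) auto
    then show ?thesis by simp
  qed
  then have "ae_eq M (\<lambda>x. f x - g x) (\<lambda>x. 0)" using f g by (intro compl) auto
  then have fg: "L2_norm M (\<lambda>x. f x - g x) = 0" using L2_norm_eq_0_iff[OF L2_diff[OF f g(1)]] by simp
  obtain n where n: "L2_norm M (\<lambda>x. S n x - g x) < \<epsilon>"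
    using order_tendstoD(2)[OF g(2) \<epsilon>] by (auto simp: eventually_sequentially)
  have "L2_norm M (\<lambda>x. f x - S n x) \<le> L2_norm M (\<lambda>x. f x - g x) + L2_norm M (\<lambda>x. g x - S n x)"
    by (rule L2_norm_triangle3[OF f g(1) SL2])
  with n fg have "L2_norm M (\<lambda>x. f x - S n x) < \<epsilon>" using L2_norm_minus_commute[of M g "S n"] by simp
  then show "\<exists>F c. finite F \<and> F \<subseteq> I \<and> L2_norm M (\<lambda>x. f x - lincomb F c u x) < \<epsilon>"
    using K[of n] unfolding S_def by blast
qed

lemma lincomb_lincomb:
  assumes "finite F" "\<And>i. i \<in> F \<Longrightarrow> \<exists>G d. finite G \<and> G \<subseteq> I \<and> u i = lincomb G d e"
  shows "\<exists>G d. finite G \<and> G \<subseteq> I \<and> lincomb F c u = lincomb G d e"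
  using assms
proof (induction F rule: finite_induct)
  case empty
  show ?case by (intro exI[of _ "{}"]) simp
next
  case (insert i F)
  obtain G1 d1 where 1: "finite G1" "G1 \<subseteq> I" "lincomb F c u = lincomb G1 d1 e" using insert by auto
  obtain G2 d2 where 2: "finite G2" "G2 \<subseteq> I" "u i = lincomb G2 d2 e" using insert.prems[of i] by blast
  define d where "d j = (if j \<in> G1 then d1 j else 0) + c i * (if j \<in> G2 then d2 j else 0)" for j
  have "lincomb (insert i F) c u x = lincomb (G1 \<union> G2) d e x" for x
  proof -
    have "lincomb (insert i F) c u x = c i * u i x + lincomb F c u x"
      using insert by (simp add: lincomb_def)
    also have "u i x = lincomb (G1 \<union> G2) (\<lambda>j. if j \<in> G2 then d2 j else 0) e x"
      unfolding 2(3) by (subst lincomb_extend[of "G1 \<union> G2"]) (use 1 2 in auto)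
    also have "lincomb F c u x = lincomb (G1 \<union> G2) (\<lambda>j. if j \<in> G1 then d1 j else 0) e x"
      unfolding 1(3) by (subst lincomb_extend[of "G1 \<union> G2"]) (use 1 2 in auto)
    finally show ?thesis unfolding d_def lincomb_add lincomb_cmult by simp
  qed
  then show ?case using 1 2 by (intro exI[of _ "G1 \<union> G2"] exI[of _ d]) auto
qed

lemma riesz_sequence_coeff_le:
  assumes "riesz_sequence M I e" "finite F" "F \<subseteq> I" "i \<in> F" "L2_norm M (lincomb F c e) = 0"
  shows "c i = 0"
proof -
  obtain A where "\<And>F c. finite F \<Longrightarrow> F \<subseteq> I \<Longrightarrow>
      sqrt (\<Sum>i\<in>F. (cmod (c i))\<^sup>2) \<le> A * L2_norm M (lincomb F c e)"
    using assms(1) by (rule riesz_sequenceE) blast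
  from this[OF assms(2,3), of c] have "(\<Sum>i\<in>F. (cmod (c i))\<^sup>2) \<le> 0" using assms(5) by simp
  moreover have "(cmod (c i))\<^sup>2 \<le> (\<Sum>i\<in>F. (cmod (c i))\<^sup>2)" using assms by (intro member_le_sum) auto
  ultimately show ?thesis by (smt (verit) norm_eq_zero power2_less_0 zero_eq_power2)
qed

text \<open>Gram-Schmidt along an enumeration of \<open>I\<close>. The lower Riesz bound excludes
  its degenerate alternative, so the basis is indexed by exactly \<open>I\<close>, as the definition
  of a Riesz basis requires; the finite expansions are kept in order to transfer density back to
  \<open>e\<close>.\<close>

lemma ex_orthonormal_basis:
  assumes I: "countable I" and e: "\<And>i. i \<in> I \<Longrightarrow> e i \<in> L2 M"
    and riesz: "riesz_sequence M I e" and compl: "complete_in M I e"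
  shows "\<exists>u. L2_orthonormal_basis M I u \<and> (\<forall>i\<in>I. \<exists>F c. finite F \<and> F \<subseteq> I \<and> u i = lincomb F c e)"
proof -
  define N where "N = to_nat_on I"
  have inj: "inj_on N I" unfolding N_def using I by (rule inj_on_to_nat_on)
  have from_N: "from_nat_into I (N i) = i" if "i \<in> I" for i unfolding N_def using I that by simp
  \<comment> \<open>Numbers outside the range of the enumeration carry the zero function, for which
    Gram-Schmidt returns zero again.\<close>
  define e' where "e' n = (if n \<in> N ` I then e (from_nat_into I n) else (\<lambda>x. 0))" for n
  have e'N: "e' (N i) = e i" if "i \<in> I" for i using that by (auto simp: e'_def from_N)
  have e': "e' n \<in> L2 M" for n using e by (auto simp: e'_def from_N)
  define K where "K n = {i\<in>I. N i \<le> n}" for n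
  have K: "finite (K n)" "K n \<subseteq> I" for n
  proof -
    have "inj_on N (K n)" using inj by (rule inj_on_subset) (auto simp: K_def)
    moreover have "N ` K n \<subseteq> {..n}" by (auto simp: K_def)
    ultimately show "finite (K n)" by (meson finite_imageD finite_atMost finite_subset)
    show "K n \<subseteq> I" by (auto simp: K_def)
  qed
  have conv: "lincomb {..n} c e' = lincomb (K n) (c \<circ> N) e" for n c
  proof
    fix x
    have "lincomb {..n} c e' x = (\<Sum>k\<in>N ` K n. c k * e' k x)"
      unfolding lincomb_def by (rule sum.mono_neutral_right) (auto simp: K_def e'_def)
    also have "\<dots> = (\<Sum>i\<in>K n. c (N i) * e' (N i) x)"
      using inj K by (subst sum.reindex) (auto intro: inj_on_subset)
    also have "\<dots> = lincomb (K n) (c \<circ> N) e x"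
      unfolding lincomb_def using K by (intro sum.cong refl) (auto simp: e'N subset_eq)
    finally show "lincomb {..n} c e' x = lincomb (K n) (c \<circ> N) e x" .
  qed
  obtain u where uL2: "\<And>n. u n \<in> L2 M" and orth: "\<And>m n. m \<noteq> n \<Longrightarrow> L2_inner M (u m) (u n) = 0"
    and span: "\<And>n. \<exists>c. u n = lincomb {..n} c e'" and span': "\<And>n. \<exists>c. ae_eq M (e' n) (lincomb {..n} c u)"
    and norm: "\<And>n. L2_norm M (u n) = 1 \<or> L2_norm M (u n) = 0 \<and> (\<exists>c. c n = 1 \<and> L2_norm M (lincomb {..n} c e') = 0)"
    and zero: "\<And>n. e' n = (\<lambda>x. 0) \<Longrightarrow> u n = (\<lambda>x. 0)"
    using ex_gram_schmidt[of e' M, OF e'] by blast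
  have norm1: "L2_norm M (u (N i)) = 1" if i: "i \<in> I" for i
  proof (rule ccontr)
    assume "\<not> ?thesis"
    then obtain c where c: "c (N i) = 1" "L2_norm M (lincomb (K (N i)) (c \<circ> N) e) = 0"
      using norm[of "N i"] conv by auto
    have "(c \<circ> N) i = 0"
      by (rule riesz_sequence_coeff_le[OF riesz K _ c(2)]) (use i in \<open>auto simp: K_def\<close>)
    then show False using c(1) by simp
  qed
  have "L2_orthonormal_basis M I (u \<circ> N)"
    unfolding L2_orthonormal_basis_def
  proof (intro conjI ballI impI)
    fix i j assume "i \<in> I" "j \<in> I"
    then show "L2_inner M ((u \<circ> N) i) ((u \<circ> N) j) = (if i = j then 1 else 0)"
      using orth[of "N i" "N j"] inj norm1[of i] by (auto simp: L2_inner_self inj_on_def)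
  next
    fix f assume f: "f \<in> L2 M" and f0: "\<forall>i\<in>I. L2_inner M f ((u \<circ> N) i) = 0"
    have f0': "L2_inner M f (u n) = 0" for n
    proof (cases "n \<in> N ` I")
      case False
      then have "u n = (\<lambda>x. 0)" by (intro zero) (simp add: e'_def)
      then show ?thesis by simp
    qed (use f0 in auto)
    have "L2_inner M f (e i) = 0" if i: "i \<in> I" for i
    proof -
      obtain c where c: "ae_eq M (e' (N i)) (lincomb {..N i} c u)" using span' by blast
      have "L2_inner M f (e i) = L2_inner M f (lincomb {..N i} c u)"
        using c f e i uL2 by (intro L2_inner_cong lincomb_L2) (auto simp: e'N)
      also have "\<dots> = 0" using uL2 f f0' by (subst L2_inner_lincomb_right) auto
      finally show ?thesis .
    qed
    then show "ae_eq M f (\<lambda>x. 0)" using compl f unfolding complete_in_def by blast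
  qed (use uL2 in auto)
  moreover have "\<exists>F c. finite F \<and> F \<subseteq> I \<and> (u \<circ> N) i = lincomb F c e" for i
    using span[of "N i"] conv K by (metis comp_apply)
  ultimately show ?thesis by blast
qed

text \<open>A trivial orthogonal complement yields density by way of the orthonormal basis: its
  Fourier sums approximate, and each basis function is a finite combination of
  \<open>e\<close>.\<close>

lemma complete_imp_dense_span:
  assumes "countable I" "\<And>i. i \<in> I \<Longrightarrow> e i \<in> L2 M" "riesz_sequence M I e" "complete_in M I e"
  shows "dense_span M I e"
proof -
  obtain u where u: "L2_orthonormal_basis M I u"
    and span: "\<And>i. i \<in> I \<Longrightarrow> \<exists>F c. finite F \<and> F \<subseteq> I \<and> u i = lincomb F c e"
    using ex_orthonormal_basis[OF assms] by blast
  show ?thesis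
    unfolding dense_span_def
  proof (intro ballI allI impI)
    fix f and \<epsilon> :: real assume f: "f \<in> L2 M" "0 < \<epsilon>"
    obtain F c where F: "finite F" "F \<subseteq> I" "L2_norm M (\<lambda>x. f x - lincomb F c u x) < \<epsilon>"
      using dense_spanD[OF orthonormal_basis_dense[OF assms(1) u] f] by blast
    obtain G d where "finite G" "G \<subseteq> I" "lincomb F c u = lincomb G d e"
      using lincomb_lincomb[of F I u e c] F span by blast
    with F(3) show "\<exists>F c. finite F \<and> F \<subseteq> I \<and> L2_norm M (\<lambda>x. f x - lincomb F c e x) < \<epsilon>" by metis
  qed
qed

text \<open>The closure of the graph of the linear map sending each \<open>u i\<close> to \<open>e i\<close>.\<close>

definition transfer_graph ::
  "'a measure \<Rightarrow> 'i set \<Rightarrow> ('i \<Rightarrow> 'a \<Rightarrow> complex) \<Rightarrow> ('i \<Rightarrow> 'a \<Rightarrow> complex) \<Rightarrow> ('a \<Rightarrow> complex) \<Rightarrow> ('a \<Rightarrow> complex) \<Rightarrow> bool" where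
  "transfer_graph M I u e f h \<longleftrightarrow> f \<in> L2 M \<and> h \<in> L2 M \<and>
     (\<forall>\<epsilon>>0. \<exists>F c. finite F \<and> F \<subseteq> I \<and> L2_norm M (\<lambda>x. f x - lincomb F c u x) < \<epsilon> \<and>
        L2_norm M (\<lambda>x. h x - lincomb F c e x) < \<epsilon>)"

lemma transfer_graph_swap: "transfer_graph M I u e f h \<longleftrightarrow> transfer_graph M I e u h f"
  unfolding transfer_graph_def by metis

lemma transfer_graph_basis:
  assumes "i \<in> I" "u i \<in> L2 M" "e i \<in> L2 M"
  shows "transfer_graph M I u e (u i) (e i)"
  unfolding transfer_graph_def
proof (intro conjI allI impI exI[of _ "{i}"] exI[of _ "\<lambda>_. 1"])
qed (use assms in \<open>auto simp: lincomb_def\<close>)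

lemma transfer_graph_lin:
  assumes u: "\<And>i. i \<in> I \<Longrightarrow> u i \<in> L2 M" and e: "\<And>i. i \<in> I \<Longrightarrow> e i \<in> L2 M"
    and 1: "transfer_graph M I u e f h" and 2: "transfer_graph M I u e g k"
  shows "transfer_graph M I u e (\<lambda>x. a * f x + b * g x) (\<lambda>x. a * h x + b * k x)"
  unfolding transfer_graph_def
proof (intro conjI allI impI)
  have L: "f \<in> L2 M" "h \<in> L2 M" "g \<in> L2 M" "k \<in> L2 M" using 1 2 by (auto simp: transfer_graph_def)
  then show "(\<lambda>x. a * f x + b * g x) \<in> L2 M" "(\<lambda>x. a * h x + b * k x) \<in> L2 M" by auto
  fix \<epsilon> :: real assume "\<epsilon> > 0"
  define \<delta> where "\<delta> = \<epsilon> / (cmod a + cmod b + 1)"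
  have pos: "cmod a + cmod b + 1 > 0" by (smt (verit) norm_ge_zero)
  have \<delta>: "\<delta> > 0" using \<open>\<epsilon> > 0\<close> pos by (simp add: \<delta>_def)
  obtain F c where F: "finite F" "F \<subseteq> I" "L2_norm M (\<lambda>x. f x - lincomb F c u x) < \<delta>"
      "L2_norm M (\<lambda>x. h x - lincomb F c e x) < \<delta>"
    using 1 \<delta> unfolding transfer_graph_def by blast
  obtain G d where G: "finite G" "G \<subseteq> I" "L2_norm M (\<lambda>x. g x - lincomb G d u x) < \<delta>"
      "L2_norm M (\<lambda>x. k x - lincomb G d e x) < \<delta>"
    using 2 \<delta> unfolding transfer_graph_def by blast
  define c' where "c' i = (if i \<in> F then c i else 0)" for i
  define d' where "d' i = (if i \<in> G then d i else 0)" for i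
  define p where "p i = a * c' i + b * d' i" for i
  have est: "L2_norm M (\<lambda>x. (a * f x + b * g x) - lincomb (F \<union> G) p v x) < \<epsilon>"
    if f: "f \<in> L2 M" and g: "g \<in> L2 M" and v: "\<And>i. i \<in> I \<Longrightarrow> v i \<in> L2 M"
      and *: "L2_norm M (\<lambda>x. f x - lincomb F c v x) < \<delta>" "L2_norm M (\<lambda>x. g x - lincomb G d v x) < \<delta>"
    for f g v
  proof -
    have FL: "lincomb F c v \<in> L2 M" and GL: "lincomb G d v \<in> L2 M" using v F G by auto
    have "lincomb F c v = lincomb (F \<union> G) c' v" unfolding c'_def by (rule lincomb_extend) (use F G in auto)
    moreover have "lincomb G d v = lincomb (F \<union> G) d' v" unfolding d'_def by (rule lincomb_extend) (use F G in auto)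
    ultimately have "(a * f x + b * g x) - lincomb (F \<union> G) p v x
        = a * (f x - lincomb F c v x) + b * (g x - lincomb G d v x)" for x
      unfolding p_def[abs_def] lincomb_add lincomb_cmult by (simp add: algebra_simps)
    then have "L2_norm M (\<lambda>x. (a * f x + b * g x) - lincomb (F \<union> G) p v x)
        \<le> L2_norm M (\<lambda>x. a * (f x - lincomb F c v x)) + L2_norm M (\<lambda>x. b * (g x - lincomb G d v x))"
      using f g FL GL by (simp only:) (intro L2_norm_triangle L2_cmult L2_diff)
    also have "\<dots> \<le> cmod a * \<delta> + cmod b * \<delta>"
      unfolding L2_norm_cmult using * by (intro add_mono mult_left_mono) auto
    also have "\<dots> < (cmod a + cmod b + 1) * \<delta>" using \<delta> by (simp add: algebra_simps)
    also have "\<dots> = \<epsilon>" using pos by (simp add: \<delta>_def)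
    finally show ?thesis .
  qed
  show "\<exists>F c. finite F \<and> F \<subseteq> I \<and> L2_norm M (\<lambda>x. (a * f x + b * g x) - lincomb F c u x) < \<epsilon> \<and>
        L2_norm M (\<lambda>x. (a * h x + b * k x) - lincomb F c e x) < \<epsilon>"
    using est[of f g u] est[of h k e] L F G u e by (intro exI[of _ "F \<union> G"] exI[of _ p]) auto
qed

lemma transfer_graph_norm_le:
  assumes u: "\<And>i. i \<in> I \<Longrightarrow> u i \<in> L2 M" and e: "\<And>i. i \<in> I \<Longrightarrow> e i \<in> L2 M"
    and C: "C \<ge> 0" "\<And>F c. finite F \<Longrightarrow> F \<subseteq> I \<Longrightarrow> L2_norm M (lincomb F c e) \<le> C * L2_norm M (lincomb F c u)"
    and g: "transfer_graph M I u e f h"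
  shows "L2_norm M h \<le> C * L2_norm M f"
proof (rule field_le_epsilon)
  fix \<epsilon> :: real assume "\<epsilon> > 0"
  define \<delta> where "\<delta> = \<epsilon> / (1 + C)"
  have \<delta>: "\<delta> > 0" using \<open>\<epsilon> > 0\<close> C by (simp add: \<delta>_def)
  have L: "f \<in> L2 M" "h \<in> L2 M" using g by (auto simp: transfer_graph_def)
  obtain F c where F: "finite F" "F \<subseteq> I" "L2_norm M (\<lambda>x. f x - lincomb F c u x) < \<delta>"
      "L2_norm M (\<lambda>x. h x - lincomb F c e x) < \<delta>"
    using g \<delta> unfolding transfer_graph_def by blast
  have FL: "lincomb F c u \<in> L2 M" and GL: "lincomb F c e \<in> L2 M" using u e F by auto
  have "L2_norm M h \<le> L2_norm M (lincomb F c e) + L2_norm M (\<lambda>x. h x - lincomb F c e x)"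
    by (rule L2_norm_triangle_sub[OF L(2) GL])
  also have "\<dots> \<le> C * L2_norm M (lincomb F c u) + \<delta>" using C(2)[OF F(1,2)] F(4) by (intro add_mono) auto
  also have "L2_norm M (lincomb F c u) \<le> L2_norm M f + \<delta>"
    using L2_norm_triangle_sub[OF FL L(1)] F(3) L2_norm_minus_commute[of M f] by simp
  finally have "L2_norm M h \<le> C * (L2_norm M f + \<delta>) + \<delta>" using C(1) by (simp add: mult_left_mono)
  also have "\<dots> = C * L2_norm M f + (1 + C) * \<delta>" by (simp add: algebra_simps)
  also have "(1 + C) * \<delta> = \<epsilon>" using C(1) by (simp add: \<delta>_def)
  finally show "L2_norm M h \<le> C * L2_norm M f + \<epsilon>" .
qed

text \<open>When combinations of \<open>u\<close> approximate \<open>f\<close>, the norm comparison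
  makes the same combinations of \<open>e\<close> a Cauchy sequence, whose limit is the image of
  \<open>f\<close>.\<close>

lemma ex_transfer_graph:
  assumes u: "\<And>i. i \<in> I \<Longrightarrow> u i \<in> L2 M" and e: "\<And>i. i \<in> I \<Longrightarrow> e i \<in> L2 M"
    and C: "C \<ge> 0" "\<And>F c. finite F \<Longrightarrow> F \<subseteq> I \<Longrightarrow> L2_norm M (lincomb F c e) \<le> C * L2_norm M (lincomb F c u)"
    and dense: "dense_span M I u" and f: "f \<in> L2 M"
  shows "\<exists>h. transfer_graph M I u e f h"
proof -
  have "\<exists>F c. finite F \<and> F \<subseteq> I \<and> L2_norm M (\<lambda>x. f x - lincomb F c u x) < 1 / Suc n" for n
    by (rule dense_spanD[OF dense f]) simp
  then obtain F c where F: "\<And>n. finite (F n)" "\<And>n. F n \<subseteq> I"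
      "\<And>n. L2_norm M (\<lambda>x. f x - lincomb (F n) (c n) u x) < 1 / Suc n"
    by metis
  have UL: "lincomb (F n) (c n) u \<in> L2 M" and EL: "lincomb (F n) (c n) e \<in> L2 M" for n
    using u e F(2)[of n] by (auto simp: subset_eq)
  have diff: "L2_norm M (\<lambda>x. lincomb (F m) (c m) e x - lincomb (F n) (c n) e x) \<le> C * (1 / Suc m + 1 / Suc n)" for m n
  proof -
    define c1 where "c1 i = (if i \<in> F m then c m i else 0)" for i
    define c2 where "c2 i = - (if i \<in> F n then c n i else 0)" for i
    have eq: "(\<lambda>x. lincomb (F m) (c m) v x - lincomb (F n) (c n) v x) = lincomb (F m \<union> F n) (\<lambda>i. c1 i + c2 i) v" for v
    proof -
      have "lincomb (F m) (c m) v = lincomb (F m \<union> F n) c1 v"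
        unfolding c1_def by (rule lincomb_extend) (use F in auto)
      moreover have "lincomb (F n) (c n) v = lincomb (F m \<union> F n) (\<lambda>i. if i \<in> F n then c n i else 0) v"
        by (rule lincomb_extend) (use F in auto)
      ultimately show ?thesis
        unfolding c2_def fun_eq_iff lincomb_add by (simp add: lincomb_def sum_negf)
    qed
    have "L2_norm M (\<lambda>x. lincomb (F m) (c m) e x - lincomb (F n) (c n) e x)
        \<le> C * L2_norm M (\<lambda>x. lincomb (F m) (c m) u x - lincomb (F n) (c n) u x)"
      unfolding eq using F by (intro C) auto
    also have "L2_norm M (\<lambda>x. lincomb (F m) (c m) u x - lincomb (F n) (c n) u x)
        \<le> L2_norm M (\<lambda>x. lincomb (F m) (c m) u x - f x) + L2_norm M (\<lambda>x. f x - lincomb (F n) (c n) u x)"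
      by (rule L2_norm_triangle3[OF UL f UL])
    also have "\<dots> \<le> 1 / Suc m + 1 / Suc n"
      using F(3)[of m] F(3)[of n] L2_norm_minus_commute[of M f "lincomb (F m) (c m) u"] by simp
    finally show ?thesis using C(1) by (simp add: mult_left_mono)
  qed
  have "\<exists>h\<in>L2 M. (\<lambda>n. L2_norm M (\<lambda>x. lincomb (F n) (c n) e x - h x)) \<longlonglongrightarrow> 0"
  proof (rule L2_complete[OF EL])
    fix \<epsilon> :: real assume \<epsilon>: "\<epsilon> > 0"
    have "(\<lambda>n. 2 * C * (1 / Suc n)) \<longlonglongrightarrow> 2 * C * 0"
      by (intro tendsto_intros) (use LIMSEQ_inverse_real_of_nat in \<open>simp add: inverse_eq_divide\<close>)
    then have "eventually (\<lambda>n. 2 * C * (1 / Suc n) < \<epsilon>) sequentially"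
      using \<epsilon> by (intro order_tendstoD(2)[of _ "2 * C * 0"]) simp_all
    then obtain N where N: "2 * C * (1 / Suc N) < \<epsilon>" by (auto simp: eventually_sequentially)
    have "L2_norm M (\<lambda>x. lincomb (F m) (c m) e x - lincomb (F n) (c n) e x) < \<epsilon>" if "m \<ge> N" "n \<ge> N" for m n
    proof -
      have "1 / real (Suc m) \<le> 1 / Suc N" "1 / real (Suc n) \<le> 1 / Suc N" using that by (simp_all add: frac_le)
      then have "C * (1 / Suc m + 1 / Suc n) \<le> C * (1 / Suc N + 1 / Suc N)" using C(1) by (intro mult_left_mono add_mono)
      then show ?thesis using diff[of m n] N by (simp add: mult.commute[of 2 C])
    qed
    then show "\<exists>N. \<forall>m\<ge>N. \<forall>n\<ge>N. L2_norm M (\<lambda>x. lincomb (F m) (c m) e x - lincomb (F n) (c n) e x) < \<epsilon>" by blast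
  qed
  then obtain h where h: "h \<in> L2 M" "(\<lambda>n. L2_norm M (\<lambda>x. lincomb (F n) (c n) e x - h x)) \<longlonglongrightarrow> 0" by blast
  have "transfer_graph M I u e f h"
    unfolding transfer_graph_def
  proof (intro conjI f h(1) allI impI)
    fix \<epsilon> :: real assume \<epsilon>: "\<epsilon> > 0"
    have "eventually (\<lambda>n. L2_norm M (\<lambda>x. lincomb (F n) (c n) e x - h x) < \<epsilon>) sequentially"
      using h(2) \<epsilon> by (rule order_tendstoD(2))
    moreover have "eventually (\<lambda>n. 1 / real (Suc n) < \<epsilon>) sequentially"
      using \<epsilon> by (intro order_tendstoD(2)[of _ 0]) (use LIMSEQ_inverse_real_of_nat in \<open>simp_all add: inverse_eq_divide\<close>)
    ultimately have "eventually (\<lambda>n. L2_norm M (\<lambda>x. lincomb (F n) (c n) e x - h x) < \<epsilon> \<and> 1 / real (Suc n) < \<epsilon>) sequentially"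
      by (rule eventually_conj)
    then obtain n where n: "L2_norm M (\<lambda>x. lincomb (F n) (c n) e x - h x) < \<epsilon>" "1 / real (Suc n) < \<epsilon>"
      by (auto simp: eventually_sequentially)
    then show "\<exists>F c. finite F \<and> F \<subseteq> I \<and> L2_norm M (\<lambda>x. f x - lincomb F c u x) < \<epsilon> \<and>
        L2_norm M (\<lambda>x. h x - lincomb F c e x) < \<epsilon>"
      using F(1,2) F(3)[of n] L2_norm_minus_commute[of M h "lincomb (F n) (c n) e"]
      by (intro exI[of _ "F n"] exI[of _ "c n"]) auto
  qed
  then show ?thesis by blast
qed

text \<open>Linear combinations of graph points are graph points, so the norm bound applied to a
  difference gives uniqueness, independence of the representative and linearity up to null sets all
  at once.\<close>

lemma bounded_linear_transfer:
  assumes u: "\<And>i. i \<in> I \<Longrightarrow> u i \<in> L2 M" and e: "\<And>i. i \<in> I \<Longrightarrow> e i \<in> L2 M"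
    and C: "C \<ge> 0" "\<And>F c. finite F \<Longrightarrow> F \<subseteq> I \<Longrightarrow> L2_norm M (lincomb F c e) \<le> C * L2_norm M (lincomb F c u)"
    and T: "\<And>f. f \<in> L2 M \<Longrightarrow> transfer_graph M I u e f (T f)"
  shows "L2_bounded_linear M T"
    and "transfer_graph M I u e f h \<Longrightarrow> transfer_graph M I u e f k \<Longrightarrow> ae_eq M h k"
proof -
  have le: "L2_norm M (\<lambda>x. h x - k x) \<le> C * L2_norm M (\<lambda>x. f x - g x)"
    if "transfer_graph M I u e f h" "transfer_graph M I u e g k" for f g h k
    using transfer_graph_norm_le[OF u e C transfer_graph_lin[OF u e that, of 1 "-1"]] by simp
  have uniq: "ae_eq M h k" if "transfer_graph M I u e f h" "transfer_graph M I u e g k" "ae_eq M f g" for f g h k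
  proof -
    have L: "f \<in> L2 M" "h \<in> L2 M" "g \<in> L2 M" "k \<in> L2 M" using that by (auto simp: transfer_graph_def)
    have "L2_norm M (\<lambda>x. h x - k x) \<le> 0" using le[OF that(1,2)] ae_eq_iff_L2_norm_diff[OF L(1,3)] that(3) by simp
    then show ?thesis using ae_eq_iff_L2_norm_diff[OF L(2,4)] by (simp add: order_antisym)
  qed
  show "transfer_graph M I u e f h \<Longrightarrow> transfer_graph M I u e f k \<Longrightarrow> ae_eq M h k"
    by (rule uniq) auto
  show "L2_bounded_linear M T"
    unfolding L2_bounded_linear_def
  proof (intro conjI ballI allI impI exI)
    show TL: "T f \<in> L2 M" if "f \<in> L2 M" for f using T[OF that] by (simp add: transfer_graph_def)
    show "ae_eq M (T f) (T g)" if "f \<in> L2 M" "g \<in> L2 M" "ae_eq M f g" for f g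
      using uniq[OF T T] that by blast
    show "ae_eq M (T (\<lambda>x. a * f x + b * g x)) (\<lambda>x. a * T f x + b * T g x)" if "f \<in> L2 M" "g \<in> L2 M" for f g a b
      using that by (intro uniq[OF T transfer_graph_lin[OF u e T T]]) auto
    show "L2_norm M (T f) \<le> C * L2_norm M f" if "f \<in> L2 M" for f
      by (rule transfer_graph_norm_le[OF u e C T[OF that]])
  qed
qed

text \<open>For the orthonormal system the norm of a combination is the l2 norm of its coefficients.
  Hence the Bessel bound and the lower bound compare combinations of \<open>e\<close> and of
  \<open>u\<close> in both directions. The closed graphs of the two resulting maps are reversals of
  each other, which makes the maps mutually inverse.\<close>

theorem riesz_basisI:
  assumes I: "countable I" and e: "\<And>i. i \<in> I \<Longrightarrow> e i \<in> L2 M"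
    and bessel: "bessel M I e" and riesz: "riesz_sequence M I e" and compl: "complete_in M I e"
  shows "L2_riesz_basis M I e"
proof -
  obtain u where u: "L2_orthonormal_basis M I u" using ex_orthonormal_basis[OF I e riesz compl] by blast
  have uL2: "\<And>i. i \<in> I \<Longrightarrow> u i \<in> L2 M"
    and on: "\<And>i j. i \<in> I \<Longrightarrow> j \<in> I \<Longrightarrow> L2_inner M (u i) (u j) = (if i = j then 1 else 0)"
    using u unfolding L2_orthonormal_basis_def by auto
  have norm_u: "L2_norm M (lincomb F c u) = sqrt (\<Sum>i\<in>F. (cmod (c i))\<^sup>2)" if "finite F" "F \<subseteq> I" for F c
    using L2_norm_lincomb_orthonormal[of F u M c] that uL2 on by (metis L2_norm_nonneg real_sqrt_unique subsetD)
  obtain B where B: "B > 0" "\<And>F c. finite F \<Longrightarrow> F \<subseteq> I \<Longrightarrow>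
     L2_norm M (lincomb F c e) \<le> B * sqrt (\<Sum>i\<in>F. (cmod (c i))\<^sup>2)"
    using bessel by (rule besselE) blast
  obtain A where A: "A > 0" "\<And>F c. finite F \<Longrightarrow> F \<subseteq> I \<Longrightarrow>
     sqrt (\<Sum>i\<in>F. (cmod (c i))\<^sup>2) \<le> A * L2_norm M (lincomb F c e)"
    using riesz by (rule riesz_sequenceE) blast
  have B': "0 \<le> B" "\<And>F c. finite F \<Longrightarrow> F \<subseteq> I \<Longrightarrow> L2_norm M (lincomb F c e) \<le> B * L2_norm M (lincomb F c u)"
    using B by (auto simp: norm_u)
  have A': "0 \<le> A" "\<And>F c. finite F \<Longrightarrow> F \<subseteq> I \<Longrightarrow> L2_norm M (lincomb F c u) \<le> A * L2_norm M (lincomb F c e)"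
    using A by (auto simp: norm_u)
  have "\<exists>h. transfer_graph M I u e f h" if "f \<in> L2 M" for f
    by (rule ex_transfer_graph[OF uL2 e B' orthonormal_basis_dense[OF I u] that])
  then obtain T where T: "\<And>f. f \<in> L2 M \<Longrightarrow> transfer_graph M I u e f (T f)" by metis
  have "\<exists>h. transfer_graph M I e u f h" if "f \<in> L2 M" for f
    by (rule ex_transfer_graph[OF e uL2 A' complete_imp_dense_span[OF I e riesz compl] that])
  then obtain S where S: "\<And>f. f \<in> L2 M \<Longrightarrow> transfer_graph M I e u f (S f)" by metis
  have T_uniq: "ae_eq M h k" if "transfer_graph M I u e f h" "transfer_graph M I u e f k" for f h k
    by (rule bounded_linear_transfer(2)[OF uL2 e B' T that])
  have S_uniq: "ae_eq M h k" if "transfer_graph M I e u f h" "transfer_graph M I e u f k" for f h k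
    by (rule bounded_linear_transfer(2)[OF e uL2 A' S that])
  have TL: "T f \<in> L2 M" and SL: "S f \<in> L2 M" if "f \<in> L2 M" for f
    using T[OF that] S[OF that] by (auto simp: transfer_graph_def)
  have "L2_bounded_invertible M T"
    unfolding L2_bounded_invertible_def
  proof (intro conjI exI[of _ S] ballI bounded_linear_transfer(1)[OF uL2 e B' T] bounded_linear_transfer(1)[OF e uL2 A' S])
    fix f assume f: "f \<in> L2 M"
    show "ae_eq M (S (T f)) f"
      using S_uniq[OF S[OF TL[OF f]]] T[OF f] transfer_graph_swap by metis
    show "ae_eq M (T (S f)) f"
      using T_uniq[OF T[OF SL[OF f]]] S[OF f] transfer_graph_swap by metis
  qed
  moreover have "ae_eq M (T (u i)) (e i)" if "i \<in> I" for i
    using T_uniq[OF T[OF uL2[OF that]]] transfer_graph_basis[of i I u M e] that uL2 e by blast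
  ultimately show ?thesis unfolding L2_riesz_basis_def using u by blast
qed

subsection \<open>Restriction and translation for Lebesgue measure\<close>

text \<open>Extension by zero. Translations act on the whole space and not on a fixed domain, so
  integrals over a domain are moved there before anything is shifted.\<close>

definition cutoff :: "'a set \<Rightarrow> ('a \<Rightarrow> complex) \<Rightarrow> 'a \<Rightarrow> complex" where
  "cutoff S f = (\<lambda>x. if x \<in> S then f x else 0)"

lemma cutoff_scaleR: "cutoff S f = (\<lambda>x. indicator S x *\<^sub>R f x)"
  by (auto simp: cutoff_def)

context
  fixes S :: "'a::euclidean_space set"
  assumes S: "S \<in> sets lebesgue"
begin

lemma measurable_cutoff: "f \<in> borel_measurable (lebesgue_on S) \<longleftrightarrow> cutoff S f \<in> borel_measurable lebesgue"
  unfolding cutoff_scaleR using S by (subst borel_measurable_restrict_space_iff) auto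

lemma L2_cutoff: "f \<in> L2 (lebesgue_on S) \<longleftrightarrow> cutoff S f \<in> L2 lebesgue"
proof -
  have "integrable (lebesgue_on S) (\<lambda>x. (cmod (f x))\<^sup>2) \<longleftrightarrow> integrable lebesgue (\<lambda>x. indicator S x *\<^sub>R (cmod (f x))\<^sup>2)"
    using S by (subst integrable_restrict_space) auto
  also have "(\<lambda>x. indicator S x *\<^sub>R (cmod (f x))\<^sup>2) = (\<lambda>x. (cmod (cutoff S f x))\<^sup>2)"
    by (auto simp: cutoff_def)
  finally show ?thesis by (simp add: L2_def measurable_cutoff)
qed

lemma L2_norm_cutoff: "L2_norm (lebesgue_on S) f = L2_norm lebesgue (cutoff S f)"
proof -
  have "(\<integral>x. (cmod (f x))\<^sup>2 \<partial>lebesgue_on S) = (\<integral>x. indicator S x *\<^sub>R (cmod (f x))\<^sup>2 \<partial>lebesgue)"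
    using S by (subst integral_restrict_space) auto
  also have "(\<lambda>x. indicator S x *\<^sub>R (cmod (f x))\<^sup>2) = (\<lambda>x. (cmod (cutoff S f x))\<^sup>2)"
    by (auto simp: cutoff_def)
  finally show ?thesis by (simp add: L2_norm_def)
qed

lemma L2_inner_cutoff: "L2_inner (lebesgue_on S) f g = L2_inner lebesgue (cutoff S f) g"
proof -
  have "(\<integral>x. f x * cnj (g x) \<partial>lebesgue_on S) = (\<integral>x. indicator S x *\<^sub>R (f x * cnj (g x)) \<partial>lebesgue)"
    using S by (subst integral_restrict_space) auto
  also have "(\<lambda>x. indicator S x *\<^sub>R (f x * cnj (g x))) = (\<lambda>x. cutoff S f x * cnj (g x))"
    by (auto simp: cutoff_def)
  finally show ?thesis by (simp add: L2_inner_def)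
qed

lemma ae_eq_cutoff: "ae_eq (lebesgue_on S) f (\<lambda>x. 0) \<longleftrightarrow> ae_eq lebesgue (cutoff S f) (\<lambda>x. 0)"
  unfolding ae_eq_def using S by (subst AE_restrict_space_iff) (auto simp: cutoff_def elim!: eventually_mono)

end

lemma L2_lebesgue_on_mono:
  fixes S T :: "'a::euclidean_space set"
  assumes "S \<in> sets lebesgue" "T \<in> sets lebesgue" "S \<subseteq> T" "f \<in> L2 (lebesgue_on T)"
  shows "f \<in> L2 (lebesgue_on S)" "L2_norm (lebesgue_on S) f \<le> L2_norm (lebesgue_on T) f"
proof -
  have T: "cutoff T f \<in> L2 lebesgue" using assms by (simp add: L2_cutoff)
  have eq: "cutoff S f = (\<lambda>x. indicator S x *\<^sub>R cutoff T f x)"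
    using assms(3) by (fastforce simp: cutoff_def fun_eq_iff)
  have "cutoff S f \<in> borel_measurable lebesgue"
    unfolding eq using assms(1) L2_measurable[OF T]
    by (intro borel_measurable_scaleR borel_measurable_indicator)
  then have S: "cutoff S f \<in> L2 lebesgue"
    by (rule L2_I[OF _ L2_integrable_sq[OF T]]) (use assms(3) in \<open>auto simp: cutoff_def\<close>)
  then show "f \<in> L2 (lebesgue_on S)" using assms by (simp add: L2_cutoff)
  show "L2_norm (lebesgue_on S) f \<le> L2_norm (lebesgue_on T) f"
    unfolding L2_norm_cutoff[OF assms(1)] L2_norm_cutoff[OF assms(2)]
    unfolding L2_norm_def
  proof (intro real_sqrt_le_mono integral_mono L2_integrable_sq S T)
    show "(cmod (cutoff S f x))\<^sup>2 \<le> (cmod (cutoff T f x))\<^sup>2" for x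
      using assms(3) by (auto simp: cutoff_def)
  qed
qed

text \<open>The covering sets may overlap: balls will be covered by translated boxes, and the
  product set of the recursive step by translates of the larger body.\<close>

lemma L2_norm_UN_le:
  fixes S :: "'a::euclidean_space set"
  assumes S: "S \<in> sets lebesgue" and "finite I" and T: "\<And>i. i \<in> I \<Longrightarrow> T i \<in> sets lebesgue"
    and sub: "S \<subseteq> (\<Union>i\<in>I. T i)" and f: "\<And>i. i \<in> I \<Longrightarrow> f \<in> L2 (lebesgue_on (T i))" "f \<in> L2 (lebesgue_on S)"
  shows "(L2_norm (lebesgue_on S) f)\<^sup>2 \<le> (\<Sum>i\<in>I. (L2_norm (lebesgue_on (T i)) f)\<^sup>2)"
proof -
  have int: "integrable lebesgue (\<lambda>x. (cmod (cutoff (T i) f x))\<^sup>2)" if "i \<in> I" for i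
    using that T f(1) by (intro L2_integrable_sq) (simp add: L2_cutoff[symmetric])
  have "(L2_norm (lebesgue_on S) f)\<^sup>2 = (\<integral>x. (cmod (cutoff S f x))\<^sup>2 \<partial>lebesgue)"
    by (simp add: L2_norm_cutoff[OF S] L2_norm_sq)
  also have "\<dots> \<le> (\<integral>x. (\<Sum>i\<in>I. (cmod (cutoff (T i) f x))\<^sup>2) \<partial>lebesgue)"
  proof (rule integral_mono)
    show "integrable lebesgue (\<lambda>x. (cmod (cutoff S f x))\<^sup>2)"
      using S f(2) by (intro L2_integrable_sq) (simp add: L2_cutoff[symmetric])
    show "(cmod (cutoff S f x))\<^sup>2 \<le> (\<Sum>i\<in>I. (cmod (cutoff (T i) f x))\<^sup>2)" for x
    proof (cases "x \<in> S")
      case True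
      then obtain i where i: "i \<in> I" "x \<in> T i" using sub by auto
      then have "(cmod (cutoff S f x))\<^sup>2 = (cmod (cutoff (T i) f x))\<^sup>2" using True by (simp add: cutoff_def)
      also have "\<dots> \<le> (\<Sum>i\<in>I. (cmod (cutoff (T i) f x))\<^sup>2)"
        using i assms(2) by (intro member_le_sum) auto
      finally show ?thesis .
    qed (auto simp: cutoff_def intro: sum_nonneg)
  qed (use int in auto)
  also have "\<dots> = (\<Sum>i\<in>I. (\<integral>x. (cmod (cutoff (T i) f x))\<^sup>2 \<partial>lebesgue))"
    using int by (intro Bochner_Integration.integral_sum)
  also have "\<dots> = (\<Sum>i\<in>I. (L2_norm (lebesgue_on (T i)) f)\<^sup>2)"
    using T by (intro sum.cong refl) (simp add: L2_norm_cutoff L2_norm_sq)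
  finally show ?thesis .
qed

section \<open>Translation invariance of Lebesgue integrals\<close>

lemma measurable_lebesgue_translation [measurable]:
  "(\<lambda>x::'a::euclidean_space. x + v) \<in> lebesgue \<rightarrow>\<^sub>M lebesgue"
  using lebesgue_affine_measurable[of "\<lambda>_. 1" v] by (simp add: euclidean_representation add.commute)

lemma distr_lebesgue_translation:
  "distr lebesgue lebesgue (\<lambda>x::'a::euclidean_space. x + v) = lebesgue"
proof -
  have "(\<lambda>x::'a. v + (\<Sum>j\<in>Basis. (1 * (x \<bullet> j)) *\<^sub>R j)) = (\<lambda>x. x + v)"
    by (simp add: euclidean_representation add.commute)
  then have "lebesgue = density (distr lebesgue lebesgue (\<lambda>x::'a. x + v)) (\<lambda>_. 1)"
    using lebesgue_affine_euclidean[of "\<lambda>_. 1" "v::'a"] by simp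
  then show ?thesis by (simp add: density_1)
qed

lemma integral_lebesgue_translation:
  fixes f :: "'a::euclidean_space \<Rightarrow> 'b::{banach, second_countable_topology}"
  assumes "f \<in> borel_measurable lebesgue"
  shows "(\<integral>x. f (x + v) \<partial>lebesgue) = (\<integral>x. f x \<partial>lebesgue)"
  using integral_distr[OF measurable_lebesgue_translation[of v] assms] by (simp add: distr_lebesgue_translation)

lemma integrable_lebesgue_translation:
  fixes f :: "'a::euclidean_space \<Rightarrow> 'b::{banach, second_countable_topology}"
  assumes "integrable lebesgue f"
  shows "integrable lebesgue (\<lambda>x. f (x + v))"
  by (rule integrable_distr[OF measurable_lebesgue_translation[of v]]) (simp add: distr_lebesgue_translation assms)

lemma AE_lebesgue_translation:
  assumes "AE x::'a::euclidean_space in lebesgue. P x" shows "AE x in lebesgue. P (x + v)"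
  using assms by (intro AE_distrD[OF measurable_lebesgue_translation[of v]]) (simp only: distr_lebesgue_translation)

lemma L2_lebesgue_translation:
  assumes f: "f \<in> L2 lebesgue"
  shows "(\<lambda>x::'a::euclidean_space. f (x + v)) \<in> L2 lebesgue"
    and "L2_norm lebesgue (\<lambda>x. f (x + v)) = L2_norm lebesgue f"
proof -
  have [measurable]: "f \<in> borel_measurable lebesgue" using f by (rule L2_measurable)
  have "(\<lambda>x. f (x + v)) \<in> borel_measurable lebesgue"
    by (rule measurable_compose[OF measurable_lebesgue_translation]) fact
  then show "(\<lambda>x. f (x + v)) \<in> L2 lebesgue"
    using integrable_lebesgue_translation[OF L2_integrable_sq[OF f], of v] by (simp add: L2_def)
  show "L2_norm lebesgue (\<lambda>x. f (x + v)) = L2_norm lebesgue f"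
    unfolding L2_norm_def by (subst integral_lebesgue_translation[of "\<lambda>x. (cmod (f x))\<^sup>2" v]) auto
qed

lemma L2_norm_lebesgue_on_translation:
  fixes S :: "'a::euclidean_space set"
  assumes S: "S \<in> sets lebesgue" and T: "T \<in> sets lebesgue" "\<And>x. x + v \<in> T \<longleftrightarrow> x \<in> S"
    and f: "f \<in> L2 (lebesgue_on T)"
  shows "L2_norm (lebesgue_on S) (\<lambda>x. f (x + v)) = L2_norm (lebesgue_on T) f"
proof -
  have "cutoff S (\<lambda>x. f (x + v)) = (\<lambda>x. cutoff T f (x + v))" using T(2) by (auto simp: cutoff_def)
  then show ?thesis
    using L2_lebesgue_translation(2)[of "cutoff T f" v] f by (simp add: L2_norm_cutoff S T L2_cutoff)
qed

lemma continuous_L2: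
  fixes f :: "'a::euclidean_space \<Rightarrow> complex"
  assumes f: "continuous_on UNIV f" and S: "S \<in> sets lebesgue" "bounded S"
  shows "f \<in> L2 (lebesgue_on S)"
proof -
  obtain R where R: "S \<subseteq> cball 0 R" using S(2) by (auto simp: bounded_iff subset_eq)
  have "compact (f ` cball 0 R)" using f by (intro compact_continuous_image) (auto intro: continuous_on_subset)
  then have "bounded (f ` cball 0 R)" by (rule compact_imp_bounded)
  then obtain B where B: "\<And>x. x \<in> cball 0 R \<Longrightarrow> cmod (f x) \<le> B"
    unfolding bounded_iff by blast
  have "f \<in> borel_measurable lborel"
    using borel_measurable_continuous_onI[OF f] by simp
  then have "f \<in> borel_measurable lebesgue" by (rule measurable_completion)
  then have "cutoff S f \<in> borel_measurable lebesgue" unfolding cutoff_scaleR using S(1) by measurable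
  moreover have "integrable lebesgue (\<lambda>x. indicator S x *\<^sub>R B\<^sup>2)"
    using bounded_set_imp_lmeasurable[OF S(2,1)]
    by (intro integrable_scaleR_left integrable_real_indicator) (auto simp: fmeasurable_def)
  ultimately have "cutoff S f \<in> L2 lebesgue"
  proof (rule L2_I)
    show "(cmod (cutoff S f x))\<^sup>2 \<le> indicator S x *\<^sub>R B\<^sup>2" for x
      using B[of x] R by (auto simp: cutoff_def intro!: power_mono)
  qed
  then show ?thesis using S by (simp add: L2_cutoff)
qed

subsection \<open>Systems of exponentials\<close>

lemma norm_exponential [simp]: "cmod (exponential l x) = 1"
  by (simp add: exponential_def norm_exp_eq_Re)

lemma exponential_add_left: "exponential (l + m) x = exponential l x * exponential m x"
  by (simp add: exponential_def inner_add_left exp_add[symmetric] algebra_simps)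

lemma exponential_add_right: "exponential l (x + y) = exponential l x * exponential l y"
  by (simp add: exponential_def inner_add_right exp_add[symmetric] algebra_simps)

lemma exponential_zero [simp]: "exponential 0 x = 1" "exponential l 0 = 1"
  by (simp_all add: exponential_def)

lemma exponential_eq_1_iff: "exponential l x = 1 \<longleftrightarrow> l \<bullet> x \<in> \<int>"
proof -
  have "exponential l x = 1 \<longleftrightarrow> (\<exists>n::int. 2 * pi * (l \<bullet> x) = of_int (2 * n) * pi)"
    by (simp add: exponential_def exp_eq_1)
  also have "\<dots> \<longleftrightarrow> (\<exists>n::int. l \<bullet> x = of_int n)" by (simp add: mult.commute mult.left_commute)
  finally show ?thesis by (auto simp: Ints_def)
qed

lemma continuous_exponential [continuous_intros]: "continuous_on S (exponential l)"
  unfolding exponential_def[abs_def] by (intro continuous_intros)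

lemma continuous_lincomb_exponential [continuous_intros]: "continuous_on S (lincomb F c (\<lambda>i. exponential (t i)))"
  unfolding lincomb_def by (intro continuous_intros)

lemma exponential_L2: "S \<in> sets lebesgue \<Longrightarrow> bounded S \<Longrightarrow> exponential l \<in> L2 (lebesgue_on S)"
  by (intro continuous_L2 continuous_intros)

text \<open>A chord of the unit circle is no longer than its arc. The bound is uniform on bounded
  sets, which is what controls a perturbation of the frequencies.\<close>

lemma norm_exponential_diff_1_le: "cmod (exponential l x - 1) \<le> 2 * pi * norm l * norm x"
proof -
  have "cmod (exponential l x - 1) \<le> \<bar>2 * pi * (l \<bullet> x)\<bar>"
    using abs_sin_x_le_abs_x[of "pi * (l \<bullet> x)"] dist_exp_i_1[of "2 * pi * (l \<bullet> x)"]
    by (simp add: exponential_def mult.commute[of _ \<i>] abs_mult)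
  also have "\<dots> \<le> 2 * pi * (norm l * norm x)"
    using Cauchy_Schwarz_ineq2[of l x] by (simp add: abs_mult)
  finally show ?thesis by (simp add: mult.assoc)
qed

text \<open>The Bessel bound is demanded on every ball and not only on \<open>S\<close>, because
  frequencies found for a smaller set have to remain Bessel on the larger set built from it. The
  lower bound and completeness concern \<open>S\<close> itself.\<close>

definition exp_riesz :: "'a::euclidean_space set \<Rightarrow> 'a set \<Rightarrow> bool" where
  "exp_riesz S L \<longleftrightarrow> countable L \<and> (\<forall>R. bessel (lebesgue_on (cball 0 R)) L exponential) \<and>
     riesz_sequence (lebesgue_on S) L exponential \<and> complete_in (lebesgue_on S) L exponential"

lemma bessel_mono:
  assumes "bessel (lebesgue_on T) I e" "S \<in> sets lebesgue" "T \<in> sets lebesgue" "S \<subseteq> T"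
    "\<And>i. i \<in> I \<Longrightarrow> e i \<in> L2 (lebesgue_on T)"
  shows "bessel (lebesgue_on S) I e"
proof -
  obtain B where B: "\<And>F c. finite F \<Longrightarrow> F \<subseteq> I \<Longrightarrow>
     L2_norm (lebesgue_on T) (lincomb F c e) \<le> B * sqrt (\<Sum>i\<in>F. (cmod (c i))\<^sup>2)"
    using assms(1) by (rule besselE) blast
  have "L2_norm (lebesgue_on S) (lincomb F c e) \<le> B * sqrt (\<Sum>i\<in>F. (cmod (c i))\<^sup>2)"
    if "finite F" "F \<subseteq> I" for F c
  proof -
    have "lincomb F c e \<in> L2 (lebesgue_on T)" using assms(5) that by (intro lincomb_L2) blast
    from L2_lebesgue_on_mono(2)[OF assms(2-4) this] B[OF that] show ?thesis by (rule order_trans)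
  qed
  then show ?thesis unfolding bessel_def by blast
qed

lemma exp_riesz_bessel:
  assumes "exp_riesz \<Omega> L" "S \<in> sets lebesgue" "bounded S"
  shows "bessel (lebesgue_on S) L exponential"
proof -
  obtain R where R: "S \<subseteq> cball 0 R" using assms(3) by (auto simp: bounded_iff subset_eq)
  show ?thesis
    by (rule bessel_mono[OF _ assms(2) _ R])
       (use assms in \<open>auto simp: exp_riesz_def intro: exponential_L2\<close>)
qed

lemma exp_riesz_imp_riesz_basis:
  assumes "exp_riesz S L" "S \<in> sets lebesgue" "bounded S"
  shows "L2_riesz_basis (lebesgue_on S) L exponential"
  using assms exp_riesz_bessel[OF assms]
  by (intro riesz_basisI exponential_L2) (auto simp: exp_riesz_def)

subsection \<open>Perturbation\<close>

lemma lincomb_reindex: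
  assumes "inj_on \<tau> F"
  shows "lincomb (\<tau> ` F) c e = lincomb F (\<lambda>i. c (\<tau> i)) (\<lambda>i. e (\<tau> i))"
  unfolding lincomb_def by (simp add: sum.reindex[OF assms])

text \<open>Two equal functions with coefficients 1 and -1 cancel, against the lower bound. This
  guarantees that perturbed frequencies do not collide, so that the family can be replaced by its
  set of values.\<close>

lemma riesz_sequence_imp_inj_on:
  assumes "riesz_sequence M I (\<lambda>i. e (\<tau> i))"
  shows "inj_on \<tau> I"
proof (rule inj_onI, rule ccontr)
  fix i j assume ij: "i \<in> I" "j \<in> I" "\<tau> i = \<tau> j" "i \<noteq> j"
  define c where "c k = (if k = i then 1 else - 1 :: complex)" for k
  have "lincomb {i, j} c (\<lambda>i. e (\<tau> i)) = (\<lambda>x. 0)"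
    using ij by (simp add: lincomb_def c_def)
  then have "c i = 0" by (intro riesz_sequence_coeff_le[OF assms, of "{i, j}"]) (use ij in auto)
  then show False by (simp add: c_def)
qed

lemma
  assumes inj: "inj_on \<tau> I"
  shows bessel_reindex: "bessel M I (\<lambda>i. e (\<tau> i)) \<Longrightarrow> bessel M (\<tau> ` I) e"
    and riesz_sequence_reindex: "riesz_sequence M I (\<lambda>i. e (\<tau> i)) \<Longrightarrow> riesz_sequence M (\<tau> ` I) e"
proof -
  have F: "\<exists>G. finite G \<and> G \<subseteq> I \<and> inj_on \<tau> G \<and> F = \<tau> ` G" if "finite F" "F \<subseteq> \<tau> ` I" for F
  proof -
    obtain G where G: "G \<subseteq> I" "F = \<tau> ` G" using \<open>F \<subseteq> \<tau> ` I\<close> by (rule subset_imageE)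
    with inj have "inj_on \<tau> G" by (blast intro: inj_on_subset)
    with G \<open>finite F\<close> show ?thesis by (blast intro: finite_imageD)
  qed
  show "bessel M (\<tau> ` I) e" if b: "bessel M I (\<lambda>i. e (\<tau> i))"
  proof -
    obtain B where B: "\<And>F c. finite F \<Longrightarrow> F \<subseteq> I \<Longrightarrow>
       L2_norm M (lincomb F c (\<lambda>i. e (\<tau> i))) \<le> B * sqrt (\<Sum>i\<in>F. (cmod (c i))\<^sup>2)"
      using b by (rule besselE) blast
    have "L2_norm M (lincomb F c e) \<le> B * sqrt (\<Sum>i\<in>F. (cmod (c i))\<^sup>2)" if FI: "finite F" "F \<subseteq> \<tau> ` I" for F c
    proof -
      obtain G where G: "finite G" "G \<subseteq> I" "inj_on \<tau> G" "F = \<tau> ` G" using F[OF FI] by blast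
      show ?thesis using B[OF G(1,2), of "\<lambda>i. c (\<tau> i)"]
        unfolding G(4) lincomb_reindex[OF G(3)] by (simp add: sum.reindex[OF G(3)])
    qed
    then show ?thesis unfolding bessel_def by blast
  qed
  show "riesz_sequence M (\<tau> ` I) e" if b: "riesz_sequence M I (\<lambda>i. e (\<tau> i))"
  proof -
    obtain A where A: "\<And>F c. finite F \<Longrightarrow> F \<subseteq> I \<Longrightarrow>
       sqrt (\<Sum>i\<in>F. (cmod (c i))\<^sup>2) \<le> A * L2_norm M (lincomb F c (\<lambda>i. e (\<tau> i)))"
      using b by (rule riesz_sequenceE) blast
    have "sqrt (\<Sum>i\<in>F. (cmod (c i))\<^sup>2) \<le> A * L2_norm M (lincomb F c e)" if FI: "finite F" "F \<subseteq> \<tau> ` I" for F c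
    proof -
      obtain G where G: "finite G" "G \<subseteq> I" "inj_on \<tau> G" "F = \<tau> ` G" using F[OF FI] by blast
      show ?thesis using A[OF G(1,2), of "\<lambda>i. c (\<tau> i)"]
        unfolding G(4) lincomb_reindex[OF G(3)] by (simp add: sum.reindex[OF G(3)])
    qed
    then show ?thesis unfolding riesz_sequence_def by blast
  qed
qed

lemma L2_norm_bounded_mult_le:
  assumes f: "f \<in> L2 M" and m: "m \<in> borel_measurable M" "\<And>x. x \<in> space M \<Longrightarrow> cmod (m x) \<le> K" and "0 \<le> K"
  shows "(\<lambda>x. m x * f x) \<in> L2 M" "L2_norm M (\<lambda>x. m x * f x) \<le> K * L2_norm M f"
proof -
  have le: "(cmod (m x * f x))\<^sup>2 \<le> K\<^sup>2 * (cmod (f x))\<^sup>2" if "x \<in> space M" for x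
    unfolding norm_mult power_mult_distrib using m(2)[OF that] by (intro mult_right_mono power_mono) auto
  show L: "(\<lambda>x. m x * f x) \<in> L2 M"
    by (rule L2_I[where g = "\<lambda>x. K\<^sup>2 * (cmod (f x))\<^sup>2"]) (use f m(1) le in \<open>auto simp: L2_def\<close>)
  have "(L2_norm M (\<lambda>x. m x * f x))\<^sup>2 \<le> (\<integral>x. K\<^sup>2 * (cmod (f x))\<^sup>2 \<partial>M)"
    unfolding L2_norm_sq using L2_integrable_sq[OF L] L2_integrable_sq[OF f] le by (intro integral_mono) auto
  also have "\<dots> = (K * L2_norm M f)\<^sup>2" by (simp add: power_mult_distrib L2_norm_sq)
  finally show "L2_norm M (\<lambda>x. m x * f x) \<le> K * L2_norm M f"
    by (rule power2_le_imp_le) (use \<open>0 \<le> K\<close> in simp)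
qed

lemma exponential_measurable: "exponential l \<in> borel_measurable (lebesgue_on S)"
proof -
  have "exponential l \<in> borel_measurable lborel"
    using borel_measurable_continuous_onI[OF continuous_exponential] by simp
  then have "exponential l \<in> borel_measurable lebesgue" by (rule measurable_completion)
  then show ?thesis by (rule measurable_restrict_space1)
qed

text \<open>Only two shifts, by \<open>0\<close> and by a small multiple of \<open>u\<close>, are needed: the perturbed
  system then differs from the original one by the factor \<open>exponential (\<epsilon> *\<^sub>R u)\<close>
  on a part of the frequencies, and this factor is uniformly close to \<open>1\<close>.\<close>

lemma exp_riesz_avoid:
  fixes \<Omega> :: "'a::euclidean_space set"
  assumes L: "exp_riesz \<Omega> L" and \<Omega>: "\<Omega> \<in> sets lebesgue" "bounded \<Omega>" and u: "u \<noteq> 0"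
  shows "\<exists>L' \<delta>. exp_riesz \<Omega> L' \<and> \<delta> > 0 \<and> (\<forall>l\<in>L'. \<delta> \<le> cmod (exponential l u - 1)) \<and>
    (\<forall>b. b \<bullet> u = 0 \<longrightarrow> (\<forall>l\<in>L. l \<bullet> b \<in> \<int>) \<longrightarrow> (\<forall>l\<in>L'. l \<bullet> b \<in> \<int>))"
proof -
  define M where "M = lebesgue_on \<Omega>"
  obtain R where R: "R > 0" "\<And>x. x \<in> \<Omega> \<Longrightarrow> norm x \<le> R"
    using \<Omega>(2) bounded_pos by blast
  have eL: "\<And>l. exponential l \<in> L2 M" unfolding M_def using \<Omega> by (rule exponential_L2)
  have rs: "riesz_sequence M L exponential" and compl: "complete_in M L exponential"
    and count: "countable L" using L by (auto simp: exp_riesz_def M_def)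
  obtain A where A: "A > 0" "\<And>F c. finite F \<Longrightarrow> F \<subseteq> L \<Longrightarrow>
     sqrt (\<Sum>i\<in>F. (cmod (c i))\<^sup>2) \<le> A * L2_norm M (lincomb F c exponential)"
    using rs by (rule riesz_sequenceE) blast
  obtain B where B: "B > 0" "\<And>F c. finite F \<Longrightarrow> F \<subseteq> L \<Longrightarrow>
     L2_norm M (lincomb F c exponential) \<le> B * sqrt (\<Sum>i\<in>F. (cmod (c i))\<^sup>2)"
    using exp_riesz_bessel[OF L \<Omega>] unfolding M_def by (rule besselE) blast
  \<comment> \<open>The first bound keeps \<open>\<epsilon> * (u \<bullet> u)\<close> strictly
    between 0 and 1, so the shift changes <l,u> by a non-integer. The second gives
    \<open>K * A * B \<le> 1 / 2\<close>, which keeps the perturbation below the lower Riesz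
    bound.\<close>
  define \<epsilon> where "\<epsilon> = min (1 / (2 * (u \<bullet> u))) (1 / (4 * pi * norm u * R * A * B))"
  have \<epsilon>: "\<epsilon> > 0" using u R(1) A(1) B(1) by (simp add: \<epsilon>_def)
  define m where "m = exponential (\<epsilon> *\<^sub>R u)"
  define K where "K = 2 * pi * (\<epsilon> * norm u) * R"
  have K: "K \<ge> 0" using \<epsilon> R(1) by (simp add: K_def)
  have m_le: "cmod (m x - 1) \<le> 2 * pi * (\<epsilon> * norm u) * r" if "norm x \<le> r" for x r
  proof -
    have "cmod (m x - 1) \<le> 2 * pi * norm (\<epsilon> *\<^sub>R u) * norm x"
      unfolding m_def by (rule norm_exponential_diff_1_le)
    also have "\<dots> = 2 * pi * (\<epsilon> * norm u) * norm x" using \<epsilon> by simp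
    also have "\<dots> \<le> 2 * pi * (\<epsilon> * norm u) * r" using that \<epsilon> by (intro mult_left_mono) auto
    finally show ?thesis .
  qed
  have KAB: "K * A * B \<le> 1 / 2"
  proof -
    have "\<epsilon> * (4 * pi * norm u * R * A * B) \<le> (1 / (4 * pi * norm u * R * A * B)) * (4 * pi * norm u * R * A * B)"
      using R(1) A(1) B(1) by (intro mult_right_mono) (auto simp: \<epsilon>_def)
    also have "\<dots> = 1" using u R(1) A(1) B(1) by simp
    finally show ?thesis by (simp add: K_def algebra_simps)
  qed
  define \<eta> where "\<eta> = cmod (m u - 1)"
  have "\<eta> > 0"
  proof -
    have "0 < \<epsilon> * (u \<bullet> u)" using \<epsilon> u by simp
    moreover have "\<epsilon> * (u \<bullet> u) \<le> (1 / (2 * (u \<bullet> u))) * (u \<bullet> u)"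
      by (intro mult_right_mono) (auto simp: \<epsilon>_def)
    then have "\<epsilon> * (u \<bullet> u) < 1" using u by simp
    ultimately have "\<epsilon> * (u \<bullet> u) \<notin> \<int>" by (auto simp: Ints_def)
    then have "m u \<noteq> 1" by (simp add: m_def exponential_eq_1_iff)
    then show ?thesis by (simp add: \<eta>_def)
  qed
  \<comment> \<open>Only frequencies whose phase at \<open>u\<close> is closer than
    \<open>\<eta> / 2\<close> to 1 are moved. The shift multiplies that phase by \<open>m u\<close>,
    at distance \<open>\<eta>\<close> from 1, which leaves a distance of at least
    \<open>\<eta> / 2\<close>.\<close>
  define J where "J = {l\<in>L. cmod (exponential l u - 1) < \<eta> / 2}"
  define \<tau> where "\<tau> l = (if l \<in> J then l + \<epsilon> *\<^sub>R u else l)" for l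
  define e' where "e' l = exponential (\<tau> l)" for l
  have \<tau>_avoid: "\<eta> / 2 \<le> cmod (exponential (\<tau> l) u - 1)" if "l \<in> L" for l
  proof (cases "l \<in> J")
    case True
    have "\<eta> = cmod (exponential l u * (m u - 1))" by (simp add: \<eta>_def norm_mult)
    also have "exponential l u * (m u - 1) = (exponential (\<tau> l) u - 1) - (exponential l u - 1)"
      using True by (simp add: \<tau>_def exponential_add_left m_def algebra_simps)
    also have "cmod \<dots> \<le> cmod (exponential (\<tau> l) u - 1) + cmod (exponential l u - 1)"
      by (rule norm_triangle_ineq4)
    finally show ?thesis using True by (simp add: J_def)
  qed (use that in \<open>simp add: J_def \<tau>_def\<close>)
  have diff: "lincomb F c e' x = lincomb F c exponential x + (m x - 1) * lincomb (F \<inter> J) c exponential x"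
    if "finite F" for F c x
  proof -
    have "lincomb F c e' x = (\<Sum>l\<in>F. c l * exponential l x + (if l \<in> J then (m x - 1) * (c l * exponential l x) else 0))"
      unfolding lincomb_def by (intro sum.cong refl) (simp add: e'_def \<tau>_def exponential_add_left m_def algebra_simps)
    also have "\<dots> = lincomb F c exponential x + (\<Sum>l\<in>F. if l \<in> J then (m x - 1) * (c l * exponential l x) else 0)"
      by (simp add: sum.distrib lincomb_def)
    also have "(\<Sum>l\<in>F. if l \<in> J then (m x - 1) * (c l * exponential l x) else 0) = (m x - 1) * lincomb (F \<inter> J) c exponential x"
      using that by (simp add: lincomb_def sum.inter_restrict sum_distrib_left) (intro sum.cong refl, simp)
    finally show ?thesis .
  qed
  have sum_J: "sqrt (\<Sum>i\<in>F \<inter> J. (cmod (c i))\<^sup>2) \<le> sqrt (\<Sum>i\<in>F. (cmod (c i))\<^sup>2)" if "finite F" for F c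
    using that by (intro real_sqrt_le_mono sum_mono2) auto
  have m_meas: "(\<lambda>x. m x - 1) \<in> borel_measurable (lebesgue_on S)" for S
    unfolding m_def using exponential_measurable[of "\<epsilon> *\<^sub>R u" S] by simp
  have pert: "L2_norm (lebesgue_on S) (\<lambda>x. (m x - 1) * lincomb (F \<inter> J) c exponential x)
      \<le> (2 * pi * (\<epsilon> * norm u) * r) * (C * sqrt (\<Sum>i\<in>F. (cmod (c i))\<^sup>2))"
    and pert_L2: "(\<lambda>x. (m x - 1) * lincomb (F \<inter> J) c exponential x) \<in> L2 (lebesgue_on S)"
    if S: "S \<in> sets lebesgue" "bounded S" "\<And>x. x \<in> S \<Longrightarrow> norm x \<le> r" "r \<ge> 0" and F: "finite F" "F \<subseteq> L"
      and C: "C \<ge> 0" "\<And>F c. finite F \<Longrightarrow> F \<subseteq> L \<Longrightarrow>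
        L2_norm (lebesgue_on S) (lincomb F c exponential) \<le> C * sqrt (\<Sum>i\<in>F. (cmod (c i))\<^sup>2)"
    for S r C F c
  proof -
    have FJ: "lincomb (F \<inter> J) c exponential \<in> L2 (lebesgue_on S)" using S by (intro lincomb_L2 exponential_L2)
    have r: "2 * pi * (\<epsilon> * norm u) * r \<ge> 0" using \<epsilon> \<open>r \<ge> 0\<close> by simp
    have mx: "cmod (m x - 1) \<le> 2 * pi * (\<epsilon> * norm u) * r" if "x \<in> space (lebesgue_on S)" for x
      using that S(3) by (intro m_le) simp
    note bd = L2_norm_bounded_mult_le[OF FJ m_meas mx r]
    show "(\<lambda>x. (m x - 1) * lincomb (F \<inter> J) c exponential x) \<in> L2 (lebesgue_on S)" by (rule bd)
    have "L2_norm (lebesgue_on S) (lincomb (F \<inter> J) c exponential) \<le> C * sqrt (\<Sum>i\<in>F \<inter> J. (cmod (c i))\<^sup>2)"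
      using F by (intro C) auto
    also have "\<dots> \<le> C * sqrt (\<Sum>i\<in>F. (cmod (c i))\<^sup>2)" using sum_J[OF F(1)] C(1) by (intro mult_left_mono)
    finally show "L2_norm (lebesgue_on S) (\<lambda>x. (m x - 1) * lincomb (F \<inter> J) c exponential x)
      \<le> (2 * pi * (\<epsilon> * norm u) * r) * (C * sqrt (\<Sum>i\<in>F. (cmod (c i))\<^sup>2))"
      using bd(2) r by (meson mult_left_mono order_trans)
  qed
  have lin_L2: "lincomb F c exponential \<in> L2 M" for F c using eL by (intro lincomb_L2)
  have lin_L2': "lincomb F c e' \<in> L2 M" for F c unfolding e'_def using eL by (intro lincomb_L2)
  have pert_\<Omega>: "L2_norm M (\<lambda>x. lincomb F c exponential x - lincomb F c e' x) \<le> K * B * sqrt (\<Sum>i\<in>F. (cmod (c i))\<^sup>2)"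
    if F: "finite F" "F \<subseteq> L" for F c
  proof -
    have "L2_norm M (\<lambda>x. lincomb F c exponential x - lincomb F c e' x)
        = L2_norm M (\<lambda>x. (m x - 1) * lincomb (F \<inter> J) c exponential x)"
      by (subst L2_norm_minus_commute) (simp add: diff[OF F(1)])
    also have "\<dots> \<le> K * (B * sqrt (\<Sum>i\<in>F. (cmod (c i))\<^sup>2))"
      unfolding M_def K_def using \<Omega> R B F by (intro pert) (auto simp: M_def)
    finally show ?thesis by (simp add: mult.assoc)
  qed
  have riesz': "riesz_sequence M L e'"
    unfolding riesz_sequence_def
  \<comment> \<open>The constant doubles because half of the coefficient norm is absorbed on the
    left.\<close>
  proof (intro exI[of _ "2 * A"] allI impI)
    fix F and c :: "'a \<Rightarrow> complex" assume F: "finite F" "F \<subseteq> L"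
    define n where "n = sqrt (\<Sum>i\<in>F. (cmod (c i))\<^sup>2)"
    have "n \<ge> 0" by (simp add: n_def sum_nonneg)
    have "n \<le> A * L2_norm M (lincomb F c exponential)" unfolding n_def by (rule A(2)[OF F])
    also have "\<dots> \<le> A * (L2_norm M (lincomb F c e') + K * B * n)"
    proof (rule mult_left_mono)
      show "L2_norm M (lincomb F c exponential) \<le> L2_norm M (lincomb F c e') + K * B * n"
        using L2_norm_triangle_sub[OF lin_L2 lin_L2', of F c F c] pert_\<Omega>[OF F, of c] unfolding n_def by linarith
    qed (use A(1) in simp)
    also have "\<dots> = A * L2_norm M (lincomb F c e') + (K * A * B) * n" by (simp add: algebra_simps)
    also have "\<dots> \<le> A * L2_norm M (lincomb F c e') + (1 / 2) * n"
      using KAB \<open>n \<ge> 0\<close> by (intro add_left_mono mult_right_mono)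
    finally show "sqrt (\<Sum>i\<in>F. (cmod (c i))\<^sup>2) \<le> 2 * A * L2_norm M (lincomb F c e')" unfolding n_def[symmetric] by simp
  qed
  then have inj: "inj_on \<tau> L" unfolding e'_def by (rule riesz_sequence_imp_inj_on)
  have bessel': "bessel (lebesgue_on (cball 0 r)) L e'" for r
  proof (cases "r \<ge> 0")
    case r: True
    define S where "S = cball (0::'a) r"
    have S: "S \<in> sets lebesgue" "bounded S" "\<And>x. x \<in> S \<Longrightarrow> norm x \<le> r" by (auto simp: S_def)
    obtain C where C: "C > 0" "\<And>F c. finite F \<Longrightarrow> F \<subseteq> L \<Longrightarrow>
       L2_norm (lebesgue_on S) (lincomb F c exponential) \<le> C * sqrt (\<Sum>i\<in>F. (cmod (c i))\<^sup>2)"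
      using exp_riesz_bessel[OF L S(1,2)] by (rule besselE) blast
    have "L2_norm (lebesgue_on S) (lincomb F c e') \<le> (C + 2 * pi * (\<epsilon> * norm u) * r * C) * sqrt (\<Sum>i\<in>F. (cmod (c i))\<^sup>2)"
      if F: "finite F" "F \<subseteq> L" for F c
    proof -
      have C0: "C \<ge> 0" using C(1) by simp
      have "L2_norm (lebesgue_on S) (lincomb F c e') \<le> L2_norm (lebesgue_on S) (lincomb F c exponential)
        + L2_norm (lebesgue_on S) (\<lambda>x. (m x - 1) * lincomb (F \<inter> J) c exponential x)"
        unfolding diff[OF F(1), THEN ext] using S pert_L2[OF S r F C0 C(2)]
        by (intro L2_norm_triangle lincomb_L2 exponential_L2)
      also have "\<dots> \<le> C * sqrt (\<Sum>i\<in>F. (cmod (c i))\<^sup>2) + (2 * pi * (\<epsilon> * norm u) * r) * (C * sqrt (\<Sum>i\<in>F. (cmod (c i))\<^sup>2))"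
        by (intro add_mono C(2)[OF F] pert[OF S r F C0 C(2)])
      finally show ?thesis by (simp add: algebra_simps)
    qed
    then show ?thesis unfolding bessel_def S_def by blast
  \<comment> \<open>A ball of negative radius is empty and carries only functions of norm
    zero.\<close>
  next
    case False
    then have "lebesgue_on (cball (0::'a) r) = lebesgue_on {}" by simp
    then show ?thesis unfolding bessel_def by (intro exI[of _ 0]) (simp add: L2_norm_def)
  qed
  have complete': "complete_in M (\<tau> ` L) exponential"
    unfolding complete_in_def
  proof (intro ballI impI)
    fix f assume f: "f \<in> L2 M" and "\<forall>l\<in>\<tau> ` L. L2_inner M f (exponential l) = 0"
    then have f0: "L2_inner M f (e' l) = 0" if "l \<in> L" for l using that by (simp add: e'_def)
    \<comment> \<open>Being orthogonal to the perturbed combination \<open>g'\<close>, the function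
      \<open>f\<close> has norm at most its distance from \<open>g'\<close>. That distance is at
      most \<open>\<epsilon>' / 3\<close> plus half of the norm of \<open>g\<close>, and the norm of
      \<open>g\<close> exceeds that of \<open>f\<close> by at most \<open>\<epsilon>' / 3\<close>;
      solving for the norm of \<open>f\<close> gives at most \<open>\<epsilon>'\<close>.\<close>
    have "L2_norm M f \<le> 0 + \<epsilon>'" if "\<epsilon>' > 0" for \<epsilon>'
    proof -
      have "dense_span M L exponential" by (rule complete_imp_dense_span[OF count eL rs compl])
      then obtain F c where F: "finite F" "F \<subseteq> L" "L2_norm M (\<lambda>x. f x - lincomb F c exponential x) < \<epsilon>' / 3"
        using dense_spanD[of M L exponential f "\<epsilon>' / 3"] f \<open>\<epsilon>' > 0\<close> by auto
      define g where "g = lincomb F c exponential"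
      define g' where "g' = lincomb F c e'"
      have gL: "g \<in> L2 M" "g' \<in> L2 M" unfolding g_def g'_def by (rule lin_L2 lin_L2')+
      have "L2_norm M (\<lambda>x. g x - g' x) \<le> K * B * sqrt (\<Sum>i\<in>F. (cmod (c i))\<^sup>2)"
        unfolding g_def g'_def by (rule pert_\<Omega>[OF F(1,2)])
      also have "\<dots> \<le> K * B * (A * L2_norm M g)"
        unfolding g_def using K B(1) by (intro mult_left_mono A(2)[OF F(1,2)]) auto
      also have "\<dots> = (K * A * B) * L2_norm M g" by (simp add: algebra_simps)
      also have "\<dots> \<le> 1 / 2 * L2_norm M g" using KAB by (intro mult_right_mono) auto
      finally have gg: "L2_norm M (\<lambda>x. g x - g' x) \<le> 1 / 2 * L2_norm M g" .
      have "L2_inner M f g' = 0"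
      proof -
        have "L2_inner M f g' = (\<Sum>l\<in>F. cnj (c l) * L2_inner M f (e' l))"
          unfolding g'_def using eL f by (intro L2_inner_lincomb_right) (auto simp: e'_def)
        also have "\<dots> = 0" using f0 F(2) by (intro sum.neutral) auto
        finally show ?thesis .
      qed
      then have "complex_of_real ((L2_norm M f)\<^sup>2) = L2_inner M f (\<lambda>x. f x - g' x)"
        using f gL by (simp add: L2_inner_diff_right L2_inner_self)
      then have "(L2_norm M f)\<^sup>2 = cmod (L2_inner M f (\<lambda>x. f x - g' x))"
        by (metis norm_of_real abs_of_nonneg zero_le_power2)
      also have "\<dots> \<le> L2_norm M f * L2_norm M (\<lambda>x. f x - g' x)"
        by (intro L2_Cauchy_Schwarz f L2_diff gL)
      finally have le: "L2_norm M f \<le> L2_norm M (\<lambda>x. f x - g' x)"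
        by (cases "L2_norm M f = 0") (auto simp: power2_eq_square mult_le_cancel_left order.strict_iff_order)
      have "L2_norm M g \<le> L2_norm M f + L2_norm M (\<lambda>x. g x - f x)"
        by (rule L2_norm_triangle_sub[OF gL(1) f])
      with le gg L2_norm_triangle3[OF f gL] F(3) show ?thesis
        unfolding g_def[symmetric] L2_norm_minus_commute[of M g f] by linarith
    qed
    then have "L2_norm M f \<le> 0" by (rule field_le_epsilon)
    then have "L2_norm M f = 0" by (simp add: order_antisym)
    then show "ae_eq M f (\<lambda>x. 0)" using L2_norm_eq_0_iff[OF f] by simp
  qed
  have "exp_riesz \<Omega> (\<tau> ` L)"
    unfolding exp_riesz_def M_def[symmetric]
    using bessel_reindex[OF inj, of _ exponential] riesz_sequence_reindex[OF inj, of M exponential]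
      bessel' riesz' complete' count unfolding e'_def[abs_def] by simp
  \<comment> \<open>Shifts along \<open>u\<close> are invisible to directions orthogonal to
    \<open>u\<close>.\<close>
  moreover have "\<tau> l \<bullet> b \<in> \<int>" if "b \<bullet> u = 0" "\<forall>l\<in>L. l \<bullet> b \<in> \<int>" "l \<in> L" for b l
    using that by (simp add: \<tau>_def inner_add_left inner_commute[of u b])
  ultimately show ?thesis
    using \<tau>_avoid \<open>\<eta> > 0\<close> by (intro exI[of _ "\<tau> ` L"] exI[of _ "\<eta> / 2"]) auto
qed

subsection \<open>Adding a segment\<close>

lemma bessel_Un:
  assumes 1: "bessel M I e" and 2: "bessel M J e" and e: "\<And>i. i \<in> I \<union> J \<Longrightarrow> e i \<in> L2 M"
  shows "bessel M (I \<union> J) e"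
proof -
  obtain B1 where B1: "B1 > 0" "\<And>F c. finite F \<Longrightarrow> F \<subseteq> I \<Longrightarrow>
     L2_norm M (lincomb F c e) \<le> B1 * sqrt (\<Sum>i\<in>F. (cmod (c i))\<^sup>2)"
    using 1 by (rule besselE) blast
  obtain B2 where B2: "B2 > 0" "\<And>F c. finite F \<Longrightarrow> F \<subseteq> J \<Longrightarrow>
     L2_norm M (lincomb F c e) \<le> B2 * sqrt (\<Sum>i\<in>F. (cmod (c i))\<^sup>2)"
    using 2 by (rule besselE) blast
  have "L2_norm M (lincomb F c e) \<le> (B1 + B2) * sqrt (\<Sum>i\<in>F. (cmod (c i))\<^sup>2)"
    if F: "finite F" "F \<subseteq> I \<union> J" for F c
  proof -
    have mono: "sqrt (\<Sum>i\<in>G. (cmod (c i))\<^sup>2) \<le> sqrt (\<Sum>i\<in>F. (cmod (c i))\<^sup>2)" if "G \<subseteq> F" for G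
      using that F by (intro real_sqrt_le_mono sum_mono2) auto
    have "lincomb F c e = lincomb ((F \<inter> I) \<union> (F - I)) c e" by (simp add: Int_Diff_Un)
    then have "lincomb F c e = (\<lambda>x. lincomb (F \<inter> I) c e x + lincomb (F - I) c e x)"
      using F(1) by (subst lincomb_Un[symmetric]) auto
    then have "L2_norm M (lincomb F c e) \<le> L2_norm M (lincomb (F \<inter> I) c e) + L2_norm M (lincomb (F - I) c e)"
      using e F(2) by (simp only:) (intro L2_norm_triangle lincomb_L2, auto)
    also have "\<dots> \<le> B1 * sqrt (\<Sum>i\<in>F \<inter> I. (cmod (c i))\<^sup>2) + B2 * sqrt (\<Sum>i\<in>F - I. (cmod (c i))\<^sup>2)"
      using F by (intro add_mono B1 B2) auto
    also have "\<dots> \<le> B1 * sqrt (\<Sum>i\<in>F. (cmod (c i))\<^sup>2) + B2 * sqrt (\<Sum>i\<in>F. (cmod (c i))\<^sup>2)"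
      using B1(1) B2(1) by (intro add_mono mult_left_mono mono) auto
    finally show ?thesis by (simp add: algebra_simps)
  qed
  then show ?thesis unfolding bessel_def by blast
qed

lemma exponential_periodic:
  assumes "l \<bullet> u \<in> \<int>" shows "exponential l (x + of_int k *\<^sub>R u) = exponential l x"
proof -
  have "l \<bullet> (of_int k *\<^sub>R u) \<in> \<int>" using assms by simp
  then show ?thesis unfolding exponential_add_right exponential_eq_1_iff[symmetric] by simp
qed

text \<open>One N serves all points, so sums over the multiples of \<open>u\<close> run over a fixed
  finite range and no question of convergence arises.\<close>

lemma bounded_multiples:
  fixes S :: "'a::real_normed_vector set"
  assumes "bounded S" "u \<noteq> 0"
  shows "\<exists>N::nat. \<forall>x\<in>S. \<forall>k::int. x + of_int k *\<^sub>R u \<in> S \<longrightarrow> \<bar>k\<bar> \<le> int N"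
proof -
  obtain R where R: "\<And>x. x \<in> S \<Longrightarrow> norm x \<le> R" using assms(1) by (auto simp: bounded_iff)
  define N where "N = nat \<lceil>2 * R / norm u\<rceil>"
  have "\<bar>k\<bar> \<le> int N" if "x \<in> S" "x + of_int k *\<^sub>R u \<in> S" for x and k :: int
  proof -
    have "\<bar>of_int k\<bar> * norm u = norm ((x + of_int k *\<^sub>R u) - x)" by simp
    also have "\<dots> \<le> 2 * R" using R[OF that(1)] R[OF that(2)] norm_triangle_ineq4[of "x + of_int k *\<^sub>R u" x] by linarith
    finally have "\<bar>of_int k\<bar> \<le> 2 * R / norm u" using assms(2) by (simp add: field_simps)
    then show ?thesis unfolding N_def by linarith
  qed
  then show ?thesis by blast
qed

section \<open>Periodization along a generator\<close>

context
  fixes \<Omega> Q :: "'a::euclidean_space set" and u :: 'a and L1 L2' :: "'a set" and \<delta> :: real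
  assumes \<Omega>: "compact \<Omega>" "convex \<Omega>" and Q: "compact Q" and u: "u \<noteq> 0"
    and tile: "\<And>x. x \<in> \<Omega> \<Longrightarrow> \<exists>k::int. x - of_int k *\<^sub>R u \<in> Q \<and> (x - of_int k *\<^sub>R u) \<bullet> u < u \<bullet> u"
    and cover: "\<And>y. y \<in> Q \<Longrightarrow> \<exists>k::int. y + of_int k *\<^sub>R u \<in> \<Omega>"
    and strip: "\<And>y. y \<in> Q \<Longrightarrow> 0 \<le> y \<bullet> u \<and> y \<bullet> u \<le> u \<bullet> u"
    and L1: "exp_riesz {x\<in>\<Omega>. x + u \<in> \<Omega>} L1" "\<delta> > 0" "\<And>l. l \<in> L1 \<Longrightarrow> \<delta> \<le> cmod (exponential l u - 1)"
    and L2: "exp_riesz Q L2'" "\<And>l. l \<in> L2' \<Longrightarrow> l \<bullet> u \<in> \<int>"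
begin

text \<open>The erosion of \<open>\<Omega>\<close> by a segment: by convexity, the points from which
  the whole segment up to \<open>x + u\<close> stays inside. For a zonotope with generator
  \<open>u\<close> it is the summand left after removing \<open>u\<close>.\<close>

private definition "\<Omega>1 = {x\<in>\<Omega>. x + u \<in> \<Omega>}"

private lemma sets_\<Omega>: "\<Omega> \<in> sets lebesgue" "bounded \<Omega>" "Q \<in> sets lebesgue" "bounded Q"
  using \<Omega> Q by (auto intro: compact_imp_bounded lmeasurable_compact fmeasurableD)

private lemma sets_\<Omega>1: "\<Omega>1 \<in> sets lebesgue" "bounded \<Omega>1" "\<Omega>1 \<subseteq> \<Omega>"
proof -
  have "\<Omega>1 = \<Omega> \<inter> (+) (- u) ` \<Omega>"
    by (auto simp: \<Omega>1_def image_iff intro!: bexI[of _ "_ + u"])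
  moreover have "compact (\<Omega> \<inter> (+) (- u) ` \<Omega>)" using \<Omega>(1) by (intro compact_Int compact_translation)
  ultimately show "\<Omega>1 \<in> sets lebesgue" "bounded \<Omega>1"
    by (auto intro: compact_imp_bounded lmeasurable_compact fmeasurableD)
qed (auto simp: \<Omega>1_def)

text \<open>The difference of \<open>h\<close> under translation by \<open>u\<close> loses the
  periodic half and carries the \<open>L1\<close> coefficients times factors of modulus at least
  \<open>\<delta>\<close>, which bounds these coefficients. The Bessel bound then allows the
  \<open>L1\<close> half to be subtracted from \<open>h\<close>, and periodicity carries the
  remainder from \<open>\<Omega>\<close> to \<open>Q\<close>, where the lower bound for
  \<open>L2'\<close> applies.\<close>

private lemma riesz_sequence_step: "riesz_sequence (lebesgue_on \<Omega>) (L1 \<union> L2') exponential"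
proof -
  define n where "n h = L2_norm (lebesgue_on \<Omega>) h" for h :: "'a \<Rightarrow> complex"
  have lin: "lincomb F c exponential \<in> L2 (lebesgue_on S)" if "S \<in> sets lebesgue" "bounded S" for F c and S :: "'a set"
    using that by (intro lincomb_L2 exponential_L2)
  obtain A1 where A1: "A1 > 0" "\<And>F c. finite F \<Longrightarrow> F \<subseteq> L1 \<Longrightarrow>
     sqrt (\<Sum>i\<in>F. (cmod (c i))\<^sup>2) \<le> A1 * L2_norm (lebesgue_on \<Omega>1) (lincomb F c exponential)"
    using L1(1) unfolding exp_riesz_def \<Omega>1_def by (auto elim: riesz_sequenceE)
  obtain A2 where A2: "A2 > 0" "\<And>F c. finite F \<Longrightarrow> F \<subseteq> L2' \<Longrightarrow>
     sqrt (\<Sum>i\<in>F. (cmod (c i))\<^sup>2) \<le> A2 * L2_norm (lebesgue_on Q) (lincomb F c exponential)"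
    using L2(1) unfolding exp_riesz_def by (auto elim: riesz_sequenceE)
  obtain B where B: "B > 0" "\<And>F c. finite F \<Longrightarrow> F \<subseteq> L1 \<Longrightarrow>
     n (lincomb F c exponential) \<le> B * sqrt (\<Sum>i\<in>F. (cmod (c i))\<^sup>2)"
    using exp_riesz_bessel[OF L1(1) sets_\<Omega>(1,2)] unfolding n_def by (auto elim: besselE)
  obtain N :: nat where N: "\<And>x k. x \<in> \<Omega> \<union> Q \<Longrightarrow> x + of_int k *\<^sub>R u \<in> \<Omega> \<union> Q \<Longrightarrow> \<bar>k\<bar> \<le> int N"
    using bounded_multiples[of "\<Omega> \<union> Q" u] sets_\<Omega> u by auto
  have trans: "L2_norm (lebesgue_on S) (\<lambda>x. lincomb F c exponential (x + v)) \<le> n (lincomb F c exponential)"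
    if S: "S \<in> sets lebesgue" "bounded S" "\<And>x. x \<in> S \<Longrightarrow> x + v \<in> \<Omega>" for S v F c
  proof -
    define T where "T = (+) v ` S"
    have T: "T \<in> sets lebesgue" "bounded T"
      unfolding T_def by (rule lebesgue_sets_translation[OF S(1)], rule bounded_translation[OF S(2)])
    have T': "T \<subseteq> \<Omega>" "\<And>x. x + v \<in> T \<longleftrightarrow> x \<in> S"
      using S(3) by (auto simp: T_def add.commute)
    have "L2_norm (lebesgue_on S) (\<lambda>x. lincomb F c exponential (x + v)) = L2_norm (lebesgue_on T) (lincomb F c exponential)"
      by (rule L2_norm_lebesgue_on_translation[OF S(1) T(1) T'(2) lin[OF T]])
    also have "\<dots> \<le> n (lincomb F c exponential)"
      unfolding n_def by (rule L2_lebesgue_on_mono(2)[OF T(1) sets_\<Omega>(1) T'(1) lin[OF sets_\<Omega>(1,2)]])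
    finally show ?thesis .
  qed
  \<comment> \<open>The 2 counts the two copies of \<open>h\<close> in the difference, and division
    by \<open>\<delta>\<close> undoes the factors. In \<open>C\<close> the second summand is the
    price of subtracting the \<open>L1\<close> half and of covering \<open>Q\<close> by 2 N + 1
    translates of \<open>\<Omega>\<close>.\<close>
  define C1 where "C1 = 2 * A1 / \<delta>"
  define C where "C = C1 + A2 * ((2 * N + 1) * (1 + B * C1))"
  have C1: "C1 \<ge> 0" using A1(1) L1(2) by (simp add: C1_def)
  have "sqrt (\<Sum>i\<in>F. (cmod (c i))\<^sup>2) \<le> C * n (lincomb F c exponential)" if F: "finite F" "F \<subseteq> L1 \<union> L2'" for F c
  proof -
    define F1 where "F1 = F \<inter> L1"
    define F2 where "F2 = F - L1"
    have F12: "finite F1" "finite F2" "F1 \<subseteq> L1" "F2 \<subseteq> L2'" "F1 \<inter> F2 = {}" "F = F1 \<union> F2"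
      using F by (auto simp: F1_def F2_def)
    define h where "h = lincomb F c exponential"
    define G where "G = lincomb F2 c exponential"
    define n1 where "n1 = sqrt (\<Sum>i\<in>F1. (cmod (c i))\<^sup>2)"
    define n2 where "n2 = sqrt (\<Sum>i\<in>F2. (cmod (c i))\<^sup>2)"
    have hG: "h x = lincomb F1 c exponential x + G x" for x
      unfolding h_def G_def F12(6) by (rule lincomb_Un[OF F12(1,2,5)])
    have G_per: "G (x + of_int k *\<^sub>R u) = G x" for x k
      unfolding G_def lincomb_def using F12(4) L2(2) by (intro sum.cong refl) (auto simp: exponential_periodic)
    define c' where "c' l = c l * (exponential l u - 1)" for l
    have Dh: "h (x + u) - h x = lincomb F1 c' exponential x" for x
      using G_per[of x 1] unfolding hG
      by (simp add: lincomb_def c'_def sum_subtractf[symmetric] exponential_add_right algebra_simps)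
    have n1: "n1 \<le> C1 * n h"
    proof -
      have "\<delta> * n1 = sqrt (\<Sum>i\<in>F1. (\<delta> * cmod (c i))\<^sup>2)"
        using L1(2) by (simp add: n1_def power_mult_distrib sum_distrib_left[symmetric] real_sqrt_mult)
      also have "\<dots> \<le> sqrt (\<Sum>i\<in>F1. (cmod (c' i))\<^sup>2)"
      proof (intro real_sqrt_le_mono sum_mono power_mono)
        fix i assume "i \<in> F1"
        then have "\<delta> * cmod (c i) \<le> cmod (exponential i u - 1) * cmod (c i)"
          using F12(3) by (intro mult_right_mono L1(3)) auto
        then show "\<delta> * cmod (c i) \<le> cmod (c' i)" by (simp add: c'_def norm_mult mult.commute)
      qed (use L1(2) in simp)
      also have "\<dots> \<le> A1 * L2_norm (lebesgue_on \<Omega>1) (lincomb F1 c' exponential)" by (rule A1(2)[OF F12(1,3)])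
      also have "\<dots> \<le> A1 * (n h + n h)"
      proof (rule mult_left_mono)
        have hL: "h \<in> L2 (lebesgue_on \<Omega>1)" unfolding h_def using sets_\<Omega>1 by (intro lin)
        have huL: "(\<lambda>x. h (x + u)) \<in> L2 (lebesgue_on \<Omega>1)"
        proof (rule continuous_L2[OF _ sets_\<Omega>1(1,2)])
          show "continuous_on UNIV (\<lambda>x. h (x + u))"
            unfolding h_def by (rule continuous_on_compose2[OF continuous_lincomb_exponential]) (auto intro: continuous_intros)
        qed
        have "L2_norm (lebesgue_on \<Omega>1) (lincomb F1 c' exponential) = L2_norm (lebesgue_on \<Omega>1) (\<lambda>x. h (x + u) - h x)"
          by (simp add: Dh)
        also have "\<dots> \<le> L2_norm (lebesgue_on \<Omega>1) (\<lambda>x. h (x + u)) + L2_norm (lebesgue_on \<Omega>1) h"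
          by (rule L2_norm_triangle_diff[OF huL hL])
        also have "L2_norm (lebesgue_on \<Omega>1) (\<lambda>x. h (x + u)) \<le> n h"
          unfolding h_def using sets_\<Omega>1 by (intro trans) (auto simp: \<Omega>1_def)
        also have "L2_norm (lebesgue_on \<Omega>1) h \<le> n h"
          unfolding h_def n_def
          by (rule L2_lebesgue_on_mono(2)[OF sets_\<Omega>1(1) sets_\<Omega>(1) sets_\<Omega>1(3) lin[OF sets_\<Omega>(1,2)]])
        finally show "L2_norm (lebesgue_on \<Omega>1) (lincomb F1 c' exponential) \<le> n h + n h" by simp
      qed (use A1(1) in simp)
      finally show ?thesis using L1(2) by (simp add: C1_def field_simps)
    qed
    have nG: "n G \<le> (1 + B * C1) * n h"
    proof -
      have L: "h \<in> L2 (lebesgue_on \<Omega>)" "lincomb F1 c exponential \<in> L2 (lebesgue_on \<Omega>)"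
        unfolding h_def using sets_\<Omega> by (intro lin; simp)+
      have "n G = n (\<lambda>x. h x - lincomb F1 c exponential x)" by (simp add: hG)
      also have "\<dots> \<le> n h + n (lincomb F1 c exponential)" unfolding n_def by (rule L2_norm_triangle_diff[OF L])
      also have "n (lincomb F1 c exponential) \<le> B * n1" unfolding n1_def by (rule B(2)[OF F12(1,3)])
      also have "\<dots> \<le> B * (C1 * n h)" using n1 B(1) by (intro mult_left_mono) auto
      finally show ?thesis by (simp add: algebra_simps)
    qed
    \<comment> \<open>By \<open>cover\<close>, translates of \<open>\<Omega>\<close> by at most N
      multiples of \<open>u\<close> in either direction cover \<open>Q\<close>; on each of them the
      periodic \<open>G\<close> has norm at most its norm on \<open>\<Omega>\<close>.\<close>
    have nQ: "L2_norm (lebesgue_on Q) G \<le> (2 * N + 1) * n G"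
    proof (rule power2_le_imp_le)
      define T where "T k = (\<lambda>x. x - of_int k *\<^sub>R u) ` \<Omega>" for k :: int
      have T: "T k \<in> sets lebesgue" "bounded (T k)" "\<And>x. x \<in> T k \<longleftrightarrow> x + of_int k *\<^sub>R u \<in> \<Omega>" for k
      proof -
        have "T k = (+) (- (of_int k *\<^sub>R u)) ` \<Omega>" by (auto simp: T_def)
        then show "T k \<in> sets lebesgue" "bounded (T k)"
          using sets_\<Omega> by (auto simp only: lebesgue_sets_translation bounded_translation)
        show "\<And>x. x \<in> T k \<longleftrightarrow> x + of_int k *\<^sub>R u \<in> \<Omega>" by (force simp: T_def image_iff)
      qed
      have "(L2_norm (lebesgue_on Q) G)\<^sup>2 \<le> (\<Sum>k\<in>{-int N..int N}. (L2_norm (lebesgue_on (T k)) G)\<^sup>2)"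
      proof (rule L2_norm_UN_le[OF sets_\<Omega>(3)])
        show "Q \<subseteq> (\<Union>k\<in>{-int N..int N}. T k)"
        proof
          fix y assume y: "y \<in> Q"
          then obtain k where k: "y + of_int k *\<^sub>R u \<in> \<Omega>" using cover by blast
          then have "\<bar>k\<bar> \<le> int N" using y by (intro N[of y]) auto
          then have "k \<in> {-int N..int N}" by auto
          then show "y \<in> (\<Union>k\<in>{-int N..int N}. T k)" using k T(3) by blast
        qed
      qed (use T sets_\<Omega> in \<open>auto simp: G_def intro: lin\<close>)
      also have "\<dots> \<le> (\<Sum>k\<in>{-int N..int N}. (n G)\<^sup>2)"
      proof (intro sum_mono power_mono)
        fix k
        have "L2_norm (lebesgue_on (T k)) G = L2_norm (lebesgue_on (T k)) (\<lambda>x. G (x + of_int k *\<^sub>R u))"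
          by (simp add: G_per)
        also have "\<dots> \<le> n G" unfolding G_def using T by (intro trans) auto
        finally show "L2_norm (lebesgue_on (T k)) G \<le> n G" .
      qed simp
      also have "\<dots> = (2 * real N + 1) * (n G)\<^sup>2" by (simp add: algebra_simps)
      also have "\<dots> \<le> (2 * real N + 1)\<^sup>2 * (n G)\<^sup>2"
        by (intro mult_right_mono self_le_power) auto
      finally show "(L2_norm (lebesgue_on Q) G)\<^sup>2 \<le> (real (2 * N + 1) * n G)\<^sup>2"
        by (simp add: power_mult_distrib add.commute)
    qed (simp add: n_def)
    have "sqrt (\<Sum>i\<in>F. (cmod (c i))\<^sup>2) \<le> n1 + n2"
      unfolding n1_def n2_def F12(6) using F12
      by (subst sum.union_disjoint) (auto intro!: sqrt_add_le_add_sqrt sum_nonneg)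
    also have "n2 \<le> A2 * L2_norm (lebesgue_on Q) G" unfolding n2_def G_def by (rule A2(2)[OF F12(2,4)])
    also have "\<dots> \<le> A2 * ((2 * N + 1) * n G)" using A2(1) nQ by (intro mult_left_mono) auto
    also have "\<dots> \<le> A2 * ((2 * N + 1) * ((1 + B * C1) * n h))" using A2(1) nG by (intro mult_left_mono) auto
    also note n1
    finally show ?thesis unfolding h_def[symmetric] by (simp add: C_def algebra_simps)
  qed
  then show ?thesis unfolding riesz_sequence_def n_def by blast
qed

text \<open>Orthogonality to \<open>L2'\<close> kills the periodization \<open>P\<close> of
  \<open>f0\<close>, so the sums of \<open>f0\<close> along lines of translates vanish and the
  forward sums \<open>G\<close> give a primitive: \<open>G (x - u) - G x = f0 x\<close>. Convexity
  confines \<open>G\<close> to \<open>\<Omega>1\<close>. Orthogonality to \<open>L1\<close> passes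
  from \<open>f0\<close> to \<open>G\<close>, because the translation only costs a factor different
  from 1. Hence \<open>G\<close> vanishes, and with it \<open>f0\<close>.\<close>

private lemma complete_in_step: "complete_in (lebesgue_on \<Omega>) (L1 \<union> L2') exponential"
  unfolding complete_in_def
proof (intro ballI impI)
  fix f assume f: "f \<in> L2 (lebesgue_on \<Omega>)" and orth: "\<forall>l\<in>L1 \<union> L2'. L2_inner (lebesgue_on \<Omega>) f (exponential l) = 0"
  obtain N :: nat where N: "\<And>x k. x \<in> \<Omega> \<union> Q \<Longrightarrow> x + of_int k *\<^sub>R u \<in> \<Omega> \<union> Q \<Longrightarrow> \<bar>k\<bar> \<le> int N"
    using bounded_multiples[of "\<Omega> \<union> Q" u] sets_\<Omega> u by auto
  define f0 where "f0 = cutoff \<Omega> f"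
  have f0: "f0 \<in> L2 lebesgue" unfolding f0_def using f sets_\<Omega>(1) by (simp add: L2_cutoff)
  have f0_out: "f0 x = 0" if "x \<notin> \<Omega>" for x using that by (simp add: f0_def cutoff_def)
  have f0_trans: "(\<lambda>x. f0 (x + v)) \<in> L2 lebesgue" for v using f0 by (rule L2_lebesgue_translation)
  have cut_f0: "cutoff \<Omega> f0 = f0" by (auto simp: f0_def cutoff_def)
  have f0_inner: "L2_inner lebesgue f0 (exponential l) = 0" if "l \<in> L1 \<union> L2'" for l
    using orth that L2_inner_cutoff[OF sets_\<Omega>(1), of f "exponential l"] by (simp add: f0_def)
  define P where "P x = (\<Sum>k\<in>{-int N..int N}. f0 (x + of_int k *\<^sub>R u))" for x
  \<comment> \<open>Removing the upper face makes the translates of the tile disjoint; the removed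
    part lies in a hyperplane and is null.\<close>
  define Q' where "Q' = {x\<in>Q. x \<bullet> u < u \<bullet> u}"
  have Q': "Q' \<in> sets lebesgue"
  proof -
    have "Q' = Q \<inter> {x. u \<bullet> x < u \<bullet> u}" by (auto simp: Q'_def inner_commute)
    moreover have "{x. u \<bullet> x < u \<bullet> u} \<in> sets lebesgue" by (simp add: open_halfspace_lt borel_open)
    ultimately show ?thesis using sets_\<Omega>(3) by auto
  qed
  have meas_e: "exponential l \<in> borel_measurable lebesgue" for l :: 'a
    using exponential_measurable[of l UNIV] by (simp add: lebesgue_on_UNIV_eq)
  have P_L2: "P \<in> L2 lebesgue" unfolding P_def by (intro L2_sum f0_trans)
  have cutP: "cutoff Q P \<in> L2 lebesgue"
    using L2_lebesgue_on_mono(1)[OF sets_\<Omega>(3), of UNIV P] P_L2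
    by (simp add: lebesgue_on_UNIV_eq L2_cutoff sets_\<Omega>(3))
  have hyper: "AE x in lebesgue. x \<bullet> u \<noteq> u \<bullet> u"
  proof -
    have "negligible {x. u \<bullet> x = u \<bullet> u}" using u by (intro negligible_hyperplane) auto
    then have "{x. u \<bullet> x = u \<bullet> u} \<in> null_sets lebesgue" by (simp add: negligible_iff_null_sets)
    from AE_not_in[OF this] show ?thesis by (simp add: inner_commute)
  qed
  \<comment> \<open>Existence of the translate is \<open>tile\<close>, uniqueness follows from
    \<open>strip\<close>. This identity unfolds the integral of the periodization over
    \<open>Q\<close> into an integral over \<open>\<Omega>\<close>.\<close>
  have unique: "(\<Sum>k\<in>{-int N..int N}. indicator Q' (x - of_int k *\<^sub>R u)) = (1::complex)" if x: "x \<in> \<Omega>" for x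
  proof -
    obtain j where j: "x - of_int j *\<^sub>R u \<in> Q'" using tile[OF x] by (auto simp: Q'_def)
    have uniq: "k = j" if "x - of_int k *\<^sub>R u \<in> Q'" for k
    proof -
      have b: "0 \<le> (x - of_int i *\<^sub>R u) \<bullet> u \<and> (x - of_int i *\<^sub>R u) \<bullet> u < u \<bullet> u" if "x - of_int i *\<^sub>R u \<in> Q'" for i
        using that strip by (auto simp: Q'_def)
      have pos: "u \<bullet> u > 0" using u by simp
      have "real_of_int k * (u \<bullet> u) - of_int j * (u \<bullet> u) < u \<bullet> u" "of_int j * (u \<bullet> u) - real_of_int k * (u \<bullet> u) < u \<bullet> u"
        using b[OF j] b[OF that] unfolding inner_diff_left inner_scaleR_left by linarith+
      then have "(of_int k - of_int j) * (u \<bullet> u) < 1 * (u \<bullet> u)" "(of_int j - of_int k) * (u \<bullet> u) < 1 * (u \<bullet> u)"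
        by (simp_all only: left_diff_distrib mult_1)
      then have "real_of_int k - of_int j < 1" "real_of_int j - of_int k < 1"
        using pos by (simp_all only: mult_less_cancel_right_pos)
      then show ?thesis by linarith
    qed
    have "x - of_int j *\<^sub>R u \<in> Q" using j by (simp add: Q'_def)
    then have "\<bar>- j\<bar> \<le> int N" using x by (intro N[of x]) auto
    then have jN: "j \<in> {-int N..int N}" by auto
    have "(\<Sum>k\<in>{-int N..int N}. indicator Q' (x - of_int k *\<^sub>R u)) = (\<Sum>k\<in>{-int N..int N}. if k = j then 1 else (0::complex))"
    proof (intro sum.cong refl)
      fix k
      show "indicator Q' (x - of_int k *\<^sub>R u) = (if k = j then 1 else (0::complex))"
      proof (cases "k = j")
        case False
        then have "x - of_int k *\<^sub>R u \<notin> Q'" using uniq by blast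
        with False show ?thesis by simp
      qed (use j in simp)
    qed
    also have "\<dots> = 1" using jN by simp
    finally show ?thesis .
  qed
  have "L2_inner (lebesgue_on Q) P (exponential l) = 0" if l: "l \<in> L2'" for l
  proof -
    define \<phi> where "\<phi> x = f0 x * cnj (exponential l x)" for x
    have \<phi>: "integrable lebesgue \<phi>"
    proof -
      have "integrable lebesgue (\<lambda>x. f0 x * cnj (cutoff \<Omega> (exponential l) x))"
        using f0 exponential_L2[OF sets_\<Omega>(1,2), of l] by (intro L2_prod_integrable) (simp_all add: L2_cutoff[OF sets_\<Omega>(1)])
      also have "(\<lambda>x. f0 x * cnj (cutoff \<Omega> (exponential l) x)) = \<phi>"
        using f0_out by (auto simp: \<phi>_def cutoff_def)
      finally show ?thesis .
    qed
    have \<phi>_per: "f0 (x + of_int k *\<^sub>R u) * cnj (exponential l x) = \<phi> (x + of_int k *\<^sub>R u)" for x k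
      unfolding \<phi>_def exponential_periodic[OF L2(2)[OF l]] ..
    have ind: "integrable lebesgue (\<lambda>x. indicator Q' (x - of_int k *\<^sub>R u) * \<phi> x)" for k
    proof (rule Bochner_Integration.integrable_bound[OF \<phi>])
      have "(\<lambda>x. indicator Q' (x + - (of_int k *\<^sub>R u)) :: complex) \<in> borel_measurable lebesgue"
        by (rule measurable_compose[OF measurable_lebesgue_translation]) (use Q' in simp)
      then show "(\<lambda>x. indicator Q' (x - of_int k *\<^sub>R u) * \<phi> x) \<in> borel_measurable lebesgue"
        using \<phi> by (intro borel_measurable_times) auto
      show "AE x in lebesgue. norm (indicator Q' (x - of_int k *\<^sub>R u) * \<phi> x) \<le> norm (\<phi> x)"
        by (intro AE_I2) (auto simp: indicator_def)
    qed
    have "L2_inner (lebesgue_on Q) P (exponential l) = (\<integral>x. cutoff Q P x * cnj (exponential l x) \<partial>lebesgue)"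
      using L2_inner_cutoff[OF sets_\<Omega>(3), of P] by (simp add: L2_inner_def)
    also have "\<dots> = (\<integral>x. (\<Sum>k\<in>{-int N..int N}. indicator Q' x * \<phi> (x + of_int k *\<^sub>R u)) \<partial>lebesgue)"
    proof (rule integral_cong_AE)
      show "(\<lambda>x. cutoff Q P x * cnj (exponential l x)) \<in> borel_measurable lebesgue"
        using L2_measurable[OF cutP] meas_e[of l] by (intro borel_measurable_times borel_measurable_cnj)
      show "(\<lambda>x. \<Sum>k\<in>{-int N..int N}. indicator Q' x * \<phi> (x + of_int k *\<^sub>R u)) \<in> borel_measurable lebesgue"
        using Q' integrable_lebesgue_translation[OF \<phi>]
        by (intro borel_measurable_sum borel_measurable_times) auto
      show "AE x in lebesgue. cutoff Q P x * cnj (exponential l x) = (\<Sum>k\<in>{-int N..int N}. indicator Q' x * \<phi> (x + of_int k *\<^sub>R u))"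
        using hyper
      proof eventually_elim
        case (elim x)
        show ?case
        proof (cases "x \<in> Q")
          case True
          then have "x \<in> Q'" using elim strip[OF True] by (simp add: Q'_def)
          then show ?thesis using True by (simp add: cutoff_def P_def \<phi>_per[symmetric] sum_distrib_right)
        qed (simp add: cutoff_def Q'_def)
      qed
    qed
    also have "\<dots> = (\<Sum>k\<in>{-int N..int N}. (\<integral>x. indicator Q' x * \<phi> (x + of_int k *\<^sub>R u) \<partial>lebesgue))"
    proof (rule Bochner_Integration.integral_sum)
      fix k
      show "integrable lebesgue (\<lambda>x. indicator Q' x * \<phi> (x + of_int k *\<^sub>R u))"
        using integrable_lebesgue_translation[OF ind[of k], of "of_int k *\<^sub>R u"] by simp
    qed
    also have "\<dots> = (\<Sum>k\<in>{-int N..int N}. (\<integral>x. indicator Q' (x - of_int k *\<^sub>R u) * \<phi> x \<partial>lebesgue))"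
    proof (intro sum.cong refl)
      fix k
      show "(\<integral>x. indicator Q' x * \<phi> (x + of_int k *\<^sub>R u) \<partial>lebesgue) = (\<integral>x. indicator Q' (x - of_int k *\<^sub>R u) * \<phi> x \<partial>lebesgue)"
        using integral_lebesgue_translation[OF borel_measurable_integrable[OF ind[of k]], of "of_int k *\<^sub>R u"] by simp
    qed
    also have "\<dots> = (\<integral>x. (\<Sum>k\<in>{-int N..int N}. indicator Q' (x - of_int k *\<^sub>R u) * \<phi> x) \<partial>lebesgue)"
      using ind by (intro Bochner_Integration.integral_sum[symmetric])
    also have "\<dots> = (\<integral>x. \<phi> x \<partial>lebesgue)"
    proof (intro Bochner_Integration.integral_cong refl)
      fix x
      show "(\<Sum>k\<in>{-int N..int N}. indicator Q' (x - of_int k *\<^sub>R u) * \<phi> x) = \<phi> x"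
        using unique[of x] f0_out[of x] by (cases "x \<in> \<Omega>") (simp_all add: sum_distrib_right[symmetric] \<phi>_def)
    qed
    also have "\<dots> = 0" using f0_inner[of l] l by (simp add: L2_inner_def \<phi>_def)
    finally show ?thesis .
  qed
  then have "ae_eq (lebesgue_on Q) P (\<lambda>x. 0)"
    using L2(1) cutP L2_cutoff[OF sets_\<Omega>(3), of P] unfolding exp_riesz_def complete_in_def by blast
  then have "AE x in lebesgue. cutoff Q P x = 0"
    using ae_eq_cutoff[OF sets_\<Omega>(3)] by (simp add: ae_eq_def)
  \<comment> \<open>Discarding countably many translated null sets makes the exceptional set
    invariant under multiples of \<open>u\<close>, since \<open>P\<close> will be evaluated at
    shifted points.\<close>
  then have "AE x in lebesgue. \<forall>j::int. cutoff Q P (x + of_int j *\<^sub>R u) = 0"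
    unfolding AE_all_countable by (intro allI AE_lebesgue_translation)
  then have P0: "AE x in lebesgue. \<forall>j::int. x + of_int j *\<^sub>R u \<in> Q \<longrightarrow> P (x + of_int j *\<^sub>R u) = 0"
    by (auto simp: cutoff_def elim!: eventually_mono split: if_splits)
  define T where "T x = {k::int. x + of_int k *\<^sub>R u \<in> \<Omega>}" for x
  have finT: "finite (T x)" for x
  proof (cases "T x = {}")
    case False
    then obtain k0 where k0: "x + of_int k0 *\<^sub>R u \<in> \<Omega>" by (auto simp: T_def)
    have "T x \<subseteq> {k0 - int N..k0 + int N}"
    proof
      fix k assume "k \<in> T x"
      then have "(x + of_int k0 *\<^sub>R u) + of_int (k - k0) *\<^sub>R u \<in> \<Omega>" by (simp add: T_def algebra_simps)
      then have "\<bar>k - k0\<bar> \<le> int N" using k0 by (intro N[of "x + of_int k0 *\<^sub>R u"]) auto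
      then show "k \<in> {k0 - int N..k0 + int N}" by auto
    qed
    then show ?thesis by (rule finite_subset) simp
  qed simp
  \<comment> \<open>The sum starts at k = 1, so that shifting the argument by \<open>- u\<close>
    adds exactly the term k = 0.\<close>
  define G where "G x = (\<Sum>k\<in>{k\<in>T x. 1 \<le> k}. f0 (x + of_int k *\<^sub>R u))" for x
  have G_shift: "G (x - u) = G x + f0 x" for x
  proof -
    have "G (x - u) = (\<Sum>k\<in>{k\<in>T x. 0 \<le> k}. f0 (x + of_int k *\<^sub>R u))"
      unfolding G_def
      by (rule sum.reindex_bij_witness[of _ "\<lambda>k. k + 1" "\<lambda>k. k - 1"]) (auto simp: T_def algebra_simps)
    also have "\<dots> = (\<Sum>k\<in>{k\<in>T x. 1 \<le> k} \<union> {0}. f0 (x + of_int k *\<^sub>R u))"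
    proof (rule sum.mono_neutral_left)
      show "\<forall>i\<in>({k\<in>T x. 1 \<le> k} \<union> {0}) - {k\<in>T x. 0 \<le> k}. f0 (x + of_int i *\<^sub>R u) = 0"
      proof
        fix i assume "i \<in> ({k\<in>T x. 1 \<le> k} \<union> {0}) - {k\<in>T x. 0 \<le> k}"
        then have "i = 0" "x \<notin> \<Omega>" by (auto simp: T_def)
        then show "f0 (x + of_int i *\<^sub>R u) = 0" using f0_out by simp
      qed
    qed (use finT[of x] in auto)
    also have "\<dots> = G x + f0 x"
      unfolding G_def using finT[of x] by (subst sum.union_disjoint) auto
    finally show ?thesis .
  qed
  \<comment> \<open>If one translate of \<open>x\<close> with k \<le> 0 and another with k \<ge> 1
    lie in \<open>\<Omega>\<close>, convexity puts both \<open>x\<close> and \<open>x + u\<close>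
    there. Outside \<open>\<Omega>1\<close> the forward sum is therefore empty or complete, and a
    complete sum is a value of \<open>P\<close>.\<close>
  have G0: "G x = 0" if good: "\<forall>j::int. x + of_int j *\<^sub>R u \<in> Q \<longrightarrow> P (x + of_int j *\<^sub>R u) = 0" and x: "x \<notin> \<Omega>1" for x
  proof (cases "{k\<in>T x. 1 \<le> k} = {}")
    case True then show ?thesis unfolding G_def by (simp only: sum.empty)
  next
    case False
    then obtain k1 where k1: "x + of_int k1 *\<^sub>R u \<in> \<Omega>" "1 \<le> k1" by (auto simp: T_def)
    have "T x \<subseteq> {k. 1 \<le> k}"
    proof (rule ccontr)
      assume "\<not> ?thesis"
      then obtain k0 where "k0 \<in> T x" "\<not> 1 \<le> k0" by blast
      then have k0: "x + of_int k0 *\<^sub>R u \<in> \<Omega>" "k0 \<le> 0" by (auto simp: T_def)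
      have seg: "x + t *\<^sub>R u \<in> \<Omega>" if t: "of_int k0 \<le> t" "t \<le> of_int k1" for t :: real
      proof -
        define s where "s = (t - of_int k0) / (of_int k1 - of_int k0)"
        have d: "real_of_int k1 - of_int k0 > 0" using k0(2) k1(2) by simp
        have s: "0 \<le> s" "s \<le> 1" using t d by (auto simp: s_def field_simps)
        have "(1 - s) *\<^sub>R (x + of_int k0 *\<^sub>R u) + s *\<^sub>R (x + of_int k1 *\<^sub>R u) = x + (of_int k0 + s * (of_int k1 - of_int k0)) *\<^sub>R u"
          by (simp add: algebra_simps)
        also have "of_int k0 + s * (of_int k1 - of_int k0) = t" using d by (simp add: s_def)
        finally show ?thesis using \<Omega>(2) k0(1) k1(1) s by (metis convexD_alt)
      qed
      have "x \<in> \<Omega>" "x + u \<in> \<Omega>" using seg[of 0] seg[of 1] k0(2) k1(2) by auto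
      then show False using x by (simp add: \<Omega>1_def)
    qed
    then have "{k\<in>T x. 1 \<le> k} = T x" by auto
    then have "G x = (\<Sum>k\<in>T x. f0 (x + of_int k *\<^sub>R u))" by (simp add: G_def)
    also obtain j where j: "x + of_int k1 *\<^sub>R u - of_int j *\<^sub>R u \<in> Q" using tile[OF k1(1)] by blast
    \<comment> \<open>Moves the base point of the line into \<open>Q\<close>, where \<open>P\<close>
      is known to vanish.\<close>
    define i where "i = k1 - j"
    have i: "x + of_int i *\<^sub>R u \<in> Q" using j by (simp add: i_def algebra_simps)
    have "(\<Sum>k\<in>T x. f0 (x + of_int k *\<^sub>R u)) = (\<Sum>k\<in>T (x + of_int i *\<^sub>R u). f0 (x + of_int i *\<^sub>R u + of_int k *\<^sub>R u))"
      by (rule sum.reindex_bij_witness[of _ "\<lambda>k. k + i" "\<lambda>k. k - i"]) (auto simp: T_def algebra_simps)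
    also have "\<dots> = P (x + of_int i *\<^sub>R u)"
      unfolding P_def
    proof (rule sum.mono_neutral_left)
      show "T (x + of_int i *\<^sub>R u) \<subseteq> {- int N..int N}"
      proof
        fix k assume "k \<in> T (x + of_int i *\<^sub>R u)"
        then have "\<bar>k\<bar> \<le> int N" using i by (intro N[of "x + of_int i *\<^sub>R u"]) (auto simp: T_def)
        then show "k \<in> {- int N..int N}" by auto
      qed
    qed (auto simp: T_def f0_out)
    also have "\<dots> = 0" using good i by blast
    finally show ?thesis .
  qed
  define g where "g = cutoff \<Omega>1 G"
  \<comment> \<open>The index set of \<open>G\<close> varies with \<open>x\<close>; on
    \<open>\<Omega>1\<close> it can be enlarged to a fixed finite range, which exhibits
    \<open>g\<close> as the cutoff of a finite sum of translates in L2.\<close>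
  have g_eq: "g = cutoff \<Omega>1 (\<lambda>x. \<Sum>k\<in>{1..int N}. f0 (x + of_int k *\<^sub>R u))"
  proof
    fix x
    have "G x = (\<Sum>k\<in>{1..int N}. f0 (x + of_int k *\<^sub>R u))" if "x \<in> \<Omega>1"
      unfolding G_def
    proof (rule sum.mono_neutral_left)
      show "{k \<in> T x. 1 \<le> k} \<subseteq> {1..int N}"
      proof
        fix k assume k: "k \<in> {k \<in> T x. 1 \<le> k}"
        then have "\<bar>k\<bar> \<le> int N" using that sets_\<Omega>1(3) by (intro N[of x]) (auto simp: T_def)
        then show "k \<in> {1..int N}" using k by auto
      qed
    qed (use f0_out in \<open>auto simp: T_def\<close>)
    then show "g x = cutoff \<Omega>1 (\<lambda>x. \<Sum>k\<in>{1..int N}. f0 (x + of_int k *\<^sub>R u)) x" by (simp add: g_def cutoff_def)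
  qed
  have gL2: "g \<in> L2 lebesgue"
  proof -
    have "(\<lambda>x. \<Sum>k\<in>{1..int N}. f0 (x + of_int k *\<^sub>R u)) \<in> L2 (lebesgue_on UNIV)"
      unfolding lebesgue_on_UNIV_eq by (intro L2_sum f0_trans)
    from L2_lebesgue_on_mono(1)[OF sets_\<Omega>1(1) _ _ this]
    show ?thesis unfolding g_eq by (simp add: L2_cutoff[OF sets_\<Omega>1(1)])
  qed
  have gG: "AE x in lebesgue. g x = G x"
    using P0 by eventually_elim (use G0 in \<open>auto simp: g_def cutoff_def\<close>)
  have gf: "AE x in lebesgue. g (x + - u) - g x = f0 x"
    using gG AE_lebesgue_translation[OF gG, of "- u"] by eventually_elim (simp add: G_shift)
  have g_orth: "L2_inner (lebesgue_on \<Omega>1) G (exponential l) = 0" if l: "l \<in> L1" for l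
  proof -
    define \<psi> where "\<psi> x = g x * cnj (exponential l x)" for x
    have \<psi>: "integrable lebesgue \<psi>"
    proof -
      have "integrable lebesgue (\<lambda>x. g x * cnj (cutoff \<Omega>1 (exponential l) x))"
        using gL2 exponential_L2[OF sets_\<Omega>1(1,2), of l] by (intro L2_prod_integrable) (simp_all add: L2_cutoff[OF sets_\<Omega>1(1)])
      also have "(\<lambda>x. g x * cnj (cutoff \<Omega>1 (exponential l) x)) = \<psi>"
        by (auto simp: \<psi>_def g_def cutoff_def)
      finally show ?thesis .
    qed
    define z where "z = cnj (exponential l u)"
    have shift: "g (x + - u) * cnj (exponential l x) = z * \<psi> (x + - u)" for x
      using exponential_add_right[of l "x - u" u] by (simp add: \<psi>_def z_def)
    have "0 = (\<integral>x. f0 x * cnj (exponential l x) \<partial>lebesgue)"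
      using f0_inner[of l] l by (simp add: L2_inner_def)
    also have "\<dots> = (\<integral>x. z * \<psi> (x + - u) - \<psi> x \<partial>lebesgue)"
    proof (rule integral_cong_AE)
      show "AE x in lebesgue. f0 x * cnj (exponential l x) = z * \<psi> (x + - u) - \<psi> x"
        using gf
      proof eventually_elim
        case (elim x)
        have "f0 x * cnj (exponential l x) = (g (x + - u) - g x) * cnj (exponential l x)" by (simp only: elim)
        then show ?case using shift[of x] by (simp add: left_diff_distrib \<psi>_def)
      qed
      show "(\<lambda>x. f0 x * cnj (exponential l x)) \<in> borel_measurable lebesgue"
        using L2_measurable[OF f0] meas_e[of l] by (intro borel_measurable_times borel_measurable_cnj)
    qed (use integrable_lebesgue_translation[OF \<psi>, of "- u"] \<psi> in auto)
    also have "\<dots> = z * (\<integral>x. \<psi> (x + - u) \<partial>lebesgue) - (\<integral>x. \<psi> x \<partial>lebesgue)"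
      using integrable_lebesgue_translation[OF \<psi>, of "- u"] \<psi> by (subst Bochner_Integration.integral_diff) auto
    also have "(\<integral>x. \<psi> (x + - u) \<partial>lebesgue) = (\<integral>x. \<psi> x \<partial>lebesgue)"
      by (rule integral_lebesgue_translation) (use \<psi> in auto)
    finally have "(z - 1) * (\<integral>x. \<psi> x \<partial>lebesgue) = 0" by (simp add: left_diff_distrib)
    moreover have "z \<noteq> 1"
    proof
      assume "z = 1"
      then have "exponential l u = 1" by (simp add: z_def)
      then show False using L1(2) L1(3)[OF l] by simp
    qed
    ultimately have "(\<integral>x. \<psi> x \<partial>lebesgue) = 0" by simp
    then show ?thesis using L2_inner_cutoff[OF sets_\<Omega>1(1), of G] by (simp add: L2_inner_def \<psi>_def g_def)
  qed
  have "G \<in> L2 (lebesgue_on \<Omega>1)" using gL2 by (simp add: L2_cutoff[OF sets_\<Omega>1(1)] g_def)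
  then have "ae_eq (lebesgue_on \<Omega>1) G (\<lambda>x. 0)"
    using g_orth L1(1) unfolding exp_riesz_def complete_in_def \<Omega>1_def[symmetric] by blast
  then have g0: "AE x in lebesgue. g x = 0" using ae_eq_cutoff[OF sets_\<Omega>1(1)] by (simp add: ae_eq_def g_def)
  have "AE x in lebesgue. f0 x = 0"
    using gf g0 AE_lebesgue_translation[OF g0, of "- u"] by eventually_elim simp
  then show "ae_eq (lebesgue_on \<Omega>) f (\<lambda>x. 0)"
    using ae_eq_cutoff[OF sets_\<Omega>(1)] by (simp add: ae_eq_def f0_def)
qed

lemma exp_riesz_step: "exp_riesz \<Omega> (L1 \<union> L2')"
proof -
  have "bessel (lebesgue_on (cball 0 R)) (L1 \<union> L2') exponential" for R
    using L1(1) L2(1) by (intro bessel_Un) (auto simp: exp_riesz_def intro: exponential_L2)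
  then show ?thesis
    using riesz_sequence_step complete_in_step L1(1) L2(1) by (simp add: exp_riesz_def)
qed

end

subsection \<open>Orthogonal boxes\<close>

lemma sigma_finite_lebesgue: "sigma_finite_measure (lebesgue :: 'a::euclidean_space measure)"
proof
  define A where "A = range (\<lambda>n::nat. cball (0::'a) (real n))"
  have "x \<in> \<Union> A" for x
    using real_arch_simple[of "norm x"] by (auto simp: A_def)
  then have "\<Union> A = space lebesgue" by auto
  moreover have "emeasure lebesgue a \<noteq> \<infinity>" if "a \<in> A" for a
    using that lmeasurable_cball fmeasurableD2 unfolding A_def infinity_ennreal_def by blast
  moreover have "countable A" "A \<subseteq> sets lebesgue" by (auto simp: A_def)
  ultimately show "\<exists>A::'a set set. countable A \<and> A \<subseteq> sets lebesgue \<and> \<Union> A = space lebesgue \<and>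
      (\<forall>a\<in>A. emeasure lebesgue a \<noteq> \<infinity>)"
    by (intro exI[of _ A]) simp
qed

text \<open>The edge vectors are orthogonal but not normalised, so that the box they span is
  literally a zonotope and integrality of the inner products with them describes its dual
  lattice.\<close>

locale orthogonal_frame =
  fixes B :: "'a::euclidean_space set"
  assumes orth: "pairwise orthogonal B" and nz: "0 \<notin> B" and card: "card B = DIM('a)"
begin

lemma finite_B: "finite B" using card by (metis DIM_positive card.infinite less_irrefl)

lemma span_B: "span B = UNIV"
  using card_ge_dim_independent[of B UNIV] pairwise_orthogonal_independent[OF orth nz] card by auto

lemma B_pos: "b \<in> B \<Longrightarrow> b \<bullet> b > 0" using nz by auto

lemma B_orth: "b \<in> B \<Longrightarrow> b' \<in> B \<Longrightarrow> b \<noteq> b' \<Longrightarrow> b \<bullet> b' = 0"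
  using orth by (auto simp: pairwise_def orthogonal_def)

definition coord :: "'a \<Rightarrow> 'a \<Rightarrow> real" where "coord b x = (x \<bullet> b) / (b \<bullet> b)"

lemma coord_expansion: "x = (\<Sum>b\<in>B. coord b x *\<^sub>R b)"
proof -
  define y where "y = x - (\<Sum>b\<in>B. coord b x *\<^sub>R b)"
  have "y \<bullet> b = 0" if b: "b \<in> B" for b
  proof -
    have "(\<Sum>b'\<in>B. coord b' x *\<^sub>R b') \<bullet> b = (\<Sum>b'\<in>B. if b' = b then coord b x * (b \<bullet> b) else 0)"
      unfolding inner_sum_left using B_orth b by (intro sum.cong refl) auto
    also have "\<dots> = x \<bullet> b" using finite_B b B_pos[OF b] by (simp add: coord_def)
    finally show ?thesis by (simp add: y_def inner_diff_left)
  qed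
  then have "orthogonal y y"
    using orthogonal_to_span[of y B y] span_B by (auto simp: orthogonal_def)
  then show ?thesis by (simp add: y_def orthogonal_def)
qed

lemma frame_eqI: "(\<And>b. b \<in> B \<Longrightarrow> x \<bullet> b = y \<bullet> b) \<Longrightarrow> x = y"
  using coord_expansion[of x] coord_expansion[of y] by (simp add: coord_def)

definition box_B :: "'a set" where "box_B = {x. \<forall>b\<in>B. 0 \<le> x \<bullet> b \<and> x \<bullet> b \<le> b \<bullet> b}"

definition lattice_B :: "'a set" where "lattice_B = {l. \<forall>b\<in>B. l \<bullet> b \<in> \<int>}"

lemma compact_box_B: "compact box_B"
proof -
  have "box_B = (\<Inter>b\<in>B. {x. b \<bullet> x \<ge> 0} \<inter> {x. b \<bullet> x \<le> b \<bullet> b})"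
    by (auto simp: box_B_def inner_commute)
  then have "closed box_B" by (auto intro!: closed_INT closed_Int closed_halfspace_ge closed_halfspace_le)
  moreover have "norm x \<le> (\<Sum>b\<in>B. norm b)" if "x \<in> box_B" for x
  proof -
    have "norm x \<le> (\<Sum>b\<in>B. norm (coord b x *\<^sub>R b))"
      by (subst coord_expansion) (rule norm_sum)
    also have "\<dots> \<le> (\<Sum>b\<in>B. norm b)"
    proof (intro sum_mono)
      fix b assume b: "b \<in> B"
      then have "\<bar>coord b x\<bar> \<le> 1" using that B_pos[OF b] by (auto simp: coord_def box_B_def)
      then show "norm (coord b x *\<^sub>R b) \<le> norm b" by (simp add: mult_left_le_one_le)
    qed
    finally show ?thesis .
  qed
  then have "bounded box_B" unfolding bounded_iff by blast
  ultimately show ?thesis by (simp add: compact_eq_bounded_closed)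
qed

lemma box_B_sets: "box_B \<in> sets lebesgue" "bounded box_B"
  using compact_box_B by (auto intro: compact_imp_bounded lmeasurable_compact fmeasurableD)

lemma interior_box_B: "\<exists>U. open U \<and> U \<noteq> {} \<and> U \<subseteq> box_B"
proof (intro exI conjI)
  define U where "U = (\<Inter>b\<in>B. {x. b \<bullet> x > 0} \<inter> {x. b \<bullet> x < b \<bullet> b})"
  show "open U" unfolding U_def using finite_B
    by (intro open_INT ballI open_Int open_halfspace_gt open_halfspace_lt)
  show "U \<subseteq> box_B" by (auto simp: U_def box_B_def inner_commute less_imp_le)
  define c where "c = (\<Sum>b\<in>B. (1/2) *\<^sub>R b)"
  have bc: "b \<bullet> c = (1/2) * (b \<bullet> b)" if b: "b \<in> B" for b
  proof -
    have "b \<bullet> c = (\<Sum>b'\<in>B. if b' = b then (1/2) * (b \<bullet> b) else 0)"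
      unfolding c_def inner_sum_right using B_orth[OF b] by (intro sum.cong refl) auto
    also have "\<dots> = (1/2) * (b \<bullet> b)" using finite_B b by simp
    finally show ?thesis .
  qed
  have "0 < b \<bullet> c \<and> b \<bullet> c < b \<bullet> b" if "b \<in> B" for b
    using bc[OF that] B_pos[OF that] by linarith
  then have "c \<in> U" by (auto simp: U_def)
  then show "U \<noteq> {}" by auto
qed

lemma countable_lattice_B: "countable lattice_B"
proof -
  define g where "g \<phi> = (\<Sum>b\<in>B. (of_int (\<phi> b) / (b \<bullet> b)) *\<^sub>R b)" for \<phi> :: "'a \<Rightarrow> int"
  have "lattice_B \<subseteq> g ` (PiE B (\<lambda>_. UNIV))"
  proof
    fix l assume l: "l \<in> lattice_B"
    define \<phi> where "\<phi> = restrict (\<lambda>b. \<lfloor>l \<bullet> b\<rfloor>) B"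
    have "g \<phi> = (\<Sum>b\<in>B. coord b l *\<^sub>R b)"
      unfolding g_def using l by (intro sum.cong refl) (auto simp: \<phi>_def coord_def lattice_B_def elim!: Ints_cases)
    then have "l = g \<phi>" using coord_expansion[of l] by simp
    moreover have "\<phi> \<in> PiE B (\<lambda>_. UNIV)" by (auto simp: \<phi>_def)
    ultimately show "l \<in> g ` (PiE B (\<lambda>_. UNIV))" by blast
  qed
  moreover have "countable (g ` (PiE B (\<lambda>_. UNIV)))"
    using finite_B by (intro countable_image countable_PiE) auto
  ultimately show ?thesis by (rule countable_subset)
qed

lemma integrable_indicator_exponential:
  fixes S :: "'a set"
  assumes "S \<in> lmeasurable"
  shows "integrable lebesgue (\<lambda>x. indicator S x * exponential l x)"
proof (rule Bochner_Integration.integrable_bound)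
  show "integrable lebesgue (indicator S :: 'a \<Rightarrow> real)"
    using assms by (intro integrable_real_indicator) (auto simp: fmeasurable_def)
  show "(\<lambda>x. indicator S x * exponential l x) \<in> borel_measurable lebesgue"
    using assms exponential_measurable[of l UNIV]
    by (intro borel_measurable_times borel_measurable_indicator) (auto simp: lebesgue_on_UNIV_eq)
qed (auto simp: norm_mult indicator_def)

text \<open>A half-period argument replaces iterated integrals. Translation by \<open>v\<close>
  changes the sign of the exponential, while the translated box is the original one with a slab
  moved by \<open>b\<close>, a full number of periods. So the integral equals its negative.\<close>

lemma integral_exponential_box_B:
  assumes l: "l \<in> lattice_B" "l \<noteq> 0"
  shows "(\<integral>x. indicator box_B x * exponential l x \<partial>lebesgue) = 0"
proof -
  obtain b where b: "b \<in> B" "l \<bullet> b \<noteq> 0" using frame_eqI[of l 0] l(2) by auto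
  obtain k :: int where k: "l \<bullet> b = of_int k" using l(1) b(1) by (auto simp: lattice_B_def Ints_def)
  have k0: "k \<noteq> 0" using b(2) k by auto
  \<comment> \<open>With this factor <l,v> is plus or minus one half.\<close>
  define s where "s = 1 / (2 * \<bar>real_of_int k\<bar>)"
  have "1 \<le> \<bar>real_of_int k\<bar>" using k0 by linarith
  then have s: "0 < s" "s < 1" by (auto simp: s_def field_simps)
  define v where "v = s *\<^sub>R b"
  \<comment> \<open>Half-open at the upper face, so that \<open>S\<close> and the slab
    \<open>D\<close> moved by \<open>b\<close> partition the translated box exactly. In the original
    box the mismatch of \<open>S\<close> and \<open>D\<close> is confined to two
    hyperplanes.\<close>
  define S where "S = {x\<in>box_B. s * (b \<bullet> b) \<le> b \<bullet> x} \<inter> {x. b \<bullet> x < b \<bullet> b}"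
  define D where "D = {x\<in>box_B. b \<bullet> x \<le> s * (b \<bullet> b)}"
  have m: "box_B \<in> lmeasurable" "S \<in> lmeasurable" "D \<in> lmeasurable"
  proof -
    show 1: "box_B \<in> lmeasurable" using compact_box_B by (rule lmeasurable_compact)
    have "S = box_B \<inter> ({x. s * (b \<bullet> b) \<le> b \<bullet> x} \<inter> {x. b \<bullet> x < b \<bullet> b})" by (auto simp: S_def)
    moreover have "{x. s * (b \<bullet> b) \<le> b \<bullet> x} \<inter> {x. b \<bullet> x < b \<bullet> b} \<in> sets lebesgue"
      using closed_halfspace_ge[of "s * (b \<bullet> b)" b] open_halfspace_lt[of b "b \<bullet> b"] by (intro sets.Int) (auto simp: borel_closed borel_open)
    ultimately show "S \<in> lmeasurable" using 1 by (simp add: fmeasurable_Int_fmeasurable)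
    have "D = box_B \<inter> {x. b \<bullet> x \<le> s * (b \<bullet> b)}" by (auto simp: D_def)
    moreover have "{x. b \<bullet> x \<le> s * (b \<bullet> b)} \<in> sets lebesgue" using closed_halfspace_le[of b "s * (b \<bullet> b)"] by (simp add: borel_closed)
    ultimately show "D \<in> lmeasurable" using 1 by (simp add: fmeasurable_Int_fmeasurable)
  qed
  define I where "I X = (\<integral>x. indicator X x * exponential l x \<partial>lebesgue)" for X :: "'a set"
  note int = integrable_indicator_exponential
  have shift: "(\<integral>x. indicator X (x - w) * exponential l x \<partial>lebesgue) = exponential l w * I X"
    and shift_int: "integrable lebesgue (\<lambda>x. indicator X (x - w) * exponential l x)" if "X \<in> lmeasurable" for X w
  proof -
    have eq: "(\<lambda>x. indicator X (x - w) * exponential l x) = (\<lambda>x. exponential l w * (indicator X (x + - w) * exponential l (x + - w)))"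
    proof
      fix x
      have "exponential l x = exponential l w * exponential l (x + - w)"
        using exponential_add_right[of l w "x + - w"] by simp
      then show "indicator X (x - w) * exponential l x = exponential l w * (indicator X (x + - w) * exponential l (x + - w))"
        by (simp only: add_uminus_conv_diff mult.left_commute)
    qed
    show "(\<integral>x. indicator X (x - w) * exponential l x \<partial>lebesgue) = exponential l w * I X"
      unfolding eq I_def using integral_lebesgue_translation[OF borel_measurable_integrable[OF int[OF that, of l]], where v = "- w"] by simp
    show "integrable lebesgue (\<lambda>x. indicator X (x - w) * exponential l x)"
      unfolding eq by (intro integrable_mult_right integrable_lebesgue_translation int that)
  qed
  have ev: "exponential l v = -1"
  proof -
    have "l \<bullet> v = of_int (sgn k) / 2" using k0 by (simp add: v_def k s_def abs_if sgn_if)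
    then have "2 * pi * (l \<bullet> v) = of_int (sgn k) * pi" by simp
    then have "exponential l v = exp (complex_of_real (of_int (sgn k) * pi) * \<i>)" by (simp only: exponential_def)
    then show ?thesis using k0 exp_minus[of "complex_of_real pi * \<i>"] by (cases "k > 0") (auto simp: sgn_if exp_pi_i)
  qed
  have eb: "exponential l b = 1" using k by (simp add: exponential_eq_1_iff)
  have hyper: "AE x in lebesgue. b \<bullet> x \<noteq> c" for c
  proof -
    have "negligible {x. b \<bullet> x = c}" using b(1) nz by (intro negligible_hyperplane) auto
    then have "{x. b \<bullet> x = c} \<in> null_sets lebesgue" by (simp add: negligible_iff_null_sets)
    from AE_not_in[OF this] show ?thesis by simp
  qed
  have "I box_B = (\<integral>x. indicator S x * exponential l x + indicator D x * exponential l x \<partial>lebesgue)"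
    unfolding I_def
  proof (rule integral_cong_AE)
    show "AE x in lebesgue. indicator box_B x * exponential l x = indicator S x * exponential l x + indicator D x * exponential l x"
      using hyper[of "s * (b \<bullet> b)"] hyper[of "b \<bullet> b"]
    proof eventually_elim
      case (elim x)
      have "x \<in> box_B \<Longrightarrow> b \<bullet> x < b \<bullet> b" using elim b(1) by (fastforce simp: box_B_def inner_commute)
      then have "indicator box_B x = indicator S x + (indicator D x :: complex)"
        using elim by (auto simp: S_def D_def indicator_def)
      then show ?case by (simp add: distrib_right)
    qed
  qed (use int m in \<open>auto intro: borel_measurable_integrable\<close>)
  also have "\<dots> = I S + I D" unfolding I_def using int m by (intro Bochner_Integration.integral_add)
  finally have 1: "I box_B = I S + I D" .
  have ind: "indicator box_B (x - v) = indicator S x + (indicator D (x - b) :: complex)" for x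
  proof -
    have box_shift: "x - t *\<^sub>R b \<in> box_B \<longleftrightarrow> (\<forall>b'\<in>B - {b}. 0 \<le> x \<bullet> b' \<and> x \<bullet> b' \<le> b' \<bullet> b') \<and>
        t * (b \<bullet> b) \<le> b \<bullet> x \<and> b \<bullet> x \<le> (1 + t) * (b \<bullet> b)" for t
    proof -
      have eq: "(x - t *\<^sub>R b) \<bullet> b' = x \<bullet> b'" if "b' \<in> B - {b}" for b'
        using B_orth[OF b(1), of b'] that by (auto simp: inner_diff_left)
      have eq': "(x - t *\<^sub>R b) \<bullet> b = b \<bullet> x - t * (b \<bullet> b)" by (simp add: inner_diff_left inner_commute[of x])
      have "x - t *\<^sub>R b \<in> box_B \<longleftrightarrow> (\<forall>b'\<in>B - {b}. 0 \<le> (x - t *\<^sub>R b) \<bullet> b' \<and> (x - t *\<^sub>R b) \<bullet> b' \<le> b' \<bullet> b')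
          \<and> 0 \<le> (x - t *\<^sub>R b) \<bullet> b \<and> (x - t *\<^sub>R b) \<bullet> b \<le> b \<bullet> b"
        unfolding box_B_def mem_Collect_eq using b(1) by blast
      also have "\<dots> \<longleftrightarrow> (\<forall>b'\<in>B - {b}. 0 \<le> x \<bullet> b' \<and> x \<bullet> b' \<le> b' \<bullet> b')
          \<and> 0 \<le> b \<bullet> x - t * (b \<bullet> b) \<and> b \<bullet> x - t * (b \<bullet> b) \<le> b \<bullet> b"
        using eq by (simp only: eq' cong: ball_cong)
      finally show ?thesis by (simp add: algebra_simps)
    qed
    have pos: "0 < s * (b \<bullet> b)" "s * (b \<bullet> b) < b \<bullet> b" using s B_pos[OF b(1)] by auto
    show ?thesis
      using box_shift[of s] box_shift[of 1] box_shift[of 0] pos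
      by (auto simp: S_def D_def v_def indicator_def inner_diff_right algebra_simps)
  qed
  have "- I box_B = (\<integral>x. indicator box_B (x - v) * exponential l x \<partial>lebesgue)"
    using shift[OF m(1), of v] ev by simp
  also have "\<dots> = (\<integral>x. indicator S x * exponential l x + indicator D (x - b) * exponential l x \<partial>lebesgue)"
    by (simp add: ind distrib_right)
  also have "\<dots> = I S + I D"
    using shift[OF m(3), of b] eb int[OF m(2)] shift_int[OF m(3), of b]
    by (subst Bochner_Integration.integral_add) (auto simp: I_def)
  finally have "- I box_B = I box_B" using 1 by simp
  then show ?thesis unfolding I_def by simp
qed

text \<open>Distinct lattice frequencies differ by a nonzero lattice vector, hence are orthogonal on
  the box. The volume enters because the exponentials are not normalised there; its positivity comes
  from the interior of the box.\<close>

lemma L2_norm_lincomb_box_B: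
  assumes F: "finite F" "F \<subseteq> lattice_B"
  shows "(L2_norm (lebesgue_on box_B) (lincomb F c exponential))\<^sup>2 = measure lebesgue box_B * (\<Sum>l\<in>F. (cmod (c l))\<^sup>2)"
    and "measure lebesgue box_B > 0"
proof -
  define \<mu> where "\<mu> = measure lebesgue box_B"
  have m: "box_B \<in> lmeasurable" using compact_box_B by (rule lmeasurable_compact)
  obtain U where U: "open U" "U \<noteq> {}" "U \<subseteq> box_B" using interior_box_B by blast
  have \<mu>: "\<mu> > 0"
  proof (rule ccontr)
    assume "\<not> ?thesis"
    then have "\<mu> = 0" by (simp add: \<mu>_def order_antisym not_less)
    then have "negligible box_B" using m by (simp add: \<mu>_def negligible_iff_measure0)
    then show False using U open_not_negligible negligible_subset by blast
  qed
  then show "measure lebesgue box_B > 0" by (simp add: \<mu>_def)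
  have inner: "L2_inner (lebesgue_on box_B) (exponential l) (exponential k) = (if l = k then complex_of_real \<mu> else 0)"
    if "l \<in> lattice_B" "k \<in> lattice_B" for l k
  proof -
    have "cutoff box_B (exponential l) x * cnj (exponential k x) = indicator box_B x * exponential (l - k) x" for x
    proof -
      have "exponential l x * cnj (exponential k x) = exponential (l - k) x * (exponential k x * cnj (exponential k x))"
        using exponential_add_left[of "l - k" k x] by simp
      also have "exponential k x * cnj (exponential k x) = 1"
        unfolding complex_norm_square[symmetric] by simp
      finally show ?thesis by (simp add: cutoff_def)
    qed
    then have eq: "L2_inner (lebesgue_on box_B) (exponential l) (exponential k) = (\<integral>x. indicator box_B x * exponential (l - k) x \<partial>lebesgue)"
      unfolding L2_inner_cutoff[OF box_B_sets(1)] by (simp add: L2_inner_def)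
    show ?thesis
    proof (cases "l = k")
      case True
      have "(\<integral>x. indicator box_B x \<partial>lebesgue) = complex_of_real \<mu>"
      proof -
        have "has_bochner_integral lebesgue (\<lambda>x. indicator box_B x *\<^sub>R (1::complex)) (\<mu> *\<^sub>R 1)"
          unfolding \<mu>_def by (rule has_bochner_integral_indicator) (use m in \<open>auto simp: fmeasurable_def\<close>)
        moreover have "(\<lambda>x. indicator box_B x *\<^sub>R (1::complex)) = indicator box_B"
          by (auto simp: indicator_def)
        ultimately show ?thesis
          by (simp add: has_bochner_integral_integral_eq scaleR_conv_of_real)
      qed
      then show ?thesis using eq True by simp
    next
      case False
      have "l - k \<in> lattice_B" using that by (auto simp: lattice_B_def inner_diff_left)
      then show ?thesis using eq False integral_exponential_box_B[of "l - k"] by simp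
    qed
  qed
  define w where "w l = (\<lambda>x. complex_of_real (inverse (sqrt \<mu>)) * exponential l x)" for l :: 'a
  have "lincomb F c exponential = lincomb F (\<lambda>l. complex_of_real (sqrt \<mu>) * c l) w"
    using \<mu> unfolding lincomb_def w_def by (intro ext sum.cong refl) simp
  moreover have "(L2_norm (lebesgue_on box_B) (lincomb F (\<lambda>l. complex_of_real (sqrt \<mu>) * c l) w))\<^sup>2
      = (\<Sum>l\<in>F. (cmod (complex_of_real (sqrt \<mu>) * c l))\<^sup>2)"
  proof (rule L2_norm_lincomb_orthonormal[OF F(1)])
    show "w l \<in> L2 (lebesgue_on box_B)" for l
      unfolding w_def using box_B_sets by (intro L2_cmult exponential_L2)
    show "L2_inner (lebesgue_on box_B) (w i) (w j) = (if i = j then 1 else 0)" if "i \<in> F" "j \<in> F" for i j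
    proof -
      have "L2_inner (lebesgue_on box_B) (w i) (w j) = complex_of_real (inverse (sqrt \<mu>) * inverse (sqrt \<mu>)) * (if i = j then complex_of_real \<mu> else 0)"
        unfolding w_def L2_inner_cmult_left L2_inner_cmult_right using that F(2) by (subst inner) auto
      also have "inverse (sqrt \<mu>) * inverse (sqrt \<mu>) = inverse \<mu>" using \<mu> by (simp add: inverse_mult_distrib[symmetric])
      finally show ?thesis using \<mu> by auto
    qed
  qed
  ultimately show "(L2_norm (lebesgue_on box_B) (lincomb F c exponential))\<^sup>2 = measure lebesgue box_B * (\<Sum>l\<in>F. (cmod (c l))\<^sup>2)"
    using \<mu> by (simp add: norm_mult power_mult_distrib sum_distrib_left[symmetric] \<mu>_def)
qed

lemma riesz_sequence_box_B: "riesz_sequence (lebesgue_on box_B) lattice_B exponential"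
proof -
  define \<mu> where "\<mu> = measure lebesgue box_B"
  have \<mu>: "\<mu> > 0" using L2_norm_lincomb_box_B(2)[of "{}"] by (simp add: \<mu>_def)
  have "sqrt (\<Sum>i\<in>F. (cmod (c i))\<^sup>2) \<le> inverse (sqrt \<mu>) * L2_norm (lebesgue_on box_B) (lincomb F c exponential)"
    if F: "finite F" "F \<subseteq> lattice_B" for F c
  proof -
    have "L2_norm (lebesgue_on box_B) (lincomb F c exponential) = sqrt (\<mu> * (\<Sum>l\<in>F. (cmod (c l))\<^sup>2))"
      using L2_norm_lincomb_box_B(1)[OF F, of c] unfolding \<mu>_def by (intro real_sqrt_unique[symmetric]) auto
    then show ?thesis using \<mu> by (simp add: real_sqrt_mult mult.assoc[symmetric])
  qed
  then show ?thesis unfolding riesz_sequence_def by blast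
qed

text \<open>Translating the domain multiplies the coefficients by numbers of modulus 1, so the norm
  is the same on all translates of the box, and by compactness finitely many of them cover the
  ball.\<close>

lemma bessel_box_B: "bessel (lebesgue_on (cball 0 R)) lattice_B exponential"
proof -
  define S where "S = cball (0::'a) R"
  have S: "S \<in> sets lebesgue" "bounded S" by (auto simp: S_def)
  obtain U where U: "open U" "U \<noteq> {}" "U \<subseteq> box_B" using interior_box_B by blast
  obtain p where p: "p \<in> U" using U by blast
  have "compact S" by (simp add: S_def)
  moreover have "\<And>y. y \<in> S \<Longrightarrow> open ((+) (y - p) ` U)" using U(1) by (intro open_translation)
  moreover have "S \<subseteq> (\<Union>y\<in>S. (+) (y - p) ` U)" using p by force
  ultimately obtain V where V: "V \<subseteq> S" "finite V" "S \<subseteq> (\<Union>y\<in>V. (+) (y - p) ` U)"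
    by (rule compactE_image)
  define \<mu> where "\<mu> = measure lebesgue box_B"
  have "L2_norm (lebesgue_on S) (lincomb F c exponential) \<le> sqrt (card V * \<mu>) * sqrt (\<Sum>i\<in>F. (cmod (c i))\<^sup>2)"
    if F: "finite F" "F \<subseteq> lattice_B" for F c
  proof (rule power2_le_imp_le)
    have \<mu>: "\<mu> > 0" using L2_norm_lincomb_box_B(2)[of "{}"] by (simp add: \<mu>_def)
    define T where "T y = (+) (y - p) ` box_B" for y
    have T: "T y \<in> sets lebesgue" "bounded (T y)" for y
      unfolding T_def by (rule lebesgue_sets_translation[OF box_B_sets(1)], rule bounded_translation[OF box_B_sets(2)])
    have lin: "lincomb F c exponential \<in> L2 (lebesgue_on X)" if "X \<in> sets lebesgue" "bounded X" for X c
      using that by (intro lincomb_L2 exponential_L2)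
    have norm_T: "(L2_norm (lebesgue_on (T y)) (lincomb F c exponential))\<^sup>2 = \<mu> * (\<Sum>i\<in>F. (cmod (c i))\<^sup>2)" for y
    proof -
      have "L2_norm (lebesgue_on (T y)) (lincomb F c exponential) = L2_norm (lebesgue_on box_B) (\<lambda>x. lincomb F c exponential (x + (y - p)))"
        by (rule L2_norm_lebesgue_on_translation[symmetric, OF box_B_sets(1) T(1) _ lin[OF T]]) (force simp: T_def)
      also have "(\<lambda>x. lincomb F c exponential (x + (y - p))) = lincomb F (\<lambda>l. c l * exponential l (y - p)) exponential"
        unfolding lincomb_def by (intro ext sum.cong refl) (simp add: exponential_add_right[of _ _ "y - p"] mult.commute mult.left_commute)
      finally show ?thesis
        using L2_norm_lincomb_box_B(1)[OF F, of "\<lambda>l. c l * exponential l (y - p)"] by (simp add: \<mu>_def norm_mult)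
    qed
    have "(L2_norm (lebesgue_on S) (lincomb F c exponential))\<^sup>2 \<le> (\<Sum>y\<in>V. (L2_norm (lebesgue_on (T y)) (lincomb F c exponential))\<^sup>2)"
    proof (rule L2_norm_UN_le[OF S(1) V(2) T(1)])
      show "S \<subseteq> (\<Union>y\<in>V. T y)" using V(3) U(3) unfolding T_def by blast
    qed (use T S lin in auto)
    also have "\<dots> = (sqrt (card V * \<mu>) * sqrt (\<Sum>i\<in>F. (cmod (c i))\<^sup>2))\<^sup>2"
      using \<mu> by (simp add: norm_T power_mult_distrib sum_nonneg)
    finally show "(L2_norm (lebesgue_on S) (lincomb F c exponential))\<^sup>2 \<le> (sqrt (card V * \<mu>) * sqrt (\<Sum>i\<in>F. (cmod (c i))\<^sup>2))\<^sup>2" .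
    show "0 \<le> sqrt (card V * \<mu>) * sqrt (\<Sum>i\<in>F. (cmod (c i))\<^sup>2)" using \<mu> by (simp add: sum_nonneg)
  qed
  then show ?thesis unfolding bessel_def S_def by blast
qed

section \<open>Trigonometric polynomials and completeness on a box\<close>

definition trig :: "('a \<Rightarrow> complex) \<Rightarrow> bool" where
  "trig h \<longleftrightarrow> (\<exists>F c. finite F \<and> F \<subseteq> lattice_B \<and> h = lincomb F c exponential)"

lemma trig_lincomb: "finite F \<Longrightarrow> (\<And>i. i \<in> F \<Longrightarrow> trig (u i)) \<Longrightarrow> trig (lincomb F c u)"
  unfolding trig_def using lincomb_lincomb[of F lattice_B u exponential c] by metis

lemma trig_exponential: "l \<in> lattice_B \<Longrightarrow> trig (exponential l)"
  unfolding trig_def by (intro exI[of _ "{l}"] exI[of _ "\<lambda>_. 1"]) (simp add: lincomb_def)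

lemma trig_cmult: "trig h \<Longrightarrow> trig (\<lambda>x. c * h x)"
  using trig_lincomb[of "{()}" "\<lambda>_. h" "\<lambda>_. c"] by (simp add: lincomb_def)

lemma trig_add: "trig g \<Longrightarrow> trig h \<Longrightarrow> trig (\<lambda>x. g x + h x)"
  using trig_lincomb[of "{True, False}" "\<lambda>i. if i then g else h" "\<lambda>_. 1"] by (simp add: lincomb_def)

lemma trig_const: "trig (\<lambda>x. c)"
  using trig_cmult[OF trig_exponential[of 0], of c] by (simp add: lattice_B_def)

lemma trig_mult: assumes "trig g" "trig h" shows "trig (\<lambda>x. g x * h x)"
proof -
  obtain F c where F: "finite F" "F \<subseteq> lattice_B" "g = lincomb F c exponential" using assms(1) by (auto simp: trig_def)
  obtain G d where G: "finite G" "G \<subseteq> lattice_B" "h = lincomb G d exponential" using assms(2) by (auto simp: trig_def)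
  have 1: "trig (\<lambda>x. exponential l x * h x)" if l: "l \<in> F" for l
  proof -
    have "trig (lincomb G d (\<lambda>k. exponential (l + k)))"
    proof (rule trig_lincomb[OF G(1)], rule trig_exponential)
      show "l + k \<in> lattice_B" if "k \<in> G" for k
        using l that F(2) G(2) by (auto simp: lattice_B_def inner_add_left subset_eq intro!: Ints_add)
    qed
    also have "lincomb G d (\<lambda>k. exponential (l + k)) = (\<lambda>x. exponential l x * h x)"
      unfolding G(3) lincomb_def sum_distrib_left
      by (intro ext sum.cong refl) (simp add: exponential_add_left)
    finally show ?thesis .
  qed
  have "trig (lincomb F c (\<lambda>l x. exponential l x * h x))" by (rule trig_lincomb[OF F(1) 1])
  also have "lincomb F c (\<lambda>l x. exponential l x * h x) = (\<lambda>x. g x * h x)"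
    unfolding F(3) lincomb_def sum_distrib_right by (simp add: mult.assoc)
  finally show ?thesis .
qed

lemma trig_prod: "finite I \<Longrightarrow> (\<And>i. i \<in> I \<Longrightarrow> trig (h i)) \<Longrightarrow> trig (\<lambda>x. \<Prod>i\<in>I. h i x)"
  by (induction I rule: finite_induct) (auto intro: trig_const trig_mult)

text \<open>A real-linear functional on the complex plane is a complex combination of z and its
  conjugate, whence the second assumption; sums and products stay in the algebra.\<close>

lemma trig_real_polynomial:
  assumes z: "trig z" "trig (\<lambda>x. cnj (z x))" and p: "real_polynomial_function p"
  shows "trig (\<lambda>x. complex_of_real (p (z x)))"
  using p
proof (induction p rule: real_polynomial_function.induct)
  case (linear f)
  interpret bounded_linear f by fact
  have "complex_of_real (f (z x)) = (complex_of_real (f 1) / 2 + complex_of_real (f \<i>) / (2 * \<i>)) * z x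
      + (complex_of_real (f 1) / 2 - complex_of_real (f \<i>) / (2 * \<i>)) * cnj (z x)" for x
  proof -
    have "f (z x) = f (Re (z x) *\<^sub>R 1 + Im (z x) *\<^sub>R \<i>)"
      by (rule arg_cong[of _ _ f]) (simp add: complex_eq_iff)
    then have "f (z x) = Re (z x) * f 1 + Im (z x) * f \<i>" by (simp only: add scale real_scaleR_def)
    then show ?thesis by (simp add: complex_eq_iff field_simps)
  qed
  then show ?case using z by (simp add: trig_add trig_cmult)
qed (auto intro: trig_const trig_add trig_mult)

text \<open>The indicator of an open arc of the unit circle is a bounded pointwise limit of polynomials
  (distance function to the complementary arc, then Stone--Weierstrass).\<close>

lemma trig_approx_indicator:
  assumes b: "b \<in> B"
  shows "\<exists>T. (\<forall>n. trig (T n)) \<and> (\<forall>n x. cmod (T n x) \<le> 2) \<and>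
    (\<forall>x\<in>box_B. (\<lambda>n. T n x) \<longlonglongrightarrow> (if a < coord b x \<and> coord b x < c \<and> 0 < coord b x \<and> coord b x < 1 then 1 else 0))"
proof -
  define w where "w t = exp (complex_of_real (2 * pi * t) * \<i>)" for t
  \<comment> \<open>The complementary arc always contains \<open>w 0 = w 1\<close>, the point where
    the ends of the unit interval are glued, so the limit is 0 at both ends.\<close>
  define C where "C = w ` ({0..1} \<inter> ({..a} \<union> {c..} \<union> {0}))"
  have "compact C"
    unfolding C_def w_def
    by (intro compact_continuous_image continuous_intros compact_Int_closed closed_Un) auto
  then have C: "closed C" "C \<noteq> {}" by (auto simp: compact_imp_closed C_def)
  \<comment> \<open>Zero on \<open>C\<close> for all n, and eventually 1 at each point outside this
    closed set.\<close>
  define \<psi> where "\<psi> n z = min 1 (real n * infdist z C)" for n z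
  have "\<exists>p. real_polynomial_function p \<and> (\<forall>z\<in>sphere 0 1. \<bar>\<psi> n z - p z\<bar> < 1 / real (Suc n))" for n
  proof -
    have "continuous_on (sphere 0 1) (\<psi> n)" unfolding \<psi>_def by (intro continuous_intros)
    then show ?thesis by (metis Stone_Weierstrass_real_polynomial_function compact_sphere of_nat_0_less_iff zero_less_Suc zero_less_divide_1_iff)
  qed
  then obtain p where p: "\<And>n. real_polynomial_function (p n)"
      "\<And>n z. z \<in> sphere 0 1 \<Longrightarrow> \<bar>\<psi> n z - p n z\<bar> < 1 / real (Suc n)" by metis
  \<comment> \<open>The frequency dual to \<open>b\<close>: inner product 1 with \<open>b\<close>
    and 0 with the other frame vectors, so \<open>z\<close> winds the coordinate along
    \<open>b\<close> once around the circle.\<close>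
  define z where "z = exponential (b /\<^sub>R (b \<bullet> b))"
  have z_w: "z x = w (coord b x)" for x
    by (simp add: z_def exponential_def w_def coord_def inner_commute divide_inverse mult.commute)
  have z_sphere: "z x \<in> sphere 0 1" for x by (simp add: z_def)
  have "trig z" "trig (\<lambda>x. cnj (z x))"
  proof -
    have l: "(b /\<^sub>R (b \<bullet> b)) \<in> lattice_B" "- (b /\<^sub>R (b \<bullet> b)) \<in> lattice_B"
    proof -
      have "(b /\<^sub>R (b \<bullet> b)) \<bullet> b' = (if b' = b then 1 else 0)" if "b' \<in> B" for b'
        using B_orth[OF b that] B_pos[OF b] by auto
      then show "(b /\<^sub>R (b \<bullet> b)) \<in> lattice_B" "- (b /\<^sub>R (b \<bullet> b)) \<in> lattice_B"
        unfolding lattice_B_def by (auto simp del: inner_scaleR_left)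
    qed
    show "trig z" unfolding z_def by (rule trig_exponential[OF l(1)])
    have "cnj (z x) = exponential (- (b /\<^sub>R (b \<bullet> b))) x" for x
      by (simp add: z_def exponential_def exp_cnj)
    then show "trig (\<lambda>x. cnj (z x))" using trig_exponential[OF l(2)] by simp
  qed
  then have trig: "trig (\<lambda>x. complex_of_real (p n (z x)))" for n by (rule trig_real_polynomial[OF _ _ p(1)])
  have \<psi>01: "0 \<le> \<psi> n y" "\<psi> n y \<le> 1" for n y by (auto simp: \<psi>_def infdist_nonneg)
  have bound: "cmod (complex_of_real (p n (z x))) \<le> 2" for n x
  proof -
    have "1 / real (Suc n) \<le> 1" by simp
    then show ?thesis using p(2)[OF z_sphere, of n x] \<psi>01[of n "z x"] unfolding norm_of_real by linarith
  qed
  have lim: "(\<lambda>n. complex_of_real (p n (z x))) \<longlonglongrightarrow> (if a < coord b x \<and> coord b x < c \<and> 0 < coord b x \<and> coord b x < 1 then 1 else 0)"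
    if x: "x \<in> box_B" for x
  proof -
    define t where "t = coord b x"
    have t: "0 \<le> t" "t \<le> 1" using x b B_pos[OF b] by (auto simp: t_def coord_def box_B_def)
    define v where "v = (if a < t \<and> t < c \<and> 0 < t \<and> t < 1 then 1 else 0 :: real)"
    have \<psi>v: "eventually (\<lambda>n. \<psi> n (z x) = v) sequentially"
    proof (cases "a < t \<and> t < c \<and> 0 < t \<and> t < 1")
      case True
      have "z x \<notin> C"
      proof
        assume "z x \<in> C"
        then obtain t' where t': "w t = w t'" "t' \<in> {0..1} \<inter> ({..a} \<union> {c..} \<union> {0})"
          unfolding C_def z_w t_def[symmetric] by (rule imageE)
        have "w (t - t') = w t / w t'" by (simp add: w_def exp_diff[symmetric] algebra_simps)
        also have "\<dots> = 1" using t'(1) by (simp add: w_def)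
        finally obtain n :: int where "2 * pi * (t - t') = of_int (2 * n) * pi"
          unfolding w_def by (auto simp: exp_eq_1)
        then have "t - t' = of_int n" by simp
        moreover have "\<bar>t - t'\<bar> < 1" using t'(2) True by auto
        ultimately have "n = 0" by linarith
        then show False using \<open>t - t' = of_int n\<close> t'(2) True by auto
      qed
      then have d: "infdist (z x) C > 0" using C infdist_pos_not_in_closed by blast
      obtain N where N: "1 / infdist (z x) C < real N" using reals_Archimedean2 by blast
      have "\<psi> n (z x) = v" if "n \<ge> N" for n
      proof -
        have "1 / infdist (z x) C < real n" using N that by (meson less_le_trans of_nat_mono)
        then have "1 < real n * infdist (z x) C" using d by (simp add: field_simps)
        then show ?thesis using True by (simp add: \<psi>_def v_def)
      qed
      then show ?thesis by (auto simp: eventually_sequentially)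
    next
      case False
      have "z x \<in> C"
      proof (cases "t = 1")
        case True
        then have "z x = w 0" by (simp add: z_w t_def[symmetric] w_def exp_eq_1)
        then show ?thesis by (auto simp: C_def)
      next
        case f: False
        then have "t \<in> {0..1} \<inter> ({..a} \<union> {c..} \<union> {0})" using t False by auto
        then show ?thesis unfolding C_def z_w t_def[symmetric] by (rule imageI)
      qed
      then show ?thesis using False by (simp add: \<psi>_def v_def)
    qed
    have "(\<lambda>n. p n (z x)) \<longlonglongrightarrow> v"
    proof (rule Lim_transform_eventually)
      have "(\<lambda>n. p n (z x) - \<psi> n (z x)) \<longlonglongrightarrow> 0"
      proof (rule Lim_null_comparison)
        show "\<forall>\<^sub>F n in sequentially. norm (p n (z x) - \<psi> n (z x)) \<le> 1 / real (Suc n)"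
          using p(2)[OF z_sphere] by (intro always_eventually allI) (simp add: abs_minus_commute less_imp_le)
      qed (use LIMSEQ_inverse_real_of_nat in \<open>simp add: inverse_eq_divide\<close>)
      then show "(\<lambda>n. (p n (z x) - \<psi> n (z x)) + v) \<longlonglongrightarrow> v" using tendsto_add[OF _ tendsto_const[of v]] by fastforce
      show "\<forall>\<^sub>F n in sequentially. (p n (z x) - \<psi> n (z x)) + v = p n (z x)" using \<psi>v by eventually_elim simp
    qed
    then have "(\<lambda>n. complex_of_real (p n (z x))) \<longlonglongrightarrow> complex_of_real v" by (rule tendsto_of_real)
    then show ?thesis by (simp add: v_def t_def if_distrib cong: if_cong)
  qed
  show ?thesis
    by (intro exI[of _ "\<lambda>n x. complex_of_real (p n (z x))"] conjI allI ballI trig bound lim)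
qed

definition cell :: "('a \<Rightarrow> real) \<Rightarrow> ('a \<Rightarrow> real) \<Rightarrow> 'a set" where
  "cell a c = {x. \<forall>b\<in>B. a b < coord b x \<and> coord b x < c b}"

text \<open>All frame coordinates are measurable for the generated sigma-algebra, hence by the frame
  expansion so is the identity map; conversely cells are open. Cells adapted to the frame are the
  sets whose indicators arise as products of arc indicators.\<close>

lemma sets_borel_cells: "sets (sigma UNIV (range (\<lambda>(a, c). cell a c))) = sets borel"
proof
  define N where "N = sigma UNIV (range (\<lambda>(a, c). cell a c))"
  have cell_N: "cell a c \<in> sets N" for a c unfolding N_def by (auto intro!: sigma_sets.Basic)
  have "coord b \<in> borel_measurable N" if b: "b \<in> B" for b
    unfolding borel_measurable_iff_less
  proof
    fix r
    \<comment> \<open>A half-space is not a cell but is exhausted by cells whose remaining bounds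
      grow with n.\<close>
    have "{x \<in> space N. coord b x < r} = (\<Union>n::nat. cell (\<lambda>_. - real n) (\<lambda>b'. if b' = b then min r n else real n))"
    proof (intro equalityI subsetI)
      fix x assume x: "x \<in> {x \<in> space N. coord b x < r}"
      define n where "n = nat \<lceil>\<Sum>b\<in>B. \<bar>coord b x\<bar>\<rceil> + 1"
      have "\<bar>coord b' x\<bar> < real n" if "b' \<in> B" for b'
      proof -
        have "\<bar>coord b' x\<bar> \<le> (\<Sum>b\<in>B. \<bar>coord b x\<bar>)" using that finite_B by (intro member_le_sum) auto
        then show ?thesis unfolding n_def by linarith
      qed
      then have "x \<in> cell (\<lambda>_. - real n) (\<lambda>b'. if b' = b then min r n else real n)"
        using x by (fastforce simp: cell_def abs_less_iff)
      then show "x \<in> (\<Union>n::nat. cell (\<lambda>_. - real n) (\<lambda>b'. if b' = b then min r n else real n))" by blast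
    qed (use b in \<open>auto simp: cell_def N_def\<close>)
    also have "\<dots> \<in> sets N" using cell_N by blast
    finally show "{x \<in> space N. coord b x < r} \<in> sets N" .
  qed
  then have "(\<lambda>x. \<Sum>b\<in>B. coord b x *\<^sub>R b) \<in> borel_measurable N"
    by (intro borel_measurable_sum borel_measurable_scaleR) auto
  then have id: "(\<lambda>x. x) \<in> borel_measurable N" using coord_expansion by simp
  show "sets borel \<subseteq> sets (sigma UNIV (range (\<lambda>(a, c). cell a c)))"
  proof
    fix S :: "'a set" assume "S \<in> sets borel"
    from measurable_sets[OF id this] show "S \<in> sets (sigma UNIV (range (\<lambda>(a, c). cell a c)))"
      by (simp add: N_def)
  qed
  have "cell a c \<in> sets borel" for a c
  proof -
    have "cell a c = (\<Inter>b\<in>B. {x. a b < coord b x} \<inter> {x. coord b x < c b})" by (auto simp: cell_def)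
    also have "open \<dots>" unfolding coord_def using finite_B nz
      by (intro open_INT ballI open_Int open_Collect_less continuous_intros) auto
    finally show ?thesis by (rule borel_open)
  qed
  then have "range (\<lambda>(a, c). cell a c) \<subseteq> sets borel" by auto
  from sets.sigma_sets_subset[OF this]
  show "sets (sigma UNIV (range (\<lambda>(a, c). cell a c))) \<subseteq> sets borel" by simp
qed

text \<open>Orthogonality to trigonometric polynomials passes by dominated convergence to indicators
  of cells, from this intersection-stable generator to all Borel sets, and from there to Lebesgue
  sets up to null sets. A function whose integrals over all measurable sets vanish is zero almost
  everywhere.\<close>

lemma complete_in_box_B: "complete_in (lebesgue_on box_B) lattice_B exponential"
  unfolding complete_in_def
proof (intro ballI impI)
  fix f assume f: "f \<in> L2 (lebesgue_on box_B)"
    and orth: "\<forall>l\<in>lattice_B. L2_inner (lebesgue_on box_B) f (exponential l) = 0"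
  define f0 where "f0 = cutoff box_B f"
  have f0: "f0 \<in> L2 lebesgue" unfolding f0_def using f box_B_sets(1) by (simp add: L2_cutoff)
  have f0_int: "integrable lebesgue f0"
  proof -
    have "integrable lebesgue (\<lambda>x. f0 x * cnj (cutoff box_B (exponential 0) x))"
      using f0 exponential_L2[OF box_B_sets, of 0] by (intro L2_prod_integrable) (simp_all add: L2_cutoff[OF box_B_sets(1)])
    also have "(\<lambda>x. f0 x * cnj (cutoff box_B (exponential 0) x)) = f0"
      by (auto simp: f0_def cutoff_def)
    finally show ?thesis .
  qed
  have trig_orth: "(\<integral>x. f0 x * cnj (h x) \<partial>lebesgue) = 0" if "trig h" for h
  proof -
    obtain F c where F: "finite F" "F \<subseteq> lattice_B" "h = lincomb F c exponential"
      using \<open>trig h\<close> by (auto simp: trig_def)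
    have "L2_inner (lebesgue_on box_B) f h = (\<Sum>l\<in>F. cnj (c l) * L2_inner (lebesgue_on box_B) f (exponential l))"
      unfolding F(3) using box_B_sets f by (intro L2_inner_lincomb_right exponential_L2)
    also have "\<dots> = 0" using orth F(2) by (intro sum.neutral) auto
    finally show ?thesis using L2_inner_cutoff[OF box_B_sets(1), of f h] by (simp add: L2_inner_def f0_def)
  qed
  have AE_inner: "AE x in lebesgue. \<forall>b\<in>B. coord b x \<noteq> 0 \<and> coord b x \<noteq> 1"
  proof -
    have hyper: "AE x in lebesgue. b \<bullet> x \<noteq> c" if "b \<in> B" for b c
    proof -
      have "negligible {x. b \<bullet> x = c}" using that nz by (intro negligible_hyperplane) auto
      then have "{x. b \<bullet> x = c} \<in> null_sets lebesgue" by (simp add: negligible_iff_null_sets)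
      from AE_not_in[OF this] show ?thesis by simp
    qed
    have "AE x in lebesgue. coord b x \<noteq> 0 \<and> coord b x \<noteq> 1" if b: "b \<in> B" for b
      using hyper[OF b, of 0] hyper[OF b, of "b \<bullet> b"]
      by eventually_elim (use B_pos[OF b] in \<open>auto simp: coord_def inner_commute\<close>)
    then show ?thesis using finite_B by (intro AE_finite_allI)
  qed
  have cell: "(LINT x:cell a c|lebesgue. f0 x) = 0" for a c
  proof -
    \<comment> \<open>The arc construction delivers indicators cut down to the open unit interval.
      On the box this differs from the cell condition only where some coordinate is 0 or 1, which is
      a null set.\<close>
    define ch where "ch b x = (if a b < coord b x \<and> coord b x < c b \<and> 0 < coord b x \<and> coord b x < 1 then 1 else 0 :: complex)" for b x
    have "\<exists>T. (\<forall>n. trig (T n)) \<and> (\<forall>n x. cmod (T n x) \<le> 2) \<and> (\<forall>x\<in>box_B. (\<lambda>n. T n x) \<longlonglongrightarrow> ch b x)"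
      if "b \<in> B" for b
      unfolding ch_def by (rule trig_approx_indicator[OF that])
    then obtain T where T: "\<And>b n. b \<in> B \<Longrightarrow> trig (T b n)" "\<And>b n x. b \<in> B \<Longrightarrow> cmod (T b n x) \<le> 2"
        "\<And>b x. b \<in> B \<Longrightarrow> x \<in> box_B \<Longrightarrow> (\<lambda>n. T b n x) \<longlonglongrightarrow> ch b x"
      by metis
    have meas: "(\<lambda>x. \<Prod>b\<in>B. T b n x) \<in> borel_measurable lebesgue" for n
    proof -
      have "trig (\<lambda>x. \<Prod>b\<in>B. T b n x)" by (rule trig_prod[OF finite_B T(1)])
      then obtain F d where "(\<lambda>x. \<Prod>b\<in>B. T b n x) = lincomb F d exponential" unfolding trig_def by blast
      then have "(\<lambda>x. \<Prod>b\<in>B. T b n x) \<in> borel_measurable lborel"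
        using borel_measurable_continuous_onI[OF continuous_lincomb_exponential[of UNIV F d "\<lambda>l. l"]] by simp
      then show ?thesis by (rule measurable_completion)
    qed
    have "(\<lambda>n. \<integral>x. f0 x * cnj (\<Prod>b\<in>B. T b n x) \<partial>lebesgue) \<longlonglongrightarrow> (\<integral>x. f0 x * cnj (\<Prod>b\<in>B. ch b x) \<partial>lebesgue)"
    proof (rule integral_dominated_convergence)
      \<comment> \<open>One factor 2 for each frame vector, from the uniform bound on the
        approximating polynomials.\<close>
      show "integrable lebesgue (\<lambda>x. 2 ^ card B * norm (f0 x))" using f0_int by simp
      show "(\<lambda>x. f0 x * cnj (\<Prod>b\<in>B. T b n x)) \<in> borel_measurable lebesgue" for n
        using f0_int meas[of n] by (intro borel_measurable_times borel_measurable_cnj) auto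
      have lim: "(\<lambda>n. f0 x * cnj (\<Prod>b\<in>B. T b n x)) \<longlonglongrightarrow> f0 x * cnj (\<Prod>b\<in>B. ch b x)" for x
      proof (cases "x \<in> box_B")
        case True
        then show ?thesis using T(3) by (intro tendsto_intros) auto
      qed (simp add: f0_def cutoff_def)
      then show "AE x in lebesgue. (\<lambda>n. f0 x * cnj (\<Prod>b\<in>B. T b n x)) \<longlonglongrightarrow> f0 x * cnj (\<Prod>b\<in>B. ch b x)"
        by simp
      show "(\<lambda>x. f0 x * cnj (\<Prod>b\<in>B. ch b x)) \<in> borel_measurable lebesgue"
        by (rule borel_measurable_LIMSEQ_metric[OF _ lim])
           (use f0_int meas in \<open>intro borel_measurable_times borel_measurable_cnj, auto\<close>)
      show "AE x in lebesgue. norm (f0 x * cnj (\<Prod>b\<in>B. T b n x)) \<le> 2 ^ card B * norm (f0 x)" for n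
      proof (intro AE_I2)
        fix x
        have "(\<Prod>b\<in>B. norm (T b n x)) \<le> (\<Prod>b\<in>B. 2)" using T(2) by (intro prod_mono) auto
        then have "norm (f0 x) * (\<Prod>b\<in>B. norm (T b n x)) \<le> norm (f0 x) * 2 ^ card B" by (intro mult_left_mono) auto
        then show "norm (f0 x * cnj (\<Prod>b\<in>B. T b n x)) \<le> 2 ^ card B * norm (f0 x)"
          by (simp only: norm_mult complex_mod_cnj prod_norm mult.commute[of "2 ^ card B"])
      qed
    qed
    moreover have "(\<integral>x. f0 x * cnj (\<Prod>b\<in>B. T b n x) \<partial>lebesgue) = 0" for n
      by (intro trig_orth trig_prod[OF finite_B] T(1))
    ultimately have zero: "(\<integral>x. f0 x * cnj (\<Prod>b\<in>B. ch b x) \<partial>lebesgue) = 0"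
      by (simp add: LIMSEQ_const_iff)
    have sets_cell: "cell a c \<in> sets lebesgue"
    proof -
      have "cell a c \<in> sets borel" unfolding sets_borel_cells[symmetric] by (auto intro!: sigma_sets.Basic)
      then show ?thesis by simp
    qed
    have "(LINT x:cell a c|lebesgue. f0 x) = (\<integral>x. f0 x * cnj (\<Prod>b\<in>B. ch b x) \<partial>lebesgue)"
      unfolding set_lebesgue_integral_def
    proof (rule integral_cong_AE)
      have ch_eq: "f0 x * cnj (\<Prod>b\<in>B. ch b x) = indicat_real (cell a c) x *\<^sub>R f0 x"
        if in01: "\<forall>b\<in>B. coord b x \<noteq> 0 \<and> coord b x \<noteq> 1" for x
      proof (cases "x \<in> box_B")
        case True
        have "0 < coord b x \<and> coord b x < 1" if b: "b \<in> B" for b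
        proof -
          have "0 \<le> coord b x" "coord b x \<le> 1" using True b B_pos[OF b] by (auto simp: coord_def box_B_def)
          then show ?thesis using in01 b by fastforce
        qed
        then have "ch b x = (if a b < coord b x \<and> coord b x < c b then 1 else 0)" if "b \<in> B" for b
          using that by (auto simp: ch_def)
        then have "(\<Prod>b\<in>B. ch b x) = (\<Prod>b\<in>B. if a b < coord b x \<and> coord b x < c b then 1 else 0)"
          by (intro prod.cong) auto
        also have "\<dots> = (if x \<in> cell a c then 1 else 0)"
          using finite_B by (auto simp: cell_def intro!: prod_zero)
        finally show ?thesis by (simp add: indicator_def)
      qed (simp add: f0_def cutoff_def)
      show "AE x in lebesgue. indicat_real (cell a c) x *\<^sub>R f0 x = f0 x * cnj (\<Prod>b\<in>B. ch b x)"
        using AE_inner by eventually_elim (simp only: ch_eq)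
      show "(\<lambda>x. indicat_real (cell a c) x *\<^sub>R f0 x) \<in> borel_measurable lebesgue"
        using sets_cell f0_int by (intro borel_measurable_scaleR borel_measurable_indicator) auto
      show "(\<lambda>x. f0 x * cnj (\<Prod>b\<in>B. ch b x)) \<in> borel_measurable lebesgue"
      proof (rule borel_measurable_LIMSEQ_metric)
        show "(\<lambda>x. f0 x * cnj (\<Prod>b\<in>B. T b n x)) \<in> borel_measurable lebesgue" for n
          using f0_int meas[of n] by (intro borel_measurable_times borel_measurable_cnj) auto
        show "(\<lambda>n. f0 x * cnj (\<Prod>b\<in>B. T b n x)) \<longlonglongrightarrow> f0 x * cnj (\<Prod>b\<in>B. ch b x)" for x
        proof (cases "x \<in> box_B")
          case True
          then show ?thesis using T(3) by (intro tendsto_intros) auto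
        qed (simp add: f0_def cutoff_def)
      qed
    qed
    with zero show ?thesis by simp
  qed
  have set_int: "set_integrable lebesgue S f0" if "S \<in> sets lebesgue" for S
    unfolding set_integrable_def using that f0_int by (rule integrable_mult_indicator)
  have total: "(\<integral>x. f0 x \<partial>lebesgue) = 0"
    using trig_orth[OF trig_const[of 1]] by simp
  have borel: "(LINT x:S|lebesgue. f0 x) = 0" if "S \<in> sets borel" for S
  proof -
    have "Int_stable (range (\<lambda>(a, c). cell a c))"
    proof (rule Int_stableI_image)
      fix p q :: "('a \<Rightarrow> real) \<times> ('a \<Rightarrow> real)"
      show "\<exists>r\<in>UNIV. (case p of (a, c) \<Rightarrow> cell a c) \<inter> (case q of (a, c) \<Rightarrow> cell a c) = (case r of (a, c) \<Rightarrow> cell a c)"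
        by (rule bexI[of _ "(\<lambda>b. max (fst p b) (fst q b), \<lambda>b. min (snd p b) (snd q b))"])
           (auto simp: cell_def split: prod.splits)
    qed
    moreover have "range (\<lambda>(a, c). cell a c) \<subseteq> Pow UNIV" by simp
    moreover have "S \<in> sigma_sets UNIV (range (\<lambda>(a, c). cell a c))"
      using that unfolding sets_borel_cells[symmetric] by simp
    ultimately show ?thesis
    proof (induction rule: sigma_sets_induct_disjoint)
      case (basic A)
      then show ?case using cell by auto
    next
      case empty
      show ?case by (simp add: set_lebesgue_integral_def)
    next
      case (compl A)
      then have A: "A \<in> sets lebesgue" using sets_borel_cells by auto
      then have A': "UNIV - A \<in> sets lebesgue" using sets.compl_sets[OF A] by simp
      have "(\<integral>x. f0 x \<partial>lebesgue) = (\<integral>x. indicat_real A x *\<^sub>R f0 x + indicat_real (UNIV - A) x *\<^sub>R f0 x \<partial>lebesgue)"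
        by (intro Bochner_Integration.integral_cong) (auto simp: indicator_def)
      also have "\<dots> = (LINT x:A|lebesgue. f0 x) + (LINT x:UNIV - A|lebesgue. f0 x)"
        unfolding set_lebesgue_integral_def using set_int[OF A] set_int[OF A']
        by (intro Bochner_Integration.integral_add) (auto simp: set_integrable_def)
      finally show ?case using total compl by simp
    next
      case (union A)
      then have A: "\<And>i. A i \<in> sets lebesgue" using sets_borel_cells by auto
      have "(LINT x:(\<Union>i. A i)|lebesgue. f0 x) = (\<Sum>i. (LINT x:(A i)|lebesgue. f0 x))"
        using A union(1) by (intro lebesgue_integral_countable_add set_int) (auto simp: disjoint_family_on_def)
      then show ?case using union by simp
    qed
  qed
  have "AE x in lebesgue. f0 x = 0"
  proof (rule sigma_finite_measure.density_zero)
    show "sigma_finite_measure (lebesgue :: 'a measure)" by (rule sigma_finite_lebesgue)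
    show "integrable lebesgue f0" by (rule f0_int)
    fix A :: "'a set" assume "A \<in> sets lebesgue"
    then obtain S N N' where A: "A = S \<union> N" "N \<subseteq> N'" "N' \<in> null_sets lborel" "S \<in> sets lborel"
      by (rule sets_completionE)
    have "N' \<in> null_sets lebesgue" using A(3) by (rule null_sets_completionI)
    then have "AE x in lebesgue. x \<notin> N'" by (rule AE_not_in)
    then have "(LINT x:A|lebesgue. f0 x) = (LINT x:S|lebesgue. f0 x)"
      unfolding set_lebesgue_integral_def
    proof (intro integral_cong_AE)
      show "AE x in lebesgue. indicat_real A x *\<^sub>R f0 x = indicat_real S x *\<^sub>R f0 x"
        using \<open>AE x in lebesgue. x \<notin> N'\<close> by eventually_elim (use A(1,2) in \<open>auto simp: indicator_def\<close>)
    qed (use \<open>A \<in> sets lebesgue\<close> A(4) f0_int in \<open>auto intro!: borel_measurable_scaleR borel_measurable_indicator\<close>)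
    then show "(LINT x:A|lebesgue. f0 x) = 0" using borel A(4) by simp
  qed
  then show "ae_eq (lebesgue_on box_B) f (\<lambda>x. 0)"
    using ae_eq_cutoff[OF box_B_sets(1)] by (simp add: ae_eq_def f0_def)
qed

lemma exp_riesz_box_B: "exp_riesz box_B lattice_B"
  using countable_lattice_B bessel_box_B riesz_sequence_box_B complete_in_box_B
  by (simp add: exp_riesz_def)

end

subsection \<open>Zonotopes\<close>

text \<open>Generators form a list, so that repeated, parallel and zero vectors are allowed:
  projecting along a generator can produce them, and the image is again the zonotope of the
  projected list.\<close>

fun zonotope :: "'a::real_vector list \<Rightarrow> 'a set" where
  "zonotope [] = {0}"
| "zonotope (v # vs) = {x + t *\<^sub>R v | x t. x \<in> zonotope vs \<and> 0 \<le> t \<and> t \<le> 1}"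

lemma zonotope_Cons_sum: "zonotope (v # vs) = {x + y | x y. x \<in> zonotope vs \<and> y \<in> (\<lambda>t. t *\<^sub>R v) ` {0..1}}"
  by (fastforce simp: image_iff)

lemma compact_zonotope: "compact (zonotope (vs :: 'a::euclidean_space list))"
proof (induction vs)
  case (Cons v vs)
  have "compact ((\<lambda>t. t *\<^sub>R v) ` {0..1::real})"
    by (intro compact_continuous_image continuous_intros) auto
  with Cons show ?case unfolding zonotope_Cons_sum by (intro compact_sums)
qed simp

lemma convex_zonotope: "convex (zonotope vs)"
proof (induction vs)
  case (Cons v vs)
  show ?case
  proof (rule convexI)
    fix x y and a b :: real
    assume x: "x \<in> zonotope (v # vs)" and y: "y \<in> zonotope (v # vs)" and ab: "0 \<le> a" "0 \<le> b" "a + b = 1"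
    obtain p s where p: "x = p + s *\<^sub>R v" "p \<in> zonotope vs" "0 \<le> s" "s \<le> 1" using x by auto
    obtain q t where q: "y = q + t *\<^sub>R v" "q \<in> zonotope vs" "0 \<le> t" "t \<le> 1" using y by auto
    have "a *\<^sub>R x + b *\<^sub>R y = (a *\<^sub>R p + b *\<^sub>R q) + (a * s + b * t) *\<^sub>R v"
      by (simp add: p(1) q(1) algebra_simps)
    moreover have "a *\<^sub>R p + b *\<^sub>R q \<in> zonotope vs" using Cons p(2) q(2) ab by (rule convexD)
    moreover have "0 \<le> a * s + b * t" using ab p q by simp
    moreover have "a * s + b * t \<le> 1" using ab p q by (intro convex_bound_le) auto
    ultimately show "a *\<^sub>R x + b *\<^sub>R y \<in> zonotope (v # vs)" by auto
  qed
qed simp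

lemma zonotope_insert: "zonotope (us @ v # vs) = zonotope (v # us @ vs)"
proof (induction us)
  case (Cons u us)
  have "x \<in> zonotope (u # v # us @ vs) \<longleftrightarrow> x \<in> zonotope (v # u # us @ vs)" for x
  proof -
    have comm: "y + s *\<^sub>R a + t *\<^sub>R b = y + t *\<^sub>R b + s *\<^sub>R a" for y a b :: 'a and s t :: real by simp
    show ?thesis by (auto, (metis comm)+)
  qed
  with Cons show ?case by auto
qed simp

lemma zonotope_linear_image:
  assumes "linear p" shows "zonotope (map p vs) = p ` zonotope vs"
proof (induction vs)
  case (Cons v vs)
  interpret linear p by fact
  have "p ` zonotope (v # vs) = {p x + t *\<^sub>R p v | x t. x \<in> zonotope vs \<and> 0 \<le> t \<and> t \<le> 1}"
    by (force simp: add scale image_iff)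
  also have "\<dots> = zonotope (p v # map p vs)" using Cons by auto
  finally show ?case by simp
qed (simp add: linear_0[OF assms])

text \<open>Cancellation for Minkowski sums of compact convex sets. A hyperplane strictly separating
  \<open>x\<close> from the smaller zonotope contradicts the representation of \<open>x\<close> or
  that of \<open>x + u\<close>, depending on the sign of \<open>a \<bullet> u\<close>.\<close>

lemma zonotope_erosion:
  fixes u :: "'a::euclidean_space"
  shows "{x \<in> zonotope (u # vs). x + u \<in> zonotope (u # vs)} = zonotope vs"
proof (intro equalityI subsetI)
  fix x assume x: "x \<in> zonotope vs"
  have "x + 0 *\<^sub>R u \<in> zonotope (u # vs)"
    unfolding zonotope.simps using x by (intro CollectI exI[of _ x] exI[of _ "0::real"]) simp
  moreover have "x + 1 *\<^sub>R u \<in> zonotope (u # vs)"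
    unfolding zonotope.simps using x by (intro CollectI exI[of _ x] exI[of _ "1::real"]) simp
  ultimately show "x \<in> {x \<in> zonotope (u # vs). x + u \<in> zonotope (u # vs)}" by simp
next
  fix x assume "x \<in> {x \<in> zonotope (u # vs). x + u \<in> zonotope (u # vs)}"
  then obtain y t y' t' where y: "x = y + t *\<^sub>R u" "y \<in> zonotope vs" "0 \<le> t"
    and y': "x + u = y' + t' *\<^sub>R u" "y' \<in> zonotope vs" "t' \<le> 1"
    by auto
  show "x \<in> zonotope vs"
  proof (rule ccontr)
    assume "x \<notin> zonotope vs"
    then obtain a b where a: "a \<bullet> x < b" "\<And>z. z \<in> zonotope vs \<Longrightarrow> b < a \<bullet> z"
      using separating_hyperplane_closed_point[OF convex_zonotope compact_imp_closed[OF compact_zonotope]] by metis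
    show False
    proof (cases "a \<bullet> u \<ge> 0")
      case True
      then have "0 \<le> t * (a \<bullet> u)" using y(3) by simp
      then show False using a(1) a(2)[OF y(2)] by (simp add: y(1) inner_add_right)
    next
      case False
      have "x = y' + (t' - 1) *\<^sub>R u" using y'(1) by (simp add: algebra_simps)
      then have "a \<bullet> x = a \<bullet> y' + (t' - 1) * (a \<bullet> u)" by (simp add: inner_add_right)
      moreover have "0 \<le> (t' - 1) * (a \<bullet> u)" using False y'(3) by (simp add: mult_nonpos_nonpos)
      ultimately show False using a(1) a(2)[OF y'(2)] by simp
    qed
  qed
qed

text \<open>Distinctness lets the coefficients be a function of the vectors, in the manner of frame
  coordinates.\<close>

lemma zonotope_distinct:
  assumes "distinct vs"
  shows "x \<in> zonotope vs \<longleftrightarrow> (\<exists>t. (\<forall>v\<in>set vs. 0 \<le> t v \<and> t v \<le> 1) \<and> x = (\<Sum>v\<in>set vs. t v *\<^sub>R v))"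
  using assms
proof (induction vs arbitrary: x)
  case (Cons v vs)
  show ?case
  proof
    assume "x \<in> zonotope (v # vs)"
    then obtain y s where y: "x = y + s *\<^sub>R v" "y \<in> zonotope vs" "0 \<le> s" "s \<le> 1" by auto
    then obtain t where t: "\<forall>v\<in>set vs. 0 \<le> t v \<and> t v \<le> 1" "y = (\<Sum>v\<in>set vs. t v *\<^sub>R v)"
      using Cons by auto
    define t' where "t' = t(v := s)"
    have "(\<Sum>w\<in>set vs. t' w *\<^sub>R w) = y"
      unfolding t(2) using Cons.prems by (intro sum.cong refl) (auto simp: t'_def)
    then have "x = (\<Sum>w\<in>set (v # vs). t' w *\<^sub>R w)"
      using Cons.prems by (simp add: y(1) t'_def)
    moreover have "\<forall>w\<in>set (v # vs). 0 \<le> t' w \<and> t' w \<le> 1" using t(1) y(3,4) by (simp add: t'_def)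
    ultimately show "\<exists>t. (\<forall>v\<in>set (v # vs). 0 \<le> t v \<and> t v \<le> 1) \<and> x = (\<Sum>v\<in>set (v # vs). t v *\<^sub>R v)" by blast
  next
    assume "\<exists>t. (\<forall>v\<in>set (v # vs). 0 \<le> t v \<and> t v \<le> 1) \<and> x = (\<Sum>v\<in>set (v # vs). t v *\<^sub>R v)"
    then obtain t where t: "\<forall>v\<in>set (v # vs). 0 \<le> t v \<and> t v \<le> 1" "x = (\<Sum>v\<in>set (v # vs). t v *\<^sub>R v)" by blast
    have "(\<Sum>v\<in>set vs. t v *\<^sub>R v) \<in> zonotope vs" using Cons t(1) by auto
    moreover have "x = (\<Sum>v\<in>set vs. t v *\<^sub>R v) + t v *\<^sub>R v" using t(2) Cons.prems by simp
    ultimately show "x \<in> zonotope (v # vs)" using t(1) by auto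
  qed
qed simp

section \<open>Exponential bases of zonotopes\<close>

lemma exp_riesz_negligible:
  assumes "negligible S" shows "exp_riesz S {}"
proof -
  have S: "S \<in> null_sets lebesgue" using assms by (simp add: negligible_iff_null_sets)
  have "ae_eq (lebesgue_on S) f (\<lambda>x. 0)" for f
  proof -
    have "S \<in> sets lebesgue" using S by (rule null_setsD2)
    moreover have "ae_eq lebesgue (cutoff S f) (\<lambda>x. 0)"
      unfolding ae_eq_def using AE_not_in[OF S] by eventually_elim (simp add: cutoff_def)
    ultimately show ?thesis by (simp add: ae_eq_cutoff)
  qed
  then show ?thesis by (simp add: exp_riesz_def bessel_def riesz_sequence_def complete_in_def)
qed

text \<open>With as many generators as dimensions this is a box with its dual lattice. With fewer,
  the zonotope lies in a proper subspace, and for the empty frequency set the integrality demand is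
  void.\<close>

lemma exp_riesz_zonotope_orthogonal:
  assumes bs: "pairwise orthogonal (set bs)" "(0::'a::euclidean_space) \<notin> set bs" "distinct bs"
  shows "\<exists>L. exp_riesz (zonotope bs) L \<and> (\<forall>l\<in>L. \<forall>b\<in>set bs. l \<bullet> b \<in> \<int>)"
proof (cases "card (set bs) = DIM('a)")
  case True
  interpret orthogonal_frame "set bs" by unfold_locales (use bs True in auto)
  have "zonotope bs = box_B"
  proof (intro equalityI subsetI)
    fix x assume "x \<in> zonotope bs"
    then obtain t where t: "\<And>b. b \<in> set bs \<Longrightarrow> 0 \<le> t b \<and> t b \<le> 1" "x = (\<Sum>b\<in>set bs. t b *\<^sub>R b)"
      unfolding zonotope_distinct[OF bs(3)] by blast
    have "x \<bullet> b = t b * (b \<bullet> b)" if b: "b \<in> set bs" for b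
    proof -
      have "x \<bullet> b = (\<Sum>b'\<in>set bs. if b' = b then t b * (b \<bullet> b) else 0)"
        unfolding t(2) inner_sum_left using B_orth b by (intro sum.cong refl) auto
      then show ?thesis using b by simp
    qed
    then show "x \<in> box_B" using t(1) B_pos by (auto simp: box_B_def mult_left_le_one_le)
  next
    fix x assume x: "x \<in> box_B"
    have "0 \<le> coord b x \<and> coord b x \<le> 1" if "b \<in> set bs" for b
      using x that B_pos[OF that] by (auto simp: box_B_def coord_def)
    then show "x \<in> zonotope bs"
      unfolding zonotope_distinct[OF bs(3)]
      by (intro exI[of _ "\<lambda>b. coord b x"] conjI ballI coord_expansion) auto
  qed
  then show ?thesis using exp_riesz_box_B by (auto simp: lattice_B_def)
next
  case False
  have ind: "independent (set bs)" using bs by (intro pairwise_orthogonal_independent)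
  have "zonotope bs \<subseteq> span (set bs)"
  proof
    fix x assume "x \<in> zonotope bs"
    then obtain t where "x = (\<Sum>b\<in>set bs. t b *\<^sub>R b)" unfolding zonotope_distinct[OF bs(3)] by blast
    then show "x \<in> span (set bs)" by (auto intro: span_sum span_scale span_base)
  qed
  then have "dim (zonotope bs) \<le> dim (span (set bs))" by (rule dim_subset)
  also have "\<dots> = card (set bs)" using ind by (simp add: dim_eq_card_independent)
  also have "\<dots> < DIM('a)" using False independent_bound[OF ind] by simp
  finally have "negligible (zonotope bs)" by (rule negligible_lowdim)
  then show ?thesis using exp_riesz_negligible by blast
qed

text \<open>The orthogonal generators \<open>bs\<close>, with integral frequencies along them, record the directions
  that have already been projected out; both recursive calls below have one generator less in \<open>us\<close>.\<close>

lemma exp_riesz_zonotope_aux: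
  fixes us bs :: "'a::euclidean_space list"
  assumes "pairwise orthogonal (set bs)" "0 \<notin> set bs" "distinct bs"
    "\<And>u b. u \<in> set us \<Longrightarrow> b \<in> set bs \<Longrightarrow> u \<bullet> b = 0"
  shows "\<exists>L. exp_riesz (zonotope (us @ bs)) L \<and> (\<forall>l\<in>L. \<forall>b\<in>set bs. l \<bullet> b \<in> \<int>)"
  using assms
proof (induction "length us" arbitrary: us bs)
  case 0
  then show ?case using exp_riesz_zonotope_orthogonal by simp
next
  case (Suc n)
  obtain u vs where us: "us = u # vs" and n: "n = length vs" using Suc.hyps(2) by (cases us) auto
  have vs_bs: "\<And>v b. v \<in> set vs \<Longrightarrow> b \<in> set bs \<Longrightarrow> v \<bullet> b = 0" using Suc.prems(4) us by auto
  have u_bs: "\<And>b. b \<in> set bs \<Longrightarrow> u \<bullet> b = 0" using Suc.prems(4) us by auto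
  obtain L0 where L0: "exp_riesz (zonotope (vs @ bs)) L0" "\<And>l b. l \<in> L0 \<Longrightarrow> b \<in> set bs \<Longrightarrow> l \<bullet> b \<in> \<int>"
    using Suc.hyps(1)[OF n Suc.prems(1-3) vs_bs] by blast
  show ?case
  proof (cases "u = 0")
    case True
    then have "zonotope (us @ bs) = zonotope (vs @ bs)" by (auto simp: us)
    then show ?thesis using L0 by auto
  next
    case False
    \<comment> \<open>Orthogonal projection along \<open>u\<close> keeps the remaining generators
      orthogonal to \<open>bs\<close> and makes them orthogonal to \<open>u\<close>, so that
      \<open>u\<close> may join \<open>bs\<close> in the recursive call for
      \<open>Q\<close>.\<close>
    define p where "p x = x - ((x \<bullet> u) / (u \<bullet> u)) *\<^sub>R u" for x
    have uu: "u \<bullet> u > 0" using False by simp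
    have p_lin: "linear p"
      unfolding p_def by (rule linearI) (simp_all add: inner_add_left add_divide_distrib algebra_simps)
    have p_u: "p x \<bullet> u = 0" for x using uu by (simp add: p_def inner_diff_left)
    have p_fix: "p b = b" if "b \<in> set bs" for b using u_bs[OF that] by (simp add: p_def inner_commute)
    define Q0 where "Q0 = p ` zonotope (vs @ bs)"
    define Q where "Q = zonotope (map p vs @ u # bs)"
    have "map p (vs @ bs) = map p vs @ bs" using p_fix by (simp add: map_idI)
    then have Q0: "Q0 = zonotope (map p vs @ bs)" unfolding Q0_def using zonotope_linear_image[OF p_lin, of "vs @ bs"] by simp
    have Q: "Q = {y + t *\<^sub>R u | y t. y \<in> Q0 \<and> 0 \<le> t \<and> t \<le> 1}" unfolding Q_def Q0 zonotope_insert by simp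
    obtain L2' where L2': "exp_riesz Q L2'" "\<And>l b. l \<in> L2' \<Longrightarrow> b \<in> set (u # bs) \<Longrightarrow> l \<bullet> b \<in> \<int>"
    proof -
      have "n = length (map p vs)" using n by simp
      moreover have "pairwise orthogonal (set (u # bs))"
        using Suc.prems(1) u_bs by (auto simp: pairwise_insert orthogonal_def inner_commute)
      moreover have "0 \<notin> set (u # bs)" using Suc.prems(2) False by simp
      moreover have "distinct (u # bs)" using Suc.prems(3) u_bs[of u] uu by auto
      moreover have "v \<bullet> b = 0" if "v \<in> set (map p vs)" "b \<in> set (u # bs)" for v b
        using that p_u vs_bs u_bs by (auto simp: p_def inner_diff_left)
      ultimately have "\<exists>L. exp_riesz (zonotope (map p vs @ u # bs)) L \<and> (\<forall>l\<in>L. \<forall>b\<in>set (u # bs). l \<bullet> b \<in> \<int>)"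
        by (rule Suc.hyps(1))
      then show ?thesis using that unfolding Q_def by blast
    qed
    have meas: "zonotope (vs @ bs) \<in> sets lebesgue" "bounded (zonotope (vs @ bs))"
      using compact_zonotope by (auto intro: compact_imp_bounded lmeasurable_compact fmeasurableD)
    \<comment> \<open>The frequencies \<open>L0\<close> are perturbed only after the recursive call.
      They move along \<open>u\<close>, which is orthogonal to every vector of \<open>bs\<close>, so
      the integrality obtained for \<open>L0\<close> persists.\<close>
    obtain L1 \<delta> where L1: "exp_riesz (zonotope (vs @ bs)) L1" "\<delta> > 0" "\<And>l. l \<in> L1 \<Longrightarrow> \<delta> \<le> cmod (exponential l u - 1)"
        "\<And>b. b \<bullet> u = 0 \<Longrightarrow> \<forall>l\<in>L0. l \<bullet> b \<in> \<int> \<Longrightarrow> \<forall>l\<in>L1. l \<bullet> b \<in> \<int>"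
      using exp_riesz_avoid[OF L0(1) meas False] by blast
    have \<Omega>: "zonotope (us @ bs) = {x + t *\<^sub>R u | x t. x \<in> zonotope (vs @ bs) \<and> 0 \<le> t \<and> t \<le> 1}"
      by (simp add: us)
    have dec: "x = p x + ((x \<bullet> u) / (u \<bullet> u)) *\<^sub>R u" for x by (simp add: p_def)
    have "exp_riesz (zonotope (us @ bs)) (L1 \<union> L2')"
    proof (rule exp_riesz_step[OF compact_zonotope convex_zonotope _ False])
      show "compact Q" unfolding Q_def by (rule compact_zonotope)
      show "exp_riesz {x \<in> zonotope (us @ bs). x + u \<in> zonotope (us @ bs)} L1"
        using L1(1) zonotope_erosion[of u "vs @ bs"] by (simp add: us)
      show "exp_riesz Q L2'" by (rule L2'(1))
      show "l \<bullet> u \<in> \<int>" if "l \<in> L2'" for l using L2'(2)[OF that] by simp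
      show "\<exists>k::int. x - of_int k *\<^sub>R u \<in> Q \<and> (x - of_int k *\<^sub>R u) \<bullet> u < u \<bullet> u" if x: "x \<in> zonotope (us @ bs)" for x
      proof -
        obtain z t where z: "x = z + t *\<^sub>R u" "z \<in> zonotope (vs @ bs)" using x unfolding \<Omega> by auto
        \<comment> \<open>The coordinate of \<open>x\<close> along \<open>u\<close>: its integer
          part is the shift, its fractional part the height within \<open>Q\<close>, strictly below
          the upper face.\<close>
        define r where "r = (z \<bullet> u) / (u \<bullet> u) + t"
        have xr: "x - of_int \<lfloor>r\<rfloor> *\<^sub>R u = p z + frac r *\<^sub>R u"
          unfolding z(1) frac_def r_def by (subst (1) dec[of z]) (simp add: algebra_simps)
        have "p z \<in> Q0" using z(2) by (simp add: Q0_def)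
        then have "p z + frac r *\<^sub>R u \<in> Q"
          unfolding Q using frac_lt_1[of r]
          by (intro CollectI exI[of _ "p z"] exI[of _ "frac r"]) (simp add: less_imp_le)
        moreover have "(p z + frac r *\<^sub>R u) \<bullet> u < u \<bullet> u" using p_u uu frac_lt_1[of r] by (simp add: inner_add_left)
        ultimately show ?thesis by (intro exI[of _ "\<lfloor>r\<rfloor>"]) (simp only: xr)
      qed
      show "\<exists>k::int. y + of_int k *\<^sub>R u \<in> zonotope (us @ bs)" if y: "y \<in> Q" for y
      proof -
        obtain z t where z: "y = p z + t *\<^sub>R u" "z \<in> zonotope (vs @ bs)" using y unfolding Q Q0_def by auto
        define r where "r = t - (z \<bullet> u) / (u \<bullet> u)"
        have "y + of_int (- \<lfloor>r\<rfloor>) *\<^sub>R u = z + frac r *\<^sub>R u"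
          unfolding z(1) frac_def r_def p_def by (simp add: algebra_simps)
        moreover have "z + frac r *\<^sub>R u \<in> zonotope (us @ bs)"
          unfolding \<Omega> using z(2) frac_lt_1[of r]
          by (intro CollectI exI[of _ z] exI[of _ "frac r"]) (simp add: less_imp_le)
        ultimately show ?thesis by (intro exI[of _ "- \<lfloor>r\<rfloor>"]) (simp only:)
      qed
      show "0 \<le> y \<bullet> u \<and> y \<bullet> u \<le> u \<bullet> u" if y: "y \<in> Q" for y
      proof -
        obtain z t where "y = p z + t *\<^sub>R u" "0 \<le> t" "t \<le> 1" using y unfolding Q Q0_def by auto
        then show ?thesis using p_u uu by (simp add: inner_add_left mult_left_le_one_le)
      qed
    qed (use L1 in auto)
    moreover have "l \<bullet> b \<in> \<int>" if "l \<in> L1 \<union> L2'" "b \<in> set bs" for l b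
    proof -
      have "b \<bullet> u = 0" using u_bs[OF that(2)] by (simp add: inner_commute)
      then show ?thesis using that L2'(2) L1(4)[of b] L0(2) by auto
    qed
    ultimately show ?thesis by blast
  qed
qed

lemma exp_riesz_zonotope: "\<exists>L. exp_riesz (zonotope (us :: 'a::euclidean_space list)) L"
  using exp_riesz_zonotope_aux[of "[]" us] by auto

text \<open>Moving the domain multiplies each exponential by a constant of modulus 1, so the same
  frequencies serve.\<close>

lemma exp_riesz_translation:
  fixes S :: "'a::euclidean_space set"
  assumes L: "exp_riesz S L" and S: "S \<in> sets lebesgue" "bounded S"
  shows "exp_riesz ((+) a ` S) L"
proof -
  define T where "T = (+) a ` S"
  have T: "T \<in> sets lebesgue" "bounded T" "\<And>x. x + a \<in> T \<longleftrightarrow> x \<in> S"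
    unfolding T_def by (rule lebesgue_sets_translation[OF S(1)], rule bounded_translation[OF S(2)]) (force simp: add.commute)
  obtain A where A: "A > 0" "\<And>F c. finite F \<Longrightarrow> F \<subseteq> L \<Longrightarrow>
     sqrt (\<Sum>i\<in>F. (cmod (c i))\<^sup>2) \<le> A * L2_norm (lebesgue_on S) (lincomb F c exponential)"
    using L unfolding exp_riesz_def by (auto elim: riesz_sequenceE)
  have "sqrt (\<Sum>i\<in>F. (cmod (c i))\<^sup>2) \<le> A * L2_norm (lebesgue_on T) (lincomb F c exponential)"
    if F: "finite F" "F \<subseteq> L" for F c
  proof -
    have "L2_norm (lebesgue_on T) (lincomb F c exponential) = L2_norm (lebesgue_on S) (\<lambda>x. lincomb F c exponential (x + a))"
      by (rule L2_norm_lebesgue_on_translation[symmetric, OF S(1) T(1,3)]) (intro lincomb_L2 exponential_L2 T)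
    also have "(\<lambda>x. lincomb F c exponential (x + a)) = lincomb F (\<lambda>l. c l * exponential l a) exponential"
      unfolding lincomb_def by (intro ext sum.cong refl) (simp add: exponential_add_right)
    finally show ?thesis using A(2)[OF F, of "\<lambda>l. c l * exponential l a"] by (simp add: norm_mult)
  qed
  then have "riesz_sequence (lebesgue_on T) L exponential" unfolding riesz_sequence_def by blast
  moreover have "complete_in (lebesgue_on T) L exponential"
    unfolding complete_in_def
  proof (intro ballI impI)
    fix f assume f: "f \<in> L2 (lebesgue_on T)" and orth: "\<forall>l\<in>L. L2_inner (lebesgue_on T) f (exponential l) = 0"
    define g where "g x = f (x + a)" for x
    have cut: "cutoff S g = (\<lambda>x. cutoff T f (x + a))" using T(3) by (auto simp: cutoff_def g_def)
    have fL: "cutoff T f \<in> L2 lebesgue" using f by (simp add: L2_cutoff T)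
    then have "cutoff S g \<in> L2 lebesgue" unfolding cut by (rule L2_lebesgue_translation)
    then have g: "g \<in> L2 (lebesgue_on S)" by (simp add: L2_cutoff S)
    have "L2_inner (lebesgue_on S) g (exponential l) = 0" if l: "l \<in> L" for l
    proof -
      have meas: "exponential l \<in> borel_measurable lebesgue"
        using exponential_measurable[of l UNIV] by (simp add: lebesgue_on_UNIV_eq)
      have "0 = (\<integral>x. cutoff T f x * cnj (exponential l x) \<partial>lebesgue)"
        using orth l L2_inner_cutoff[OF T(1), of f "exponential l"] by (simp add: L2_inner_def)
      also have "\<dots> = (\<integral>x. cutoff T f (x + a) * cnj (exponential l (x + a)) \<partial>lebesgue)"
        by (rule integral_lebesgue_translation[symmetric])
           (intro borel_measurable_times borel_measurable_cnj meas L2_measurable fL)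
      also have "\<dots> = (\<integral>x. cnj (exponential l a) * (cutoff S g x * cnj (exponential l x)) \<partial>lebesgue)"
        unfolding cut by (simp add: exponential_add_right mult_ac)
      also have "\<dots> = cnj (exponential l a) * L2_inner (lebesgue_on S) g (exponential l)"
        unfolding L2_inner_cutoff[OF S(1), of g] by (simp add: L2_inner_def)
      finally have "cnj (exponential l a) * L2_inner (lebesgue_on S) g (exponential l) = 0" by simp
      moreover have "exponential l a \<noteq> 0" using norm_exponential[of l a] by (metis norm_zero zero_neq_one)
      ultimately show ?thesis by simp
    qed
    then have "ae_eq (lebesgue_on S) g (\<lambda>x. 0)" using L g by (auto simp: exp_riesz_def complete_in_def)
    then have "AE x in lebesgue. cutoff T f (x + a) = 0"
      using ae_eq_cutoff[OF S(1), of g] cut by (simp add: ae_eq_def)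
    from AE_lebesgue_translation[OF this, of "- a"]
    show "ae_eq (lebesgue_on T) f (\<lambda>x. 0)" using ae_eq_cutoff[OF T(1), of f] by (simp add: ae_eq_def)
  qed
  ultimately show ?thesis using L unfolding exp_riesz_def T_def by blast
qed

subsection \<open>Polytopes with symmetric faces are zonotopes\<close>

text \<open>A point reflection is an involution, so mapping \<open>S\<close> into itself already
  means mapping it onto itself.\<close>

lemma centrally_symmetric_iff: "centrally_symmetric S \<longleftrightarrow> (\<exists>t. \<forall>x\<in>S. - x - t \<in> S)"
proof
  assume "centrally_symmetric S"
  then obtain t where t: "uminus ` S = (\<lambda>x. t + x) ` S" by (auto simp: centrally_symmetric_def)
  have "- x - t \<in> S" if "x \<in> S" for x
  proof -
    have "- x \<in> (\<lambda>x. t + x) ` S" using that t by blast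
    then show ?thesis by auto
  qed
  then show "\<exists>t. \<forall>x\<in>S. - x - t \<in> S" by blast
next
  assume "\<exists>t. \<forall>x\<in>S. - x - t \<in> S"
  then obtain t where t: "\<And>x. x \<in> S \<Longrightarrow> - x - t \<in> S" by blast
  have "uminus ` S = (\<lambda>x. t + x) ` S"
  proof (intro equalityI subsetI)
    fix y assume "y \<in> uminus ` S"
    then obtain x where "x \<in> S" "y = t + (- x - t)" by auto
    then show "y \<in> (\<lambda>x. t + x) ` S" using t by blast
  next
    fix y assume "y \<in> (\<lambda>x. t + x) ` S"
    then obtain x where "x \<in> S" "y = - (- x - t)" by auto
    then show "y \<in> uminus ` S" using t by blast
  qed
  then show "centrally_symmetric S" by (auto simp: centrally_symmetric_def)
qed

definition symmetric_faces :: "'a::euclidean_space set \<Rightarrow> bool" where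
  "symmetric_faces S \<longleftrightarrow> (\<forall>F. F face_of S \<longrightarrow> centrally_symmetric F)"

section \<open>Edges, vertices and faces of projections\<close>

lemma polytope_edge_exists:
  fixes S :: "'a::euclidean_space set"
  assumes "polytope S" "aff_dim S \<ge> 1"
  shows "\<exists>a b. a \<noteq> b \<and> closed_segment a b face_of S"
  using assms
proof (induction "nat (aff_dim S)" arbitrary: S rule: less_induct)
  case less
  show ?case
  proof (cases "aff_dim S = 1")
    case True
    then have "collinear S" "S \<noteq> {}" by (auto simp: collinear_aff_dim)
    then obtain a b where ab: "S = closed_segment a b"
      using compact_convex_collinear_segment[of S] less.prems polytope_imp_compact polytope_imp_convex by metis
    then have "a \<noteq> b" using True by auto
    moreover have "closed_segment a b face_of S" unfolding ab by (simp add: face_of_refl)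
    ultimately show ?thesis by blast
  next
    case False
    then obtain F where F: "F facet_of S" using polytope_facet_exists less.prems by (metis less_le_trans zero_less_one)
    then have dim: "aff_dim F = aff_dim S - 1" by (simp add: facet_of_def)
    have face: "F face_of S" using F by (rule facet_of_imp_face_of)
    have "polytope F" using less.prems(1) face by (rule face_of_polytope_polytope)
    then obtain a b where "a \<noteq> b" "closed_segment a b face_of F"
      using less.hyps[of F] dim False less.prems(2) by auto
    then show ?thesis using face_of_trans face by blast
  qed
qed

text \<open>The edge graph of a polytope is connected: the boundary of a face of dimension at least two is
  connected, and facets that meet share a vertex.\<close>

lemma polytope_vertices_propagate:
  fixes Q :: "'a::euclidean_space set"
  assumes "polytope Q"
    and "\<And>v w. v \<noteq> w \<Longrightarrow> closed_segment v w face_of Q \<Longrightarrow> good v \<Longrightarrow> good w"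
    and "v extreme_point_of Q" "good v" "w extreme_point_of Q"
  shows "good w"
  using assms
proof (induction "nat (aff_dim Q)" arbitrary: Q v w rule: less_induct)
  case less
  note poly = less.prems(1) and edge = less.prems(2) and v = less.prems(3,4) and w = less.prems(5)
  have comp: "compact Q" "convex Q" using poly polytope_imp_compact polytope_imp_convex by auto
  have vQ: "v \<in> Q" and wQ: "w \<in> Q" using v(1) w by (auto simp: extreme_point_of_def)
  have "aff_dim Q \<ge> 0" using vQ aff_dim_negative_iff[of Q] by (metis empty_iff not_less)
  show ?case
  proof (cases "aff_dim Q \<le> 1")
    case True
    then have "collinear Q" by (simp add: collinear_aff_dim)
    then obtain a b where ab: "Q = closed_segment a b"
      using compact_convex_collinear_segment[of Q] comp vQ by blast
    have "v = a \<or> v = b" "w = a \<or> w = b" using v(1) w unfolding ab extreme_point_of_segment by auto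
    moreover have "closed_segment a b face_of Q" "closed_segment b a face_of Q"
      unfolding ab using face_of_refl[of "closed_segment a b"] by (auto simp: closed_segment_commute)
    ultimately show ?thesis using edge[of v w] v(2) by (cases "v = w") auto
  next
    case False
    show ?thesis
    proof (rule ccontr)
      assume nw: "\<not> good w"
      have fac: "F face_of Q" "F \<noteq> {}" "polytope F" "aff_dim F = aff_dim Q - 1" if "F facet_of Q" for F
        using that poly face_of_polytope_polytope facet_of_imp_face_of by (auto simp: facet_of_def)
      have ext_face: "x extreme_point_of F \<longleftrightarrow> x extreme_point_of Q \<and> x \<in> F" if "F face_of Q" for F x
        using extreme_point_of_face[OF that] by auto
      have IH: "good y" if F: "F facet_of Q" and x: "x extreme_point_of F" "good x" and y: "y extreme_point_of F" for F x y
      proof (rule less.hyps[OF _ fac(3)[OF F] _ x y])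
        show "nat (aff_dim F) < nat (aff_dim Q)" using fac(4)[OF F] False by simp
        show "good w'" if "v' \<noteq> w'" "closed_segment v' w' face_of F" "good v'" for v' w'
          using edge[OF that(1) face_of_trans[OF that(2) fac(1)[OF F]] that(3)] .
      qed
      have "polyhedron Q" using poly by (rule polytope_imp_polyhedron)
      then have bd: "rel_frontier Q = \<Union>{F. F facet_of Q}" by (rule rel_frontier_of_polyhedron)
      have in_facet: "\<exists>F. F facet_of Q \<and> x extreme_point_of F" if x: "x extreme_point_of Q" for x
      proof -
        have "Q \<noteq> {x}" using False by auto
        then have "x \<notin> rel_interior Q" using extreme_point_not_in_REL_INTERIOR[OF x] by simp
        then have "x \<in> rel_frontier Q"
          using x closure_closed[OF compact_imp_closed[OF comp(1)]] by (simp add: rel_frontier_def extreme_point_of_def)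
        then obtain F where "F facet_of Q" "x \<in> F" using bd by auto
        then show ?thesis using ext_face[OF fac(1)] x by blast
      qed
      \<comment> \<open>Facets with a good vertex and facets with a bad one. By induction the
        vertices of a facet are all of one kind, and facets of different kinds cannot meet, because
        a vertex of their intersection would be of both kinds. So two disjoint nonempty closed sets
        would cover the boundary.\<close>
      define A where "A = {F. F facet_of Q \<and> (\<exists>x. x extreme_point_of F \<and> good x)}"
      define B where "B = {F. F facet_of Q \<and> (\<exists>x. x extreme_point_of F \<and> \<not> good x)}"
      have fin: "finite {F. F facet_of Q}" using poly by (rule finite_polytope_facets)
      have closed_facet: "closed F" if "F facet_of Q" for F
        using fac(3)[OF that] by (rule polytope_imp_closed)
      have clA: "closed (\<Union>A)"
      proof (rule closed_Union)
        show "finite A" by (rule finite_subset[OF _ fin]) (auto simp: A_def)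
      qed (simp add: closed_facet A_def)
      have clB: "closed (\<Union>B)"
      proof (rule closed_Union)
        show "finite B" by (rule finite_subset[OF _ fin]) (auto simp: B_def)
      qed (simp add: closed_facet B_def)
      have ext_ex: "\<exists>x. x extreme_point_of F" if "polytope F" "F \<noteq> {}" for F :: "'a set"
        using extreme_point_exists_convex[OF polytope_imp_compact polytope_imp_convex] that by metis
      have un: "rel_frontier Q = \<Union>A \<union> \<Union>B"
      proof -
        have "{F. F facet_of Q} = A \<union> B"
        proof (intro equalityI subsetI)
          fix F assume "F \<in> {F. F facet_of Q}"
          then have F: "F facet_of Q" by simp
          obtain x where "x extreme_point_of F" using ext_ex[OF fac(3,2)[OF F]] by blast
          then show "F \<in> A \<union> B" using F unfolding A_def B_def by blast
        qed (auto simp: A_def B_def)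
        then show ?thesis by (simp add: bd)
      qed
      have disj: "\<Union>A \<inter> \<Union>B = {}"
      proof (rule ccontr)
        assume "\<Union>A \<inter> \<Union>B \<noteq> {}"
        then obtain z F G where z: "F \<in> A" "G \<in> B" "z \<in> F" "z \<in> G" by blast
        have FG: "F facet_of Q" "G facet_of Q" using z by (auto simp: A_def B_def)
        have I: "(F \<inter> G) face_of Q" using fac(1)[OF FG(1)] fac(1)[OF FG(2)] by (rule face_of_Int)
        obtain e where e: "e extreme_point_of (F \<inter> G)"
          using ext_ex[OF face_of_polytope_polytope[OF poly I]] z by blast
        then have "e extreme_point_of Q" "e \<in> F" "e \<in> G" using ext_face[OF I] by auto
        then have eF: "e extreme_point_of F" and eG: "e extreme_point_of G"
          using ext_face[OF fac(1)[OF FG(1)]] ext_face[OF fac(1)[OF FG(2)]] by auto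
        obtain x where "x extreme_point_of F" "good x" using z(1) by (auto simp: A_def)
        then have ge: "good e" using IH[OF FG(1) _ _ eF] by blast
        obtain y where y: "y extreme_point_of G" "\<not> good y" using z(2) by (auto simp: B_def)
        then show False using IH[OF FG(2) eG ge] by blast
      qed
      have ne: "\<Union>A \<noteq> {}" "\<Union>B \<noteq> {}"
      proof -
        obtain F where "F facet_of Q" "v extreme_point_of F" using in_facet[OF v(1)] by blast
        then have "F \<in> A" "v \<in> F" using v(2) by (auto simp: A_def extreme_point_of_def)
        then show "\<Union>A \<noteq> {}" by blast
        obtain G where "G facet_of Q" "w extreme_point_of G" using in_facet[OF w] by blast
        then have "G \<in> B" "w \<in> G" using nw by (auto simp: B_def extreme_point_of_def)
        then show "\<Union>B \<noteq> {}" by blast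
      qed
      \<comment> \<open>This is where dimension at least two enters: the boundary of a segment is
        disconnected, hence the separate low-dimensional case above.\<close>
      have conn: "connected (rel_frontier Q)"
        by (rule connected_sphere_gen) (use comp False compact_imp_bounded in auto)
      have "\<Union>A \<inter> rel_frontier Q = {} \<or> \<Union>B \<inter> rel_frontier Q = {}"
        by (rule connected_closedD[OF conn _ _ clA clB]) (simp_all add: un disj)
      then show False using ne un by blast
    qed
  qed
qed

text \<open>Serves to lift an edge of a projection to a face of the polytope, to which the symmetry
  hypothesis applies.\<close>

lemma face_of_linear_vimage:
  assumes p: "linear p" and S: "convex S" and G: "G face_of (p ` S)"
  shows "{x \<in> S. p x \<in> G} face_of S"
  unfolding face_of_def
proof (intro conjI ballI impI)
  interpret linear p by fact
  have "convex (p -` G)" using G p by (intro convex_linear_vimage) (auto simp: face_of_imp_convex)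
  moreover have "{x \<in> S. p x \<in> G} = S \<inter> p -` G" by auto
  ultimately show "convex {x \<in> S. p x \<in> G}" using S by (simp add: convex_Int)
  fix a b x assume *: "a \<in> S" "b \<in> S" "x \<in> {x \<in> S. p x \<in> G}" "x \<in> open_segment a b"
  obtain t where t: "x = (1 - t) *\<^sub>R a + t *\<^sub>R b" "0 < t" "t < 1" using *(4) by (auto simp: in_segment)
  have px: "p x = (1 - t) *\<^sub>R p a + t *\<^sub>R p b" unfolding t(1) by (simp add: add scale)
  have "p a \<in> G \<and> p b \<in> G"
  proof (cases "p a = p b")
    case True
    then have "p x = p a" using px by (simp add: algebra_simps)
    then show ?thesis using True * by auto
  next
    case False
    then have "p x \<in> open_segment (p a) (p b)" using px t(2,3) by (auto simp: in_segment)
    then show ?thesis using face_ofD[OF G] * by blast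
  qed
  then show "a \<in> {x \<in> S. p x \<in> G}" "b \<in> {x \<in> S. p x \<in> G}" using * by auto
qed auto

text \<open>The reflection reverses the vector joining the endpoints. Within the segment this leaves
  room for only one position of their images, namely the opposite ends.\<close>

lemma symmetric_segment_endpoints:
  assumes "\<And>g. g \<in> closed_segment v w \<Longrightarrow> - g - s \<in> closed_segment v w" and "v \<noteq> w"
  shows "- v - s = w"
proof -
  have "- v - s \<in> closed_segment v w" "- w - s \<in> closed_segment v w" using assms(1) by auto
  then obtain \<alpha> \<beta> where \<alpha>: "- v - s = (1 - \<alpha>) *\<^sub>R v + \<alpha> *\<^sub>R w" "0 \<le> \<alpha>" "\<alpha> \<le> 1"
    and \<beta>: "- w - s = (1 - \<beta>) *\<^sub>R v + \<beta> *\<^sub>R w" "0 \<le> \<beta>" "\<beta> \<le> 1"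
    by (auto simp: in_segment)
  have "w - v = (- v - s) - (- w - s)" by simp
  also have "\<dots> = (\<alpha> - \<beta>) *\<^sub>R (w - v)" unfolding \<alpha>(1) \<beta>(1) by (simp add: algebra_simps)
  finally have "(\<alpha> - \<beta> - 1) *\<^sub>R (w - v) = 0" by (simp add: algebra_simps)
  then have "\<alpha> - \<beta> = 1" using assms(2) by simp
  then have "\<alpha> = 1" using \<alpha> \<beta> by linarith
  then show ?thesis using \<alpha>(1) by simp
qed

section \<open>Splitting off an edge as a Minkowski summand\<close>

context
  fixes \<Omega> :: "'a::euclidean_space set" and a u :: 'a
  assumes poly: "polytope \<Omega>" and sym: "symmetric_faces \<Omega>" and u: "u \<noteq> 0"
    and edge: "closed_segment a (a + u) face_of \<Omega>"
begin

private definition "\<Omega>0 = {x\<in>\<Omega>. x + u \<in> \<Omega>}"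

private lemma \<Omega>0_inter: "\<Omega>0 = \<Omega> \<inter> (+) (- u) ` \<Omega>"
proof (intro equalityI subsetI)
  fix x assume "x \<in> \<Omega>0"
  then show "x \<in> \<Omega> \<inter> (+) (- u) ` \<Omega>" unfolding \<Omega>0_def by (auto intro!: image_eqI[of _ _ "x + u"])
qed (auto simp: \<Omega>0_def)

private lemma \<Omega>_convex: "convex \<Omega>" using poly by (rule polytope_imp_convex)

private lemma polytope_\<Omega>0: "polytope \<Omega>0"
  unfolding \<Omega>0_inter by (intro polytope_Int poly) (simp only: polytope_translation_eq poly)

private lemma \<Omega>0_convex: "convex \<Omega>0" using polytope_\<Omega>0 by (rule polytope_imp_convex)

private lemma edge_ends: "a extreme_point_of \<Omega>" "(a + u) extreme_point_of \<Omega>"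
  using extreme_point_of_face[OF edge, of a] extreme_point_of_face[OF edge, of "a + u"]
  by (auto simp: extreme_point_of_segment)

text \<open>The image of \<open>\<Omega>0\<close> under the projection is convex, so once it
  contains all vertices it is the whole projection. Every point of \<open>\<Omega>\<close> then lies
  on a line in direction \<open>u\<close> that carries a full translate of the segment within
  \<open>\<Omega>\<close>.\<close>

private lemma segment_summand:
  assumes x: "x \<in> \<Omega>" shows "\<exists>y t. y \<in> \<Omega>0 \<and> 0 \<le> t \<and> t \<le> 1 \<and> x = y + t *\<^sub>R u"
proof -
  define p where "p x = x - ((x \<bullet> u) / (u \<bullet> u)) *\<^sub>R u" for x
  have uu: "u \<bullet> u > 0" using u by simp
  have p_lin: "linear p"
    unfolding p_def by (rule linearI) (simp_all add: inner_add_left add_divide_distrib algebra_simps)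
  interpret p: linear p by (rule p_lin)
  have p_u: "p u = 0" using u by (simp add: p_def)
  define Q where "Q = p ` \<Omega>"
  have Q: "polytope Q" unfolding Q_def using p_lin poly by (rule polytope_linear_image)
  define good where "good v \<longleftrightarrow> v \<in> p ` \<Omega>0" for v
  have good_a: "good (p a)"
  proof -
    have "a \<in> \<Omega>0" using edge_ends by (auto simp: \<Omega>0_def extreme_point_of_def)
    then show ?thesis by (auto simp: good_def)
  qed
  \<comment> \<open>The functional exposing the edge is constant on it, hence orthogonal to
    \<open>u\<close>. It therefore descends to the projection, where it exposes the single point
    \<open>p a\<close>.\<close>
  have ext_a: "p a extreme_point_of Q"
  proof -
    have "closed_segment a (a + u) exposed_face_of \<Omega>"
      using edge exposed_face_of_polyhedron polytope_imp_polyhedron[OF poly] by blast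
    then obtain c \<beta> where c: "\<Omega> \<subseteq> {x. c \<bullet> x \<le> \<beta>}" "closed_segment a (a + u) = \<Omega> \<inter> {x. c \<bullet> x = \<beta>}"
      unfolding exposed_face_of_def by blast
    have "a \<in> closed_segment a (a + u)" "a + u \<in> closed_segment a (a + u)" by simp_all
    then have "c \<bullet> a = \<beta>" "c \<bullet> (a + u) = \<beta>" unfolding c(2) by simp_all
    then have cu: "c \<bullet> u = 0" by (simp add: inner_add_right)
    have cp: "c \<bullet> p x = c \<bullet> x" for x by (simp add: p_def inner_diff_right cu)
    have "(Q \<inter> {x. c \<bullet> x = \<beta>}) face_of Q"
      by (rule face_of_Int_supporting_hyperplane_le) (use Q polytope_imp_convex c(1) cp in \<open>auto simp: Q_def\<close>)
    moreover have "Q \<inter> {x. c \<bullet> x = \<beta>} = {p a}"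
    proof (intro equalityI subsetI)
      fix y assume "y \<in> Q \<inter> {x. c \<bullet> x = \<beta>}"
      then obtain z where z: "y = p z" "z \<in> \<Omega>" "c \<bullet> z = \<beta>" by (auto simp: Q_def cp)
      then have "z \<in> closed_segment a (a + u)" using c(2) by blast
      then obtain t where "z = (1 - t) *\<^sub>R a + t *\<^sub>R (a + u)" by (auto simp: in_segment)
      then have "z = a + t *\<^sub>R u" by (simp add: algebra_simps)
      then show "y \<in> {p a}" using z(1) p_u by (simp add: p.add p.scale)
    next
      fix y assume "y \<in> {p a}"
      then show "y \<in> Q \<inter> {x. c \<bullet> x = \<beta>}"
        using edge_ends(1) \<open>c \<bullet> a = \<beta>\<close> by (auto simp: Q_def cp extreme_point_of_def)
    qed
    ultimately show ?thesis by (simp add: face_of_singleton)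
  qed
  \<comment> \<open>The reflection of the face over an edge projects to a reflection of that edge,
    which exchanges the ends. It carries \<open>y\<close> and \<open>y + u\<close> over one end to
    two points over the other end that again differ by \<open>u\<close>, in reverse order.\<close>
  have good_edge: "good w" if vw: "v \<noteq> w" "closed_segment v w face_of Q" "good v" for v w
  proof -
    define F where "F = {x \<in> \<Omega>. p x \<in> closed_segment v w}"
    have "F face_of \<Omega>" unfolding F_def using face_of_linear_vimage[OF p_lin \<Omega>_convex] vw(2) by (simp add: Q_def)
    then have "centrally_symmetric F" using sym by (simp add: symmetric_faces_def)
    then obtain t where t: "\<And>x. x \<in> F \<Longrightarrow> - x - t \<in> F" unfolding centrally_symmetric_iff by blast
    have refl: "- v - p t = w"
    proof (rule symmetric_segment_endpoints[OF _ vw(1)])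
      fix g assume g: "g \<in> closed_segment v w"
      then obtain x where "x \<in> \<Omega>" "g = p x" using face_of_imp_subset[OF vw(2)] by (auto simp: Q_def)
      then have "x \<in> F" using g by (simp add: F_def)
      then have "p (- x - t) \<in> closed_segment v w" using t by (simp add: F_def)
      then show "- g - p t \<in> closed_segment v w" using \<open>g = p x\<close> by (simp add: p.diff p.neg)
    qed
    obtain y where y: "y \<in> \<Omega>" "y + u \<in> \<Omega>" "v = p y" using vw(3) by (auto simp: good_def \<Omega>0_def)
    have "y \<in> F" "y + u \<in> F" using y p_u by (auto simp: F_def p.add)
    then have "- y - t \<in> F" "- (y + u) - t \<in> F" using t by blast+
    then have "- (y + u) - t \<in> \<Omega>0" by (simp add: \<Omega>0_def F_def)
    moreover have "p (- (y + u) - t) = w" using refl y(3) p_u by (simp add: p.diff p.neg p.add)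
    ultimately show ?thesis unfolding good_def by blast
  qed
  have "good w" if "w extreme_point_of Q" for w
    by (rule polytope_vertices_propagate[where good = good, OF Q good_edge ext_a good_a that])
  then have "{w. w extreme_point_of Q} \<subseteq> p ` \<Omega>0" by (auto simp: good_def)
  moreover have "convex (p ` \<Omega>0)" using \<Omega>0_convex p_lin by (rule convex_linear_image[rotated])
  ultimately have "convex hull {w. w extreme_point_of Q} \<subseteq> p ` \<Omega>0" by (rule hull_minimal)
  then have "Q \<subseteq> p ` \<Omega>0"
    using Krein_Milman_Minkowski[OF polytope_imp_compact[OF Q] polytope_imp_convex[OF Q]] by simp
  then obtain y where y: "y \<in> \<Omega>0" "p x = p y" using x by (auto simp: Q_def)
  have y': "y \<in> \<Omega>" "y + u \<in> \<Omega>" using y(1) by (auto simp: \<Omega>0_def)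
  define r where "r = (x \<bullet> u) / (u \<bullet> u) - (y \<bullet> u) / (u \<bullet> u)"
  have xy: "x = y + r *\<^sub>R u" using y(2) by (simp add: p_def r_def algebra_simps)
  have seg: "y + s *\<^sub>R u \<in> \<Omega>" if s: "y + b *\<^sub>R u \<in> \<Omega>" "y + c *\<^sub>R u \<in> \<Omega>" "b \<le> s" "s \<le> c" for b c s
  proof (cases "b = c")
    case False
    define r' where "r' = (s - b) / (c - b)"
    have l: "0 \<le> r'" "r' \<le> 1" "r' * (c - b) = s - b" using s(3,4) False by (auto simp: r'_def field_simps)
    have "(1 - r') *\<^sub>R (y + b *\<^sub>R u) + r' *\<^sub>R (y + c *\<^sub>R u) = y + (b + r' * (c - b)) *\<^sub>R u"
      by (simp add: algebra_simps)
    then show ?thesis using convexD_alt[OF \<Omega>_convex s(1,2) l(1,2)] l(3) by simp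
  qed (use s in auto)
  \<comment> \<open>\<open>x\<close> lies on the line through \<open>y\<close> and
    \<open>y + u\<close>. The base point is \<open>x\<close> itself if \<open>x\<close> comes before
    \<open>y\<close>, it is \<open>y\<close> if \<open>x\<close> is between the two, and
    \<open>x - u\<close> if \<open>x\<close> is beyond \<open>y + u\<close>; convexity along the
    line supplies the missing endpoint.\<close>
  consider "r < 0" | "0 \<le> r" "r \<le> 1" | "r > 1" by linarith
  then show ?thesis
  proof cases
    case 1
    have "y + (r + 1) *\<^sub>R u \<in> \<Omega>" using seg[of r 1 "r + 1"] 1 x xy y' by simp
    then have "x + u \<in> \<Omega>" by (simp add: xy algebra_simps)
    then have "x \<in> \<Omega>0" using x by (simp add: \<Omega>0_def)
    then show ?thesis by (intro exI[of _ x] exI[of _ 0]) simp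
  next
    case 2
    then show ?thesis using y(1) xy by blast
  next
    case 3
    have "y + (r - 1) *\<^sub>R u \<in> \<Omega>" using seg[of 0 r "r - 1"] 3 x xy y' by simp
    then have "x - u \<in> \<Omega>" by (simp add: xy algebra_simps)
    then have "x - u \<in> \<Omega>0" using x by (simp add: \<Omega>0_def)
    then show ?thesis by (intro exI[of _ "x - u"] exI[of _ 1]) simp
  qed
qed

text \<open>The face of a Minkowski sum in direction \<open>c\<close> is the sum of the faces of the
  summands. The segment contributes its end \<open>u\<close>, its end 0 or all of itself according
  to the sign of \<open>c \<bullet> u\<close>; accordingly \<open>F\<close> is the translate of
  \<open>F1\<close> by \<open>u\<close>, or equal to \<open>F1\<close>, or has \<open>F1\<close> as
  its erosion by \<open>u\<close>.\<close>

private lemma symmetric_faces_summand: "symmetric_faces \<Omega>0"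
  unfolding symmetric_faces_def
proof (intro allI impI)
  fix F1 assume F1: "F1 face_of \<Omega>0"
  show "centrally_symmetric F1"
  proof (cases "F1 = {}")
    case True then show ?thesis by (simp add: centrally_symmetric_def)
  next
    case False
    have "F1 exposed_face_of \<Omega>0"
      using F1 exposed_face_of_polyhedron polytope_imp_polyhedron[OF polytope_\<Omega>0] by blast
    then obtain c \<beta> where c: "\<Omega>0 \<subseteq> {x. c \<bullet> x \<le> \<beta>}" "F1 = \<Omega>0 \<inter> {x. c \<bullet> x = \<beta>}"
      unfolding exposed_face_of_def by blast
    \<comment> \<open>Maximum of \<open>c\<close> over \<open>\<Omega>\<close>: the maximum over
      \<open>\<Omega>0\<close> plus that over the segment.\<close>
    define m where "m = \<beta> + max 0 (c \<bullet> u)"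
    define F where "F = \<Omega> \<inter> {x. c \<bullet> x = m}"
    have le: "c \<bullet> y \<le> \<beta>" if "y \<in> \<Omega>0" for y using c(1) that by auto
    have tm: "t * (c \<bullet> u) \<le> max 0 (c \<bullet> u)" if "0 \<le> t" "t \<le> 1" for t
    proof (cases "c \<bullet> u \<ge> 0")
      case True then show ?thesis using that by (simp add: mult_left_le_one_le)
    next
      case False then show ?thesis using that by (simp add: mult_nonneg_nonpos)
    qed
    have "F face_of \<Omega>"
      unfolding F_def
    proof (rule face_of_Int_supporting_hyperplane_le[OF \<Omega>_convex])
      fix x assume "x \<in> \<Omega>"
      then obtain y t where "y \<in> \<Omega>0" "0 \<le> t" "t \<le> 1" "x = y + t *\<^sub>R u" using segment_summand by blast
      then show "c \<bullet> x \<le> m" using le[of y] tm[of t] by (simp add: m_def inner_add_right)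
    qed
    then have "centrally_symmetric F" using sym by (simp add: symmetric_faces_def)
    then obtain s where s: "\<And>x. x \<in> F \<Longrightarrow> - x - s \<in> F" unfolding centrally_symmetric_iff by blast
    consider "c \<bullet> u > 0" | "c \<bullet> u < 0" | "c \<bullet> u = 0" by linarith
    then show ?thesis
    proof cases
      case 1
      have "x + u \<in> F \<longleftrightarrow> x \<in> F1" for x
      proof
        assume "x + u \<in> F"
        then have xu: "x + u \<in> \<Omega>" "c \<bullet> (x + u) = \<beta> + c \<bullet> u" using 1 by (auto simp: F_def m_def)
        then obtain y t where y: "y \<in> \<Omega>0" "0 \<le> t" "t \<le> 1" "x + u = y + t *\<^sub>R u" using segment_summand by blast
        have "\<beta> + c \<bullet> u = c \<bullet> y + t * (c \<bullet> u)" using xu(2) y(4) by (simp add: inner_add_right)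
        then have "1 * (c \<bullet> u) \<le> t * (c \<bullet> u)" using le[OF y(1)] by simp
        then have "t = 1" using 1 y(3) by (simp add: mult_le_cancel_right)
        then have "x = y" using y(4) by simp
        then show "x \<in> F1" using y(1) xu(2) by (simp add: c(2) inner_add_right)
      next
        assume "x \<in> F1"
        then show "x + u \<in> F" using 1 by (auto simp: c(2) F_def m_def \<Omega>0_def inner_add_right)
      qed
      moreover have "- (x + u) - s \<in> F" if "x + u \<in> F" for x using s that by blast
      moreover have "- (x + u) - s = (- x - (s + 2 *\<^sub>R u)) + u" for x by (simp add: algebra_simps scaleR_2)
      ultimately have "- x - (s + 2 *\<^sub>R u) \<in> F1" if "x \<in> F1" for x using that by metis
      then show ?thesis unfolding centrally_symmetric_iff by blast
    next
      case 2
      have "F = F1"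
      proof (intro equalityI subsetI)
        fix x assume "x \<in> F"
        then have x: "x \<in> \<Omega>" "c \<bullet> x = \<beta>" using 2 by (auto simp: F_def m_def)
        then obtain y t where y: "y \<in> \<Omega>0" "0 \<le> t" "t \<le> 1" "x = y + t *\<^sub>R u" using segment_summand by blast
        have "\<beta> = c \<bullet> y + t * (c \<bullet> u)" using x(2) y(4) by (simp add: inner_add_right)
        then have "0 \<le> t * (c \<bullet> u)" using le[OF y(1)] by simp
        then have "t = 0" using 2 y(2) by (simp add: zero_le_mult_iff)
        then show "x \<in> F1" using y x(2) by (simp add: c(2))
      qed (use 2 in \<open>auto simp: c(2) F_def m_def \<Omega>0_def\<close>)
      then show ?thesis using s unfolding centrally_symmetric_iff by blast
    next
      case 3
      \<comment> \<open>The reflection of \<open>F\<close> takes the pair \<open>x\<close>,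
        \<open>x + u\<close> to a pair in reverse order; hence \<open>s + u\<close> in place of
        \<open>s\<close>.\<close>
      have F1_iff: "x \<in> F1 \<longleftrightarrow> x \<in> F \<and> x + u \<in> F" for x
        using 3 by (auto simp: c(2) F_def m_def \<Omega>0_def inner_add_right)
      have "- x - (s + u) \<in> F1" if "x \<in> F1" for x
      proof -
        have "- (x + u) - s \<in> F" "- x - s \<in> F" using that s F1_iff by blast+
        moreover have "- (x + u) - s = - x - (s + u)" "- x - s = (- x - (s + u)) + u" by simp_all
        ultimately show ?thesis using F1_iff by metis
      qed
      then show ?thesis unfolding centrally_symmetric_iff by blast
    qed
  qed
qed

text \<open>If neither point were a vertex, \<open>x\<close> and \<open>x + u\<close> would both be
  reached from points of \<open>\<Omega>0\<close> on their line: the one for \<open>x\<close> lies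
  strictly before \<open>x\<close>, the one for \<open>x + u\<close> strictly after
  \<open>x\<close>. Then \<open>x\<close> would be interior to a segment of
  \<open>\<Omega>0\<close>.\<close>

private lemma extreme_summand:
  assumes x: "x extreme_point_of \<Omega>0"
  shows "x extreme_point_of \<Omega> \<or> (x + u) extreme_point_of \<Omega>"
proof (rule ccontr)
  assume "\<not> ?thesis"
  then have n: "\<not> x extreme_point_of \<Omega>" "\<not> (x + u) extreme_point_of \<Omega>" by auto
  have x1: "x \<in> \<Omega>0" and ext: "\<And>a b. a \<in> \<Omega>0 \<Longrightarrow> b \<in> \<Omega>0 \<Longrightarrow> x \<notin> open_segment a b"
    using x by (auto simp: extreme_point_of_def)
  \<comment> \<open>Decomposing both ends of a segment through \<open>z\<close> and averaging gives
    a decomposition of \<open>z\<close>. An extreme value 0 or 1 of \<open>\<tau>\<close> forces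
    both parameters to that value and puts \<open>z\<close>, respectively \<open>z - u\<close>,
    strictly inside a segment of \<open>\<Omega>0\<close>. This excludes 0 in the application to
    \<open>x\<close> and 1 in that to \<open>x + u\<close>.\<close>
  have dec: thesis
    if z: "z \<in> \<Omega>" "\<not> z extreme_point_of \<Omega>"
      and *: "\<And>m \<tau> y1 y2. m \<in> \<Omega>0 \<Longrightarrow> y1 \<in> \<Omega>0 \<Longrightarrow> y2 \<in> \<Omega>0 \<Longrightarrow> z = m + \<tau> *\<^sub>R u \<Longrightarrow> 0 \<le> \<tau> \<Longrightarrow> \<tau> \<le> 1 \<Longrightarrow>
        \<tau> = 0 \<longrightarrow> z \<in> open_segment y1 y2 \<Longrightarrow> \<tau> = 1 \<longrightarrow> z - u \<in> open_segment y1 y2 \<Longrightarrow> thesis"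
    for z thesis
  proof -
    obtain p q where pq: "p \<in> \<Omega>" "q \<in> \<Omega>" "z \<in> open_segment p q" using z by (auto simp: extreme_point_of_def)
    obtain s where s: "p \<noteq> q" "0 < s" "s < 1" "z = (1 - s) *\<^sub>R p + s *\<^sub>R q" using pq(3) by (auto simp: in_segment)
    obtain y1 t1 where y1: "y1 \<in> \<Omega>0" "0 \<le> t1" "t1 \<le> 1" "p = y1 + t1 *\<^sub>R u" using segment_summand[OF pq(1)] by blast
    obtain y2 t2 where y2: "y2 \<in> \<Omega>0" "0 \<le> t2" "t2 \<le> 1" "q = y2 + t2 *\<^sub>R u" using segment_summand[OF pq(2)] by blast
    define m where "m = (1 - s) *\<^sub>R y1 + s *\<^sub>R y2"
    define \<tau> where "\<tau> = (1 - s) * t1 + s * t2"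
    have m: "m \<in> \<Omega>0" unfolding m_def using convexD_alt[OF \<Omega>0_convex y1(1) y2(1)] s by simp
    have zm: "z = m + \<tau> *\<^sub>R u" unfolding s(4) y1(4) y2(4) m_def \<tau>_def by (simp add: algebra_simps)
    have 0: "0 \<le> \<tau>" using s y1 y2 by (simp add: \<tau>_def)
    have one: "1 - \<tau> = (1 - s) * (1 - t1) + s * (1 - t2)" by (simp add: \<tau>_def algebra_simps)
    have 1: "\<tau> \<le> 1" using one s y1 y2 by (smt (verit) mult_nonneg_nonneg)
    have "z \<in> open_segment y1 y2" if "\<tau> = 0"
    proof -
      have "(1 - s) * t1 = 0" "s * t2 = 0"
        using that s y1(2) y2(2) mult_nonneg_nonneg[of "1 - s" t1] mult_nonneg_nonneg[of s t2] unfolding \<tau>_def by linarith+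
      then have "t1 = 0" "t2 = 0" using s by auto
      then show ?thesis using pq(3) y1(4) y2(4) by simp
    qed
    moreover have "z - u \<in> open_segment y1 y2" if "\<tau> = 1"
    proof -
      have "(1 - s) * (1 - t1) = 0" "s * (1 - t2) = 0"
        using that one s y1(3) y2(3) mult_nonneg_nonneg[of "1 - s" "1 - t1"] mult_nonneg_nonneg[of s "1 - t2"] by linarith+
      then have "t1 = 1" "t2 = 1" using s by auto
      then have "z - u = m" "y1 \<noteq> y2" using zm that s(1) y1(4) y2(4) by auto
      then show ?thesis using s unfolding m_def by (auto simp: in_segment)
    qed
    ultimately show thesis by (intro *[OF m y1(1) y2(1) zm 0 1] impI)
  qed
  have x\<Omega>: "x \<in> \<Omega>" "x + u \<in> \<Omega>" using x1 by (auto simp: \<Omega>0_def)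
  obtain m \<tau> y1 y2 where my: "m \<in> \<Omega>0" "y1 \<in> \<Omega>0" "y2 \<in> \<Omega>0" "x = m + \<tau> *\<^sub>R u" "0 \<le> \<tau>"
      "\<tau> = 0 \<longrightarrow> x \<in> open_segment y1 y2"
    by (rule dec[OF x\<Omega>(1) n(1)], rule that) assumption+
  have m: "m \<in> \<Omega>0" "x = m + \<tau> *\<^sub>R u" "\<tau> > 0"
    using my ext[OF my(2,3)] by (auto simp: order.order_iff_strict)
  obtain m' \<tau>' z1 z2 where my': "m' \<in> \<Omega>0" "z1 \<in> \<Omega>0" "z2 \<in> \<Omega>0" "x + u = m' + \<tau>' *\<^sub>R u" "\<tau>' \<le> 1"
      "\<tau>' = 1 \<longrightarrow> x + u - u \<in> open_segment z1 z2"
    by (rule dec[OF x\<Omega>(2) n(2)], rule that) assumption+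
  have m': "m' \<in> \<Omega>0" "x + u = m' + \<tau>' *\<^sub>R u" "\<tau>' < 1"
    using my' ext[OF my'(2,3)] by (auto simp: order.order_iff_strict)
  \<comment> \<open>The distance from \<open>m\<close> to \<open>m'\<close> in units of
    \<open>u\<close>; \<open>l\<close> is the relative position of \<open>x\<close> between
    them.\<close>
  define d where "d = \<tau> + (1 - \<tau>')"
  have d: "d > 0" using m m' by (simp add: d_def)
  define l where "l = \<tau> / d"
  have l: "0 < l" "l < 1" using m(3) m'(3) by (auto simp: l_def d_def)
  have m'_eq: "m' = m + d *\<^sub>R u" using m(2) m'(2) by (simp add: d_def algebra_simps)
  then have "m \<noteq> m'" using d u by simp
  moreover have "x = (1 - l) *\<^sub>R m + l *\<^sub>R m'"
  proof -
    have "(1 - l) *\<^sub>R m + l *\<^sub>R m' = m + (l * d) *\<^sub>R u" unfolding m'_eq by (simp add: algebra_simps)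
    also have "l * d = \<tau>" using d by (simp add: l_def)
    finally show ?thesis using m(2) by simp
  qed
  ultimately have "x \<in> open_segment m m'" using l by (auto simp: in_segment)
  then show False using ext m(1) m'(1) by blast
qed

text \<open>This is the termination measure. A vertex z of \<open>\<Omega>\<close> cannot have both
  \<open>z - u\<close> and \<open>z + u\<close> in \<open>\<Omega>\<close>. So the map that takes
  \<open>x\<close> to \<open>x\<close> if this is a vertex of \<open>\<Omega>\<close>, and to
  \<open>x + u\<close> otherwise, is injective and misses \<open>a + u\<close>.\<close>

private lemma card_extreme_points_summand:
  "card {x. x extreme_point_of \<Omega>0} < card {x. x extreme_point_of \<Omega>}"
proof -
  define \<phi> where "\<phi> x = (if x extreme_point_of \<Omega> then x else x + u)" for x
  have fin: "finite {x. x extreme_point_of \<Omega>}"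
    using polytope_imp_polyhedron[OF poly] by (rule finite_polyhedron_extreme_points)
  have mid: "\<not> z extreme_point_of \<Omega>" if "z - u \<in> \<Omega>" "z + u \<in> \<Omega>" for z
  proof -
    have "(1/2) *\<^sub>R z + (1/2) *\<^sub>R z = z" unfolding scaleR_add_left[symmetric] by simp
    then have "z = (1 - 1/2) *\<^sub>R (z - u) + (1/2) *\<^sub>R (z + u)" by (simp add: algebra_simps)
    moreover have "z - u \<noteq> z + u"
    proof
      assume "z - u = z + u"
      then have "u + u = 0" by (simp add: algebra_simps)
      then show False using u by (simp add: scaleR_2[symmetric])
    qed
    ultimately have "z \<in> open_segment (z - u) (z + u)" unfolding in_segment by (intro conjI exI[of _ "1/2"]) auto
    then show ?thesis using that by (auto simp: extreme_point_of_def)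
  qed
  have in1: "x \<in> \<Omega>" "x + u \<in> \<Omega>" if "x extreme_point_of \<Omega>0" for x
    using that by (auto simp: extreme_point_of_def \<Omega>0_def)
  have aux: "x = y" if "x extreme_point_of \<Omega>0" "y extreme_point_of \<Omega>0" "\<phi> x = \<phi> y" "x extreme_point_of \<Omega>" for x y
  proof (cases "y extreme_point_of \<Omega>")
    case False
    then have "x = y + u" using that by (simp add: \<phi>_def)
    then have "\<not> x extreme_point_of \<Omega>" using mid[of x] in1[OF that(1)] in1[OF that(2)] by simp
    then show ?thesis using that(4) by blast
  qed (use that in \<open>simp add: \<phi>_def\<close>)
  have "inj_on \<phi> {x. x extreme_point_of \<Omega>0}"
  proof (rule inj_onI)
    fix x y assume xy: "x \<in> {x. x extreme_point_of \<Omega>0}" "y \<in> {x. x extreme_point_of \<Omega>0}" "\<phi> x = \<phi> y"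
    show "x = y"
    proof (cases "x extreme_point_of \<Omega> \<or> y extreme_point_of \<Omega>")
      case True
      then show ?thesis using aux[of x y] aux[of y x] xy by auto
    next
      case False
      then show ?thesis using xy(3) by (simp add: \<phi>_def)
    qed
  qed
  moreover have "\<phi> ` {x. x extreme_point_of \<Omega>0} \<subseteq> {x. x extreme_point_of \<Omega>} - {a + u}"
  proof
    fix y assume "y \<in> \<phi> ` {x. x extreme_point_of \<Omega>0}"
    then obtain x where x: "x extreme_point_of \<Omega>0" "y = \<phi> x" by blast
    have "y extreme_point_of \<Omega>" using extreme_summand[OF x(1)] by (auto simp: x(2) \<phi>_def)
    moreover have "y \<noteq> a + u"
    proof
      assume y: "y = a + u"
      show False
      proof (cases "x extreme_point_of \<Omega>")
        case True
        then have "x = a + u" using x(2) y by (simp add: \<phi>_def)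
        moreover have "a \<in> \<Omega>" using edge_ends(1) by (simp add: extreme_point_of_def)
        ultimately show False using mid[of x] in1[OF x(1)] True by simp
      next
        case False
        then have "x = a" using x(2) y by (simp add: \<phi>_def)
        then show False using False edge_ends(1) by simp
      qed
    qed
    ultimately show "y \<in> {x. x extreme_point_of \<Omega>} - {a + u}" by simp
  qed
  ultimately have "card {x. x extreme_point_of \<Omega>0} \<le> card ({x. x extreme_point_of \<Omega>} - {a + u})"
    using fin by (intro card_inj_on_le) auto
  also have "\<dots> < card {x. x extreme_point_of \<Omega>}"
    using fin edge_ends(2) by (intro card_Diff1_less) auto
  finally show ?thesis .
qed

lemmas summand_facts = polytope_\<Omega>0[unfolded \<Omega>0_def] symmetric_faces_summand[unfolded \<Omega>0_def]
  card_extreme_points_summand[unfolded \<Omega>0_def] segment_summand[unfolded \<Omega>0_def]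

end

text \<open>The induction runs over the number of vertices because removing a segment summand need
  not lower the dimension. A single point is a translate of the zonotope without generators.\<close>

theorem symmetric_faces_imp_zonotope:
  fixes \<Omega> :: "'a::euclidean_space set"
  assumes "polytope \<Omega>" "symmetric_faces \<Omega>" "\<Omega> \<noteq> {}"
  shows "\<exists>c us. \<Omega> = (+) c ` zonotope us"
  using assms
proof (induction "card {x. x extreme_point_of \<Omega>}" arbitrary: \<Omega> rule: less_induct)
  case less
  show ?case
  proof (cases "aff_dim \<Omega> \<ge> 1")
    case False
    then have "aff_dim \<Omega> = 0" using less.prems(3) aff_dim_negative_iff[of \<Omega>] by linarith
    then obtain c where "\<Omega> = {c}" using aff_dim_eq_0 by blast
    then have "\<Omega> = (+) c ` zonotope []" by simp
    then show ?thesis by blast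
  next
    case True
    obtain a b where ab: "a \<noteq> b" "closed_segment a b face_of \<Omega>"
      using polytope_edge_exists[OF less.prems(1) True] by blast
    define u where "u = b - a"
    have u: "u \<noteq> 0" "closed_segment a (a + u) face_of \<Omega>" using ab by (auto simp: u_def)
    define \<Omega>0 where "\<Omega>0 = {x\<in>\<Omega>. x + u \<in> \<Omega>}"
    note facts = summand_facts[OF less.prems(1,2) u, folded \<Omega>0_def]
    have "\<Omega>0 \<noteq> {}" using facts(4) less.prems(3) by blast
    then obtain c us where \<Omega>0: "\<Omega>0 = (+) c ` zonotope us" using less.hyps[OF facts(3,1,2)] by blast
    have "\<Omega> = (+) c ` zonotope (u # us)"
    proof (intro equalityI subsetI)
      fix x assume "x \<in> \<Omega>"
      then obtain y t where "y \<in> \<Omega>0" "0 \<le> t" "t \<le> 1" "x = y + t *\<^sub>R u" using facts(4) by blast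
      then obtain z where "z \<in> zonotope us" "x = c + (z + t *\<^sub>R u)" using \<Omega>0 by (auto simp: add.assoc)
      then show "x \<in> (+) c ` zonotope (u # us)" using \<open>0 \<le> t\<close> \<open>t \<le> 1\<close> by auto
    next
      fix x assume "x \<in> (+) c ` zonotope (u # us)"
      then obtain z t where z: "z \<in> zonotope us" "0 \<le> t" "t \<le> 1" "x = (c + z) + t *\<^sub>R u" by (auto simp: add.assoc)
      then have "c + z \<in> \<Omega>0" using \<Omega>0 by blast
      then have "c + z \<in> \<Omega>" "c + z + u \<in> \<Omega>" by (auto simp: \<Omega>0_def)
      from convexD_alt[OF polytope_imp_convex[OF less.prems(1)] this z(2,3)]
      show "x \<in> \<Omega>" by (simp add: z(4) algebra_simps)
    qed
    then show ?thesis by blast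
  qed
qed

theorem theorem1p1:
  fixes \<Omega> :: "'a::euclidean_space set"
  assumes "polytope \<Omega>"
    and "interior \<Omega> \<noteq> {}"
    and "centrally_symmetric \<Omega>"
    and "\<And>F. F face_of \<Omega> \<Longrightarrow> centrally_symmetric F"
  shows "\<exists>\<Lambda>::'a set. L2_riesz_basis (lebesgue_on \<Omega>) \<Lambda> exponential"
proof -
  have "symmetric_faces \<Omega>" "\<Omega> \<noteq> {}" using assms by (auto simp: symmetric_faces_def)
  then obtain c us where \<Omega>: "\<Omega> = (+) c ` zonotope us"
    using symmetric_faces_imp_zonotope[OF assms(1)] by blast
  have meas: "S \<in> sets lebesgue" "bounded S" if "compact S" for S :: "'a set"
    using that by (auto intro: compact_imp_bounded lmeasurable_compact fmeasurableD)
  obtain \<Lambda> where "exp_riesz (zonotope us) \<Lambda>" using exp_riesz_zonotope by blast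
  then have "exp_riesz \<Omega> \<Lambda>"
    unfolding \<Omega> by (rule exp_riesz_translation) (rule meas[OF compact_zonotope])+
  then have "L2_riesz_basis (lebesgue_on \<Omega>) \<Lambda> exponential"
    by (rule exp_riesz_imp_riesz_basis) (rule meas[OF polytope_imp_compact[OF assms(1)]])+
  then show ?thesis by blast
qed

end
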